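(* Let $q\geqslant 1$ and $a$ be integers with $\gcd(a,q)=1$, and let $x\geqslant y\geqslant 2$ be real. Then \[ \left|S_{a,q}(x,y)\right| \leqslant x^{1+o(1)}\left(\min\{x^{-1/5},(x/y)^{-1/4}\} + q^{-1/2} + (x/q)^{-1/2}\right), \] where $o(1)$ denotes a quantity tending to $0$ as $x\to\infty$, uniformly in $y$, $a$ and $q$.
   Context: For an integer $n\geqslant 1$, $P(n)$ denotes its largest prime divisor, with $P(1)=1$. For $x\geqslant y\geqslant 2$, ${\mathcal S}(x,y)=\{n\in[1,x]\cap\mathbb{Z}: P(n)\leqslant y\}$ is the set of $y$-smooth integers up to $x$. Write $\mathbf{e}_q(z)=\exp(2\pi i z/q)$ and \[ S_{a,q}(x,y)=\sum_{n\in{\mathcal S}(x,y)}\mathbf{e}_q(an). \] *)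

theory Defs
  imports Complex_Main "HOL-Computational_Algebra.Primes"
begin

definition largest_prime_divisor :: "nat \<Rightarrow> nat" where
  "largest_prime_divisor n = (if n = 1 then 1 else Max {p. prime p \<and> p dvd n})"

definition smooth_upto :: "real \<Rightarrow> real \<Rightarrow> nat set" where
  "smooth_upto x y = {n. 1 \<le> n \<and> real n \<le> x \<and> real (largest_prime_divisor n) \<le> y}"

definition e_mod :: "int \<Rightarrow> complex \<Rightarrow> complex" where
  "e_mod q z = exp (2 * of_real pi * \<i> * z / of_int q)"

definition smooth_exp_sum :: "int \<Rightarrow> int \<Rightarrow> real \<Rightarrow> real \<Rightarrow> complex" where
  "smooth_exp_sum a q x y = (\<Sum>n\<in>smooth_upto x y. e_mod q (of_int (a * int n)))"

end

theory Submission
  imports Defs "HOL-Library.Discrete_Functions" "HOL-Analysis.Analysis"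
begin

text \<open>
  Write \<open>z = x\<^bsup>1/5\<^esup>\<close>. Bilinear sums over products \<open>v w \<le> x\<close> with \<open>v\<close> in a dyadic interval around \<open>M\<close> are
  bounded by Cauchy--Schwarz and orthogonality modulo \<open>q\<close>; side conditions \<open>\<psi> b < \<phi> a\<close> coupling the two
  variables cost only a logarithm. This is admissible for \<open>z\<^sup>2 < v \<le> z\<^sup>3\<close> (type II), while sums over
  \<open>v k\<close> with \<open>k\<close> running through an interval are geometric and admissible for \<open>v \<le> z\<^sup>4\<close> (type I).

  A number with prime factors at most \<open>y\<close> that exceeds \<open>U\<close> has a divisor in \<open>(U, U y]\<close>, obtained by
  multiplying its primes in increasing order. For \<open>y \<le> z\<close> this puts the whole sum into type II form.
  The same device applied to the Legendre sieve bounds sums over \<open>a b k\<close> with \<open>k\<close> free of prime factors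
  up to \<open>z\<close>, \<open>a \<le> z\<^sup>3\<close> and \<open>b \<le> z\<^sup>2\<close>. For \<open>y > z\<close> one splits by the largest prime factors, and whatever is
  neither type I nor type II is reduced by Buchstab-like identities to such sieved sums.
  All losses are powers of \<open>log x\<close> and of the maximum of the divisor function, hence \<open>x\<^bsup>o(1)\<^esup>\<close>.
\<close>

text \<open>A type II sum with \<open>v\<close> in \<open>(U, W]\<close> has main error
  \<open>sqrt (x * V)\<close>, where \<open>V\<close> is the larger of \<open>W\<close> and
  \<open>x / U\<close>. Cutting a \<open>y\<close>-smooth number gives \<open>W = U * y\<close>, and
  \<open>U = sqrt (x / y)\<close> balances the two, which yields x (x/y)^(-1/4). At y = x^(1/5) this
  has grown to x^(4/5); from there on the interval \<open>(z ^ 2, z ^ 3]\<close> is kept fixed. The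
  obstacle for larger \<open>y\<close> is that a number need not have any divisor in that interval:
  take a prime beyond \<open>z ^ 4\<close> times a cofactor below \<open>z\<close>. For such numbers
  the bilinear structure is created by sieving the large prime only up to \<open>z\<close>. The
  sieve divisors are \<open>z\<close>-smooth, so either they can be cut or everything is short
  enough for type I. What has been counted in excess is a product of several primes above
  \<open>z\<close>, and then a subproduct falls into the interval, or a factor is below
  \<open>z ^ 2\<close>, where roughness and primality agree.\<close>

section \<open>Bilinear forms and chain conditions\<close>

text \<open>\<open>D\<close> bounds the l2 operator norm of the matrix \<open>T\<close>. Quantifying
  over all coefficients allows the matrix to be cut into blocks and reassembled when side conditions
  are imposed.\<close>

definition bilinear_bound :: "'a set \<Rightarrow> 'b set \<Rightarrow> ('a \<Rightarrow> 'b \<Rightarrow> complex) \<Rightarrow> real \<Rightarrow> bool" where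
  "bilinear_bound A B T D \<longleftrightarrow> 0 \<le> D \<and> (\<forall>\<alpha> \<beta>.
     norm (\<Sum>a\<in>A. \<Sum>b\<in>B. \<alpha> a * \<beta> b * T a b)
       \<le> D * L2_set (\<lambda>a. norm (\<alpha> a)) A * L2_set (\<lambda>b. norm (\<beta> b)) B)"

lemma bilinear_boundD:
  assumes "bilinear_bound A B T D"
  shows "norm (\<Sum>a\<in>A. \<Sum>b\<in>B. \<alpha> a * \<beta> b * T a b)
       \<le> D * L2_set (\<lambda>a. norm (\<alpha> a)) A * L2_set (\<lambda>b. norm (\<beta> b)) B"
  using assms unfolding bilinear_bound_def by blast

lemma bilinear_bound_nonneg: "bilinear_bound A B T D \<Longrightarrow> 0 \<le> D"
  unfolding bilinear_bound_def by blast

lemma bilinear_bound_cong: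
  assumes "bilinear_bound A B T D" "\<And>a b. a \<in> A \<Longrightarrow> b \<in> B \<Longrightarrow> T a b = T' a b"
  shows "bilinear_bound A B T' D"
proof -
  have "(\<Sum>a\<in>A. \<Sum>b\<in>B. \<alpha> a * \<beta> b * T' a b) = (\<Sum>a\<in>A. \<Sum>b\<in>B. \<alpha> a * \<beta> b * T a b)"
    for \<alpha> :: "'a \<Rightarrow> complex" and \<beta> :: "'b \<Rightarrow> complex"
    using assms(2) by (intro sum.cong refl) auto
  then show ?thesis using assms(1) unfolding bilinear_bound_def by simp
qed

lemma L2_set_restrict:
  assumes "finite A" "A' \<subseteq> A"
  shows "L2_set (\<lambda>a. norm (if a \<in> A' then f a else (0::complex))) A = L2_set (\<lambda>a. norm (f a)) A'"
  unfolding L2_set_def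
  by (rule arg_cong[where f=sqrt], rule sum.mono_neutral_cong_right) (use assms in auto)

lemma bilinear_bound_subset:
  assumes b: "bilinear_bound A B T D" and f: "finite A" "finite B" and s: "A' \<subseteq> A" "B' \<subseteq> B"
  shows "bilinear_bound A' B' T D"
  unfolding bilinear_bound_def
proof (intro conjI allI)
  show "0 \<le> D" using bilinear_bound_nonneg[OF b] .
  fix \<alpha> :: "'a \<Rightarrow> complex" and \<beta> :: "'b \<Rightarrow> complex"
  let ?\<alpha> = "\<lambda>a. if a \<in> A' then \<alpha> a else 0" and ?\<beta> = "\<lambda>b. if b \<in> B' then \<beta> b else 0"
  have "(\<Sum>a\<in>A. \<Sum>b\<in>B. ?\<alpha> a * ?\<beta> b * T a b) = (\<Sum>a\<in>A'. \<Sum>b\<in>B. ?\<alpha> a * ?\<beta> b * T a b)"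
    by (rule sum.mono_neutral_right) (use f s in auto)
  also have "\<dots> = (\<Sum>a\<in>A'. \<Sum>b\<in>B'. \<alpha> a * \<beta> b * T a b)"
  proof (rule sum.cong[OF refl])
    fix a assume "a \<in> A'"
    show "(\<Sum>b\<in>B. ?\<alpha> a * ?\<beta> b * T a b) = (\<Sum>b\<in>B'. \<alpha> a * \<beta> b * T a b)"
      by (rule sum.mono_neutral_cong_right) (use f s \<open>a \<in> A'\<close> in auto)
  qed
  finally have "norm (\<Sum>a\<in>A'. \<Sum>b\<in>B'. \<alpha> a * \<beta> b * T a b)
     \<le> D * L2_set (\<lambda>a. norm (?\<alpha> a)) A * L2_set (\<lambda>b. norm (?\<beta> b)) B"
    using bilinear_boundD[OF b, of ?\<alpha> ?\<beta>] by simp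
  then show "norm (\<Sum>a\<in>A'. \<Sum>b\<in>B'. \<alpha> a * \<beta> b * T a b)
     \<le> D * L2_set (\<lambda>a. norm (\<alpha> a)) A' * L2_set (\<lambda>b. norm (\<beta> b)) B'"
    by (simp only: L2_set_restrict[OF f(1) s(1)] L2_set_restrict[OF f(2) s(2)])
qed

lemma L2_set_split_square:
  assumes "finite A" "A = A1 \<union> A2" "A1 \<inter> A2 = {}"
  shows "(L2_set f A)\<^sup>2 = (L2_set f A1)\<^sup>2 + (L2_set f A2)\<^sup>2"
  using assms by (simp add: L2_set_def sum_nonneg sum.union_disjoint)

lemma cauchy_schwarz_two:
  fixes a b c d :: real
  assumes "0 \<le> a" "0 \<le> b" "0 \<le> c" "0 \<le> d" "e \<ge> 0" "f \<ge> 0" "e\<^sup>2 = a\<^sup>2 + b\<^sup>2" "f\<^sup>2 = c\<^sup>2 + d\<^sup>2"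
  shows "a * c + b * d \<le> e * f"
proof (rule power2_le_imp_le)
  have "0 \<le> (a * d - b * c)\<^sup>2" by simp
  then have "(a * c + b * d)\<^sup>2 \<le> (a\<^sup>2 + b\<^sup>2) * (c\<^sup>2 + d\<^sup>2)"
    by (simp add: power2_eq_square algebra_simps)
  then show "(a * c + b * d)\<^sup>2 \<le> (e * f)\<^sup>2" using assms by (simp add: power_mult_distrib)
  show "0 \<le> e * f" using assms by simp
qed

text \<open>Bisecting the range of \<open>\<sigma>\<close> splits the triangle \<open>\<sigma> b < \<rho> a\<close> into a full rectangle and two
  triangles of half the size on disjoint rows and columns.\<close>

lemma bilinear_bound_rank:
  assumes "finite A" "finite B" "bilinear_bound A B T D" "\<And>b. b \<in> B \<Longrightarrow> \<sigma> b < (2::nat) ^ K"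
  shows "bilinear_bound A B (\<lambda>a b. if \<sigma> b < \<rho> a then T a b else 0) (real (K + 1) * D)"
  using assms
proof (induction K arbitrary: A B \<sigma> \<rho>)
  case 0
  have D: "0 \<le> D" using bilinear_bound_nonneg[OF 0(3)] .
  show ?case unfolding bilinear_bound_def
  proof (intro conjI allI)
    show "0 \<le> real (0 + 1) * D" using D by simp
    fix \<alpha> :: "'a \<Rightarrow> complex" and \<beta> :: "'b \<Rightarrow> complex"
    let ?A = "{a \<in> A. 0 < \<rho> a}"
    have sub: "bilinear_bound ?A B T D" by (rule bilinear_bound_subset[OF 0(3,1,2)]) auto
    have "(\<Sum>a\<in>A. \<Sum>b\<in>B. \<alpha> a * \<beta> b * (if \<sigma> b < \<rho> a then T a b else 0)) =
      (\<Sum>a\<in>?A. \<Sum>b\<in>B. \<alpha> a * \<beta> b * T a b)"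
      by (rule sum.mono_neutral_cong_right) (use 0 in \<open>auto intro!: sum.neutral sum.cong\<close>)
    then have "norm (\<Sum>a\<in>A. \<Sum>b\<in>B. \<alpha> a * \<beta> b * (if \<sigma> b < \<rho> a then T a b else 0)) \<le>
       D * L2_set (\<lambda>a. norm (\<alpha> a)) ?A * L2_set (\<lambda>b. norm (\<beta> b)) B"
      using bilinear_boundD[OF sub] by simp
    also have "\<dots> \<le> D * L2_set (\<lambda>a. norm (\<alpha> a)) A * L2_set (\<lambda>b. norm (\<beta> b)) B"
      using D 0(1) unfolding L2_set_def
      by (intro mult_right_mono mult_left_mono real_sqrt_le_mono sum_mono2) (auto intro: sum_nonneg)
    finally show "norm (\<Sum>a\<in>A. \<Sum>b\<in>B. \<alpha> a * \<beta> b * (if \<sigma> b < \<rho> a then T a b else 0)) \<le>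
       real (0 + 1) * D * L2_set (\<lambda>a. norm (\<alpha> a)) A * L2_set (\<lambda>b. norm (\<beta> b)) B"
      by simp
  qed
next
  case (Suc K)
  have D: "0 \<le> D" using bilinear_bound_nonneg[OF Suc.prems(3)] .
  define h where "h = (2::nat) ^ K"
  define A1 where "A1 = {a \<in> A. \<rho> a \<le> h}"
  define A2 where "A2 = {a \<in> A. h < \<rho> a}"
  define B1 where "B1 = {b \<in> B. \<sigma> b < h}"
  define B2 where "B2 = {b \<in> B. h \<le> \<sigma> b}"
  have fin: "finite A1" "finite A2" "finite B1" "finite B2"
    using Suc.prems unfolding A1_def A2_def B1_def B2_def by auto
  have AA: "A = A1 \<union> A2" "A1 \<inter> A2 = {}" and BB: "B = B1 \<union> B2" "B1 \<inter> B2 = {}"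
    unfolding A1_def A2_def B1_def B2_def by auto
  let ?T = "\<lambda>a b. if \<sigma> b < \<rho> a then T a b else 0"
  have b11: "bilinear_bound A1 B1 ?T (real (K + 1) * D)"
  proof (rule Suc.IH)
    show "bilinear_bound A1 B1 T D"
      by (rule bilinear_bound_subset[OF Suc.prems(3,1,2)]) (use AA BB in auto)
  qed (use fin in \<open>auto simp: B1_def h_def\<close>)
  \<comment> \<open>Subtracting \<open>h\<close> from both ranks preserves their comparison, since
    \<open>h \<le> \<sigma> b\<close> on \<open>B2\<close> and \<open>h < \<rho> a\<close> on
    \<open>A2\<close>; it brings \<open>\<sigma>\<close> back below \<open>2 ^ K\<close>.\<close>
  have "bilinear_bound A2 B2 (\<lambda>a b. if \<sigma> b - h < \<rho> a - h then T a b else 0) (real (K + 1) * D)"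
  proof (rule Suc.IH)
    show "bilinear_bound A2 B2 T D"
      by (rule bilinear_bound_subset[OF Suc.prems(3,1,2)]) (use AA BB in auto)
    show "\<sigma> b - h < 2 ^ K" if "b \<in> B2" for b
      using Suc.prems(4)[of b] that unfolding B2_def h_def by auto
  qed (use fin in auto)
  then have b22: "bilinear_bound A2 B2 ?T (real (K + 1) * D)"
    by (rule bilinear_bound_cong) (auto simp: A2_def B2_def)
  have b21: "bilinear_bound A2 B1 T D"
    by (rule bilinear_bound_subset[OF Suc.prems(3,1,2)]) (use AA BB in auto)
  show ?case unfolding bilinear_bound_def
  proof (intro conjI allI)
    show "0 \<le> real (Suc K + 1) * D" using D by simp
    fix \<alpha> :: "'a \<Rightarrow> complex" and \<beta> :: "'b \<Rightarrow> complex"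
    let ?s = "\<lambda>a b. \<alpha> a * \<beta> b * (if \<sigma> b < \<rho> a then T a b else 0)"
    let ?x = "L2_set (\<lambda>a. norm (\<alpha> a))" and ?y = "L2_set (\<lambda>b. norm (\<beta> b))"
    have z: "(\<Sum>a\<in>A1. \<Sum>b\<in>B2. ?s a b) = 0"
      by (intro sum.neutral ballI) (auto simp: A1_def B2_def)
    have e21: "(\<Sum>a\<in>A2. \<Sum>b\<in>B1. ?s a b) = (\<Sum>a\<in>A2. \<Sum>b\<in>B1. \<alpha> a * \<beta> b * T a b)"
      by (intro sum.cong refl) (auto simp: A2_def B1_def)
    have "(\<Sum>a\<in>A. \<Sum>b\<in>B. ?s a b) = (\<Sum>a\<in>A1. \<Sum>b\<in>B1. ?s a b) + (\<Sum>a\<in>A1. \<Sum>b\<in>B2. ?s a b)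
      + (\<Sum>a\<in>A2. \<Sum>b\<in>B1. ?s a b) + (\<Sum>a\<in>A2. \<Sum>b\<in>B2. ?s a b)"
      using fin AA BB by (simp add: sum.union_disjoint sum.distrib algebra_simps)
    then have "norm (\<Sum>a\<in>A. \<Sum>b\<in>B. ?s a b) \<le> norm (\<Sum>a\<in>A1. \<Sum>b\<in>B1. ?s a b)
      + norm (\<Sum>a\<in>A2. \<Sum>b\<in>B1. \<alpha> a * \<beta> b * T a b) + norm (\<Sum>a\<in>A2. \<Sum>b\<in>B2. ?s a b)"
      by (simp only: z e21 add_0_right norm_triangle_mono[OF norm_triangle_ineq order_refl])
    also have "\<dots> \<le> real (K + 1) * D * ?x A1 * ?y B1 + D * ?x A2 * ?y B1 + real (K + 1) * D * ?x A2 * ?y B2"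
      using bilinear_boundD[OF b11] bilinear_boundD[OF b21] bilinear_boundD[OF b22] by (intro add_mono)
    also have "\<dots> = real (K + 1) * D * (?x A1 * ?y B1 + ?x A2 * ?y B2) + D * (?x A2 * ?y B1)"
      by (simp add: algebra_simps)
    \<comment> \<open>By Cauchy-Schwarz for two terms the triangles together cost no more than one
      of them, so a bisection adds only the \<open>D\<close> of the rectangle. Adding all norms
      crudely would make the factor exponential in \<open>K\<close>.\<close>
    also have "\<dots> \<le> real (K + 1) * D * (?x A * ?y B) + D * (?x A * ?y B)"
    proof (intro add_mono mult_left_mono)
      show "?x A1 * ?y B1 + ?x A2 * ?y B2 \<le> ?x A * ?y B"
        by (rule cauchy_schwarz_two)
           (use L2_set_split_square[OF Suc.prems(1) AA] L2_set_split_square[OF Suc.prems(2) BB] in auto)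
      show "?x A2 * ?y B1 \<le> ?x A * ?y B"
        using Suc.prems(1,2) AA BB unfolding L2_set_def
        by (intro mult_mono real_sqrt_le_mono sum_mono2) (auto intro: sum_nonneg)
    qed (use D in auto)
    finally show "norm (\<Sum>a\<in>A. \<Sum>b\<in>B. ?s a b) \<le> real (Suc K + 1) * D * ?x A * ?y B"
      by (simp add: algebra_simps)
  qed
qed

definition chain_rel :: "'a set \<Rightarrow> 'b set \<Rightarrow> ('a \<Rightarrow> 'b \<Rightarrow> bool) \<Rightarrow> bool" where
  "chain_rel A B R \<longleftrightarrow> (\<exists>(\<phi> :: 'a \<Rightarrow> real) \<psi>.
     (\<forall>a\<in>A. \<forall>b\<in>B. R a b \<longleftrightarrow> \<psi> b < \<phi> a) \<or> (\<forall>a\<in>A. \<forall>b\<in>B. R a b \<longleftrightarrow> \<psi> b \<le> \<phi> a))"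

lemma chain_rel_lessI:
  assumes "\<And>a b. a \<in> A \<Longrightarrow> b \<in> B \<Longrightarrow> R a b \<longleftrightarrow> (\<psi> b :: real) < \<phi> a"
  shows "chain_rel A B R"
  unfolding chain_rel_def using assms by blast

lemma chain_rel_leI:
  assumes "\<And>a b. a \<in> A \<Longrightarrow> b \<in> B \<Longrightarrow> R a b \<longleftrightarrow> (\<psi> b :: real) \<le> \<phi> a"
  shows "chain_rel A B R"
  unfolding chain_rel_def using assms by blast

lemma chain_rel_not:
  assumes "chain_rel A B R"
  shows "chain_rel A B (\<lambda>a b. \<not> R a b)"
proof -
  obtain \<phi> :: "'a \<Rightarrow> real" and \<psi> where
    "(\<forall>a\<in>A. \<forall>b\<in>B. R a b \<longleftrightarrow> \<psi> b < \<phi> a) \<or> (\<forall>a\<in>A. \<forall>b\<in>B. R a b \<longleftrightarrow> \<psi> b \<le> \<phi> a)"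
    using assms unfolding chain_rel_def by blast
  then show ?thesis
  proof
    assume "\<forall>a\<in>A. \<forall>b\<in>B. R a b \<longleftrightarrow> \<psi> b < \<phi> a"
    then show ?thesis by (intro chain_rel_leI[where \<psi> = "\<lambda>b. - \<psi> b" and \<phi> = "\<lambda>a. - \<phi> a"]) auto
  next
    assume "\<forall>a\<in>A. \<forall>b\<in>B. R a b \<longleftrightarrow> \<psi> b \<le> \<phi> a"
    then show ?thesis by (intro chain_rel_lessI[where \<psi> = "\<lambda>b. - \<psi> b" and \<phi> = "\<lambda>a. - \<phi> a"]) auto
  qed
qed

lemma chain_rel_subset:
  assumes "chain_rel A B R" "A' \<subseteq> A" "B' \<subseteq> B"
  shows "chain_rel A' B' R"
proof -
  obtain \<phi> :: "'a \<Rightarrow> real" and \<psi> where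
    "(\<forall>a\<in>A. \<forall>b\<in>B. R a b \<longleftrightarrow> \<psi> b < \<phi> a) \<or> (\<forall>a\<in>A. \<forall>b\<in>B. R a b \<longleftrightarrow> \<psi> b \<le> \<phi> a)"
    using assms unfolding chain_rel_def by blast
  then have "(\<forall>a\<in>A'. \<forall>b\<in>B'. R a b \<longleftrightarrow> \<psi> b < \<phi> a) \<or> (\<forall>a\<in>A'. \<forall>b\<in>B'. R a b \<longleftrightarrow> \<psi> b \<le> \<phi> a)"
    using assms(2,3) by (meson subsetD)
  then show ?thesis unfolding chain_rel_def by blast
qed

text \<open>Dividing by the positive \<open>f a\<close> turns a bound for a product into a threshold
  for \<open>h b\<close>; \<open>s = False\<close> selects the negated condition. Most size
  restrictions below have this shape.\<close>

lemma chain_rel_prodI: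
  assumes "\<And>a b. a \<in> A \<Longrightarrow> b \<in> B \<Longrightarrow> R a b \<longleftrightarrow> ((f a :: real) * h b \<le> 1) = s"
    and pos: "\<And>a. a \<in> A \<Longrightarrow> f a > 0"
  shows "chain_rel A B R"
proof -
  have c: "chain_rel A B (\<lambda>a b. f a * h b \<le> 1)"
    by (rule chain_rel_leI[where \<psi> = h and \<phi> = "\<lambda>a. 1 / f a"]) (use pos in \<open>auto simp: field_simps\<close>)
  have "chain_rel A B (\<lambda>a b. (f a * h b \<le> 1) = s)"
    using c chain_rel_not[OF c] by (cases s) auto
  then show ?thesis using assms(1) unfolding chain_rel_def by simp
qed

text \<open>Only the order of the thresholds matters, so they are replaced by ranks: each row is an
  initial segment of \<open>B\<close> in the order of \<open>\<psi>\<close>, and \<open>b\<close>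
  lies in it iff fewer elements strictly precede \<open>b\<close> than the row contains.\<close>

lemma bilinear_bound_chain:
  assumes f: "finite A" "finite B" and b: "bilinear_bound A B T D" and c: "chain_rel A B R"
    and card: "card B < (2::nat) ^ K"
  shows "bilinear_bound A B (\<lambda>a b. if R a b then T a b else 0) (real (K + 1) * D)"
proof -
  obtain \<phi> :: "'a \<Rightarrow> real" and \<psi> where
    *: "(\<forall>a\<in>A. \<forall>b\<in>B. R a b \<longleftrightarrow> \<psi> b < \<phi> a) \<or> (\<forall>a\<in>A. \<forall>b\<in>B. R a b \<longleftrightarrow> \<psi> b \<le> \<phi> a)"
    using c unfolding chain_rel_def by blast
  define \<sigma> where "\<sigma> b = card {b' \<in> B. \<psi> b' < \<psi> b}" for b
  define \<rho> where "\<rho> a = card {b' \<in> B. R a b'}" for a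
  have eq: "R a b \<longleftrightarrow> \<sigma> b < \<rho> a" if "a \<in> A" "b \<in> B" for a b
  proof
    assume R: "R a b"
    have "{b' \<in> B. \<psi> b' < \<psi> b} \<subset> {b' \<in> B. R a b'}"
    proof
      show "{b' \<in> B. \<psi> b' < \<psi> b} \<subseteq> {b' \<in> B. R a b'}"
        using * R that by (elim disjE) fastforce+
      show "{b' \<in> B. \<psi> b' < \<psi> b} \<noteq> {b' \<in> B. R a b'}"
        using R that by blast
    qed
    then show "\<sigma> b < \<rho> a" unfolding \<sigma>_def \<rho>_def using f by (intro psubset_card_mono) auto
  next
    assume l: "\<sigma> b < \<rho> a"
    show "R a b"
    proof (rule ccontr)
      assume "\<not> R a b"
      then have "{b' \<in> B. R a b'} \<subseteq> {b' \<in> B. \<psi> b' < \<psi> b}"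
        using * that by (elim disjE) fastforce+
      then have "\<rho> a \<le> \<sigma> b" unfolding \<sigma>_def \<rho>_def using f by (intro card_mono) auto
      then show False using l by simp
    qed
  qed
  have "\<sigma> b < 2 ^ K" if "b \<in> B" for b
  proof -
    have "\<sigma> b \<le> card B" unfolding \<sigma>_def using f by (intro card_mono) auto
    then show ?thesis using card by simp
  qed
  from bilinear_bound_rank[OF f b this, where \<rho> = \<rho>] show ?thesis
    by (rule bilinear_bound_cong) (auto simp: eq)
qed

lemma bilinear_bound_chains:
  assumes f: "finite A" "finite B" and b: "bilinear_bound A B T D"
    and c: "\<And>R. R \<in> set Rs \<Longrightarrow> chain_rel A B R"
    and card: "card B < (2::nat) ^ K"
  shows "bilinear_bound A B (\<lambda>a b. if \<forall>R\<in>set Rs. R a b then T a b else 0) (real (K + 1) ^ length Rs * D)"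
  using c
proof (induction Rs)
  case Nil
  then show ?case using b by simp
next
  case (Cons R Rs)
  have "bilinear_bound A B (\<lambda>a b. if \<forall>R\<in>set Rs. R a b then T a b else 0) (real (K + 1) ^ length Rs * D)"
    using Cons by auto
  from bilinear_bound_chain[OF f this Cons.prems[of R] card] show ?case
    by (simp add: mult.assoc) (erule bilinear_bound_cong, auto)
qed

text \<open>The variables of the bilinear sums are tuples of integers, because side conditions see
  the single entries, whereas the character sees only the product \<open>v a\<close>;
  \<open>F\<close> bounds how often a product is repeated.\<close>

definition fibres_le :: "'a set \<Rightarrow> ('a \<Rightarrow> nat) \<Rightarrow> real \<Rightarrow> bool" where
  "fibres_le A v F \<longleftrightarrow> finite A \<and> 1 \<le> F \<and> (\<forall>n. real (card {a \<in> A. v a = n}) \<le> F)"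

text \<open>Coefficients are pushed forward along \<open>v\<close>; Cauchy-Schwarz on each fibre
  costs a factor \<open>F\<close> in the squared norm.\<close>

lemma L2_set_fibre_sum:
  assumes "fibres_le A v F" "v ` A \<subseteq> M" "finite M"
  shows "L2_set (\<lambda>m. norm (\<Sum>a\<in>{a \<in> A. v a = m}. (\<alpha> a :: complex))) M \<le> sqrt F * L2_set (\<lambda>a. norm (\<alpha> a)) A"
proof -
  have fin: "finite A" and F: "1 \<le> F" using assms(1) unfolding fibres_le_def by auto
  have "(norm (\<Sum>a\<in>{a \<in> A. v a = m}. \<alpha> a))\<^sup>2 \<le> F * (\<Sum>a\<in>{a \<in> A. v a = m}. (norm (\<alpha> a))\<^sup>2)" for m
  proof -
    let ?S = "{a \<in> A. v a = m}"
    have "norm (\<Sum>a\<in>?S. \<alpha> a) \<le> (\<Sum>a\<in>?S. norm (\<alpha> a))" by (rule norm_sum)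
    also have "\<dots> = (\<Sum>a\<in>?S. \<bar>1::real\<bar> * \<bar>norm (\<alpha> a)\<bar>)" by simp
    also have "\<dots> \<le> L2_set (\<lambda>_. 1) ?S * L2_set (\<lambda>a. norm (\<alpha> a)) ?S" by (rule L2_set_mult_ineq)
    finally have "(norm (\<Sum>a\<in>?S. \<alpha> a))\<^sup>2 \<le> (L2_set (\<lambda>_. 1) ?S * L2_set (\<lambda>a. norm (\<alpha> a)) ?S)\<^sup>2"
      by (intro power_mono) auto
    also have "\<dots> = real (card ?S) * (\<Sum>a\<in>?S. (norm (\<alpha> a))\<^sup>2)"
      by (simp add: power_mult_distrib L2_set_def sum_nonneg)
    also have "\<dots> \<le> F * (\<Sum>a\<in>?S. (norm (\<alpha> a))\<^sup>2)"
      using assms(1) unfolding fibres_le_def by (intro mult_right_mono sum_nonneg) auto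
    finally show ?thesis .
  qed
  then have "(\<Sum>m\<in>M. (norm (\<Sum>a\<in>{a \<in> A. v a = m}. \<alpha> a))\<^sup>2) \<le>
      (\<Sum>m\<in>M. F * (\<Sum>a\<in>{a \<in> A. v a = m}. (norm (\<alpha> a))\<^sup>2))" by (rule sum_mono)
  also have "\<dots> = F * (\<Sum>a\<in>A. (norm (\<alpha> a))\<^sup>2)"
    by (simp only: sum_distrib_left[symmetric] sum.group[OF fin assms(3,2)])
  finally show ?thesis
    unfolding L2_set_def using F by (simp flip: real_sqrt_mult)
qed

text \<open>Both families of coefficients are pushed forward to the products, where \<open>T\<close>
  lives. The conclusion is about the tuples again, so that conditions on single entries can still be
  imposed.\<close>

lemma bilinear_bound_fibres:
  fixes v :: "'c \<Rightarrow> nat" and w :: "'d \<Rightarrow> nat"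
  assumes b: "bilinear_bound M N T D" and fin: "finite M" "finite N"
    and v: "fibres_le A v F1" "v ` A \<subseteq> M" and w: "fibres_le B w F2" "w ` B \<subseteq> N"
  shows "bilinear_bound A B (\<lambda>a b. T (v a) (w b)) (sqrt F1 * sqrt F2 * D)"
  unfolding bilinear_bound_def
proof (intro conjI allI)
  have D: "0 \<le> D" using bilinear_bound_nonneg[OF b] .
  have F: "1 \<le> F1" "1 \<le> F2" and fA: "finite A" "finite B" using v w unfolding fibres_le_def by auto
  show "0 \<le> sqrt F1 * sqrt F2 * D" using D F by simp
  fix \<alpha> :: "'c \<Rightarrow> complex" and \<beta> :: "'d \<Rightarrow> complex"
  let ?\<alpha> = "\<lambda>m. \<Sum>a\<in>{a \<in> A. v a = m}. \<alpha> a" and ?\<beta> = "\<lambda>n. \<Sum>b\<in>{b \<in> B. w b = n}. \<beta> b"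
  have "(\<Sum>a\<in>A. \<Sum>b\<in>B. \<alpha> a * \<beta> b * T (v a) (w b)) =
      (\<Sum>m\<in>M. \<Sum>a\<in>{a \<in> A. v a = m}. \<Sum>b\<in>B. \<alpha> a * \<beta> b * T (v a) (w b))"
    by (rule sum.group[OF fA(1) fin(1) v(2), symmetric])
  also have "\<dots> = (\<Sum>m\<in>M. \<Sum>a\<in>{a \<in> A. v a = m}. \<Sum>n\<in>N. \<Sum>b\<in>{b \<in> B. w b = n}. \<alpha> a * \<beta> b * T (v a) (w b))"
    by (intro sum.cong refl sum.group[OF fA(2) fin(2) w(2), symmetric])
  also have "\<dots> = (\<Sum>m\<in>M. \<Sum>n\<in>N. \<Sum>a\<in>{a \<in> A. v a = m}. \<Sum>b\<in>{b \<in> B. w b = n}. \<alpha> a * \<beta> b * T (v a) (w b))"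
    by (intro sum.cong refl) (rule sum.swap)
  also have "\<dots> = (\<Sum>m\<in>M. \<Sum>n\<in>N. ?\<alpha> m * ?\<beta> n * T m n)"
    by (intro sum.cong refl) (simp add: sum_distrib_left sum_distrib_right, rule sum.swap)
  finally have "norm (\<Sum>a\<in>A. \<Sum>b\<in>B. \<alpha> a * \<beta> b * T (v a) (w b)) \<le>
     D * L2_set (\<lambda>m. norm (?\<alpha> m)) M * L2_set (\<lambda>n. norm (?\<beta> n)) N"
    using bilinear_boundD[OF b, of ?\<alpha> ?\<beta>] by simp
  also have "\<dots> \<le> D * (sqrt F1 * L2_set (\<lambda>a. norm (\<alpha> a)) A) * (sqrt F2 * L2_set (\<lambda>b. norm (\<beta> b)) B)"
    using L2_set_fibre_sum[OF v fin(1)] L2_set_fibre_sum[OF w fin(2)] D F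
    by (intro mult_mono) auto
  finally show "norm (\<Sum>a\<in>A. \<Sum>b\<in>B. \<alpha> a * \<beta> b * T (v a) (w b)) \<le>
     sqrt F1 * sqrt F2 * D * L2_set (\<lambda>a. norm (\<alpha> a)) A * L2_set (\<lambda>b. norm (\<beta> b)) B"
    by (simp add: algebra_simps)
qed

section \<open>Additive characters\<close>

lemma card_residue_le:
  assumes "q \<ge> (1::nat)"
  shows "real (card {m \<in> {1..M}. m mod q = r}) \<le> real M / q + 1"
proof -
  have "card {m \<in> {1..M}. m mod q = r} \<le> card {0..M div q}"
  proof (rule card_inj_on_le[where f = "\<lambda>m. m div q"])
    show "inj_on (\<lambda>m. m div q) {m \<in> {1..M}. m mod q = r}"
      by (rule inj_onI) (metis (mono_tags, lifting) mem_Collect_eq div_mult_mod_eq)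
  qed (auto intro: div_le_mono)
  also have "\<dots> = M div q + 1" by simp
  finally have "real (card {m \<in> {1..M}. m mod q = r}) \<le> real (M div q + 1)" by linarith
  also have "\<dots> \<le> real M / q + 1" using of_nat_div_le_of_nat[of M q, where 'a=real] by simp
  finally show ?thesis .
qed

lemma periodic_sum_le:
  fixes f :: "nat \<Rightarrow> real"
  assumes q: "q \<ge> 1" and f: "\<And>m. f m \<ge> 0" "\<And>m. f (m mod q) = f m"
  shows "(\<Sum>m=1..M. f m) \<le> (real M / q + 1) * (\<Sum>m<q. f m)"
proof -
  have "(\<Sum>m=1..M. f m) = (\<Sum>r<q. \<Sum>m\<in>{m \<in> {1..M}. m mod q = r}. f m)"
    by (rule sum.group[symmetric]) (use q in auto)
  also have "\<dots> = (\<Sum>r<q. \<Sum>m\<in>{m \<in> {1..M}. m mod q = r}. f r)"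
    using f(2) by (intro sum.cong refl) auto
  also have "\<dots> = (\<Sum>r<q. real (card {m \<in> {1..M}. m mod q = r}) * f r)"
    by (intro sum.cong refl) (rule sum_constant)
  also have "\<dots> \<le> (\<Sum>r<q. (real M / q + 1) * f r)"
    using card_residue_le[OF q] f(1) by (intro sum_mono mult_right_mono) auto
  finally show ?thesis by (simp add: sum_distrib_left)
qed

lemma cis_2pi_eq_1_imp_int: "cis (2 * pi * t) = 1 \<Longrightarrow> t \<in> \<int>"
proof -
  assume "cis (2 * pi * t) = 1"
  then have "cos (2 * pi * t) = 1" by (simp add: complex_eq_iff)
  then obtain n :: int where "2 * pi * t = of_int n * 2 * pi"
    using cos_one_2pi_int by blast
  then have "t = of_int n" by simp
  then show ?thesis by simp
qed

lemma norm_1_minus_cis: "norm (1 - cis (2 * t)) = 2 * \<bar>sin t\<bar>"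
proof -
  have "(norm (1 - cis (2 * t)))\<^sup>2 = (2 * \<bar>sin t\<bar>)\<^sup>2"
    using sin_cos_squared_add[of "2 * t"]
    by (simp add: cmod_power2 power2_diff cos_double_sin power_mult_distrib)
  then show ?thesis by (rule power2_eq_imp_eq) simp_all
qed

text \<open>Jordan's inequality: the concave sine lies above its chord from \<open>0\<close> to
  \<open>pi / 2\<close>.\<close>

lemma sin_pi_ge:
  assumes "0 \<le> t" "t \<le> 1 / 2"
  shows "2 * t \<le> sin (pi * t)"
proof -
  have "concave_on {0..pi} sin"
  proof (rule f''_le0_imp_concave[where f' = cos and f'' = "\<lambda>x. - sin x"])
    show "- sin x \<le> 0" if "x \<in> {0..pi}" for x using that sin_ge_zero by auto
  qed (auto intro!: derivative_eq_intros)
  then have c: "convex_on {0..pi} (\<lambda>x. - sin x)" by (simp add: concave_on_def)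
  have "- sin ((1 - 2 * t) *\<^sub>R 0 + (2 * t) *\<^sub>R (pi / 2)) \<le> (1 - 2 * t) * (- sin 0) + (2 * t) * (- sin (pi / 2))"
    by (rule convex_onD[OF c]) (use assms in auto)
  then show ?thesis by (simp add: mult.commute)
qed

section \<open>The character modulo \<open>q\<close> and its bilinear form\<close>

locale additive_char =
  fixes a :: int and q :: nat
  assumes q_pos: "1 \<le> q" and coprime_aq: "coprime a (int q)"
begin

definition e :: "nat \<Rightarrow> complex" where
  "e n = cis (2 * pi * (real_of_int a * real n / real q))"

lemma norm_e [simp]: "norm (e n) = 1"
  by (simp add: e_def)

lemma e_mult: "e (m * n) = e n ^ m"
  unfolding e_def Complex.DeMoivre by (simp add: algebra_simps)

lemma e_add: "e (m + n) = e m * e n"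
  by (simp add: e_def cis_mult add_divide_distrib distrib_left)

lemma e_q [simp]: "e (q * n) = 1"
proof -
  have "2 * pi * (real_of_int a * real (q * n) / real q) = 2 * pi * real_of_int (a * int n)"
    using q_pos by simp
  then show ?thesis unfolding e_def using cis_multiple_2pi[of "real_of_int (a * int n)"] by simp
qed

lemma e_mod: "e (n mod q) = e n"
proof -
  have "e n = e (q * (n div q) + n mod q)" by simp
  then show ?thesis by (simp only: e_add e_q mult_1)
qed

lemma e_eq_imp_cong:
  assumes "e m = e n"
  shows "m mod q = n mod q"
proof -
  have "cis (2 * pi * (real_of_int a * (real m - real n) / real q)) = e m / e n"
    by (simp add: e_def cis_divide diff_divide_distrib right_diff_distrib)
  also have "\<dots> = 1" using assms norm_e[of n] by (metis divide_self norm_zero zero_neq_one)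
  finally have "real_of_int a * (real m - real n) / real q \<in> \<int>" by (rule cis_2pi_eq_1_imp_int)
  then obtain k :: int where "real_of_int a * (real m - real n) / real q = of_int k"
    by (auto elim: Ints_cases)
  then have "real_of_int (a * (int m - int n)) = real_of_int (k * int q)"
    using q_pos by (simp add: field_simps)
  then have "a * (int m - int n) = k * int q" by (simp only: of_int_eq_iff)
  then have "int q dvd a * (int m - int n)" by simp
  then have "int q dvd int m - int n"
    using coprime_aq by (metis coprime_commute coprime_dvd_mult_right_iff)
  then show ?thesis by (metis mod_eq_dvd_iff of_nat_mod of_nat_eq_iff)
qed

lemma e_eq_1_iff: "e n = 1 \<longleftrightarrow> q dvd n"
proof
  assume "e n = 1"
  then have "e n = e 0" by (simp add: e_def)
  then show "q dvd n" using e_eq_imp_cong[of n 0] by auto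
qed (auto elim!: dvdE)

text \<open>As \<open>a\<close> is coprime to \<open>q\<close>, distinct residues \<open>r\<close>
  and \<open>s\<close> belong to distinct \<open>q\<close>-th roots of unity, so their inner product
  over \<open>m\<close> is a complete geometric sum and vanishes.\<close>

lemma parseval:
  fixes c :: "nat \<Rightarrow> complex"
  shows "(\<Sum>m<q. (norm (\<Sum>r<q. c r * e (m * r)))\<^sup>2) = q * (\<Sum>r<q. (norm (c r))\<^sup>2)"
proof -
  have orth: "(\<Sum>m<q. e (m * r) * cnj (e (m * s))) = (if r = s then of_nat q else 0)"
    if "r < q" "s < q" for r s
  proof -
    have 1: "e (m * r) * cnj (e (m * s)) = (e r * cnj (e s)) ^ m" for m
      by (simp add: e_mult power_mult_distrib)
    have ns: "e s * cnj (e s) = 1" by (simp add: complex_norm_square[symmetric])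
    show ?thesis
    proof (cases "r = s")
      case True then show ?thesis by (simp add: complex_norm_square[symmetric])
    next
      case False
      have "e r \<noteq> e s" using e_eq_imp_cong[of r s] that False by auto
      then have n1: "e r * cnj (e s) \<noteq> 1"
        by (metis ns mult.commute mult_cancel_right mult_zero_right zero_neq_one)
      have "(e r * cnj (e s)) ^ q = 1"
        using e_mult[of q r] e_mult[of q s] by (simp add: power_mult_distrib flip: complex_cnj_power)
      then show ?thesis using False n1 by (simp only: 1) (simp add: geometric_sum)
    qed
  qed
  have "complex_of_real (\<Sum>m<q. (norm (\<Sum>r<q. c r * e (m * r)))\<^sup>2) =
     (\<Sum>m<q. \<Sum>r<q. \<Sum>s<q. c r * cnj (c s) * (e (m * r) * cnj (e (m * s))))"
    by (simp only: of_real_sum complex_norm_square cnj_sum sum_product complex_cnj_mult of_real_power[symmetric])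
       (simp add: ac_simps)
  also have "\<dots> = (\<Sum>r<q. \<Sum>s<q. \<Sum>m<q. c r * cnj (c s) * (e (m * r) * cnj (e (m * s))))"
    by (rule trans[OF sum.swap], rule sum.cong[OF refl], rule sum.swap)
  also have "\<dots> = (\<Sum>r<q. \<Sum>s<q. c r * cnj (c s) * (if r = s then of_nat q else 0))"
    by (intro sum.cong refl) (simp only: sum_distrib_left[symmetric] orth lessThan_iff)
  also have "\<dots> = (\<Sum>r<q. c r * cnj (c r) * of_nat q)"
    by (intro sum.cong refl) (simp add: if_distrib[of "\<lambda>t. _ * t"] sum.delta cong: if_cong)
  also have "\<dots> = complex_of_real (q * (\<Sum>r<q. (norm (c r))\<^sup>2))"
    by (simp only: of_real_mult of_real_sum of_real_power[symmetric] complex_norm_square[symmetric] sum_distrib_left)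
       (simp add: mult.commute)
  finally show ?thesis using of_real_eq_iff by blast
qed

text \<open>A discrete large sieve. After Cauchy-Schwarz the range of \<open>m\<close> is covered by
  \<open>M / q + 1\<close> periods, and Parseval applies to \<open>\<beta>\<close> collected into
  residue classes, each containing at most \<open>L / q + 1\<close> of the \<open>l\<close>.
  Multiplied out, the square of the bound is \<open>M * L / q + M + L + q\<close>, the source of all
  error terms.\<close>

lemma bilinear_bound_e:
  "bilinear_bound {1..M} {1..L} (\<lambda>m l. e (m * l)) (sqrt ((real M + q) * (real L / q + 1)))"
  unfolding bilinear_bound_def
proof (intro conjI allI)
  show "0 \<le> sqrt ((real M + q) * (real L / q + 1))" by simp
  fix \<alpha> \<beta> :: "nat \<Rightarrow> complex"
  define c where "c r = (\<Sum>l\<in>{l \<in> {1..L}. l mod q = r}. \<beta> l)" for r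
  define S where "S m = (\<Sum>r<q. c r * e (m * r))" for m
  have S: "(\<Sum>l=1..L. \<beta> l * e (m * l)) = S m" for m
  proof -
    have "(\<Sum>l=1..L. \<beta> l * e (m * l)) = (\<Sum>r<q. \<Sum>l\<in>{l \<in> {1..L}. l mod q = r}. \<beta> l * e (m * l))"
      by (rule sum.group[symmetric]) (use q_pos in auto)
    also have "\<dots> = (\<Sum>r<q. \<Sum>l\<in>{l \<in> {1..L}. l mod q = r}. \<beta> l * e (m * r))"
    proof (intro sum.cong refl)
      fix r l assume "l \<in> {l \<in> {1..L}. l mod q = r}"
      then have "e (m * l) = e (m * r)" using e_mod[of "m * l"] e_mod[of "m * r"] by (auto simp: mod_mult_right_eq)
      then show "\<beta> l * e (m * l) = \<beta> l * e (m * r)" by simp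
    qed
    finally show ?thesis by (simp add: S_def c_def sum_distrib_right)
  qed
  have "(\<Sum>m=1..M. (norm (S m))\<^sup>2) \<le> (real M / q + 1) * (\<Sum>m<q. (norm (S m))\<^sup>2)"
  proof (rule periodic_sum_le[OF q_pos])
    have "S (m mod q) = S m" for m
    proof -
      have "e (m mod q * r) = e (m * r)" for r
        using e_mod[of "m mod q * r"] e_mod[of "m * r"] by (simp add: mod_mult_left_eq)
      then show ?thesis by (simp add: S_def)
    qed
    then show "(norm (S (m mod q)))\<^sup>2 = (norm (S m))\<^sup>2" for m by simp
  qed simp
  also have "(\<Sum>m<q. (norm (S m))\<^sup>2) = q * (\<Sum>r<q. (norm (c r))\<^sup>2)"
    unfolding S_def by (rule parseval)
  also have "(real M / q + 1) * (q * (\<Sum>r<q. (norm (c r))\<^sup>2)) = (real M + q) * (\<Sum>r<q. (norm (c r))\<^sup>2)"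
    using q_pos by (simp add: field_simps)
  finally have 1: "(\<Sum>m=1..M. (norm (S m))\<^sup>2) \<le> (real M + q) * (\<Sum>r<q. (norm (c r))\<^sup>2)" .
  have "fibres_le {1..L} (\<lambda>l. l mod q) (real L / q + 1)"
    unfolding fibres_le_def using card_residue_le[OF q_pos] by auto
  from L2_set_fibre_sum[OF this _ finite_lessThan, of q \<beta>]
  have "L2_set (\<lambda>m. norm (c m)) {..<q} \<le> sqrt (real L / q + 1) * L2_set (\<lambda>b. norm (\<beta> b)) {1..L}"
    using q_pos unfolding c_def by (simp add: image_subset_iff)
  then have 2: "sqrt (real M + q) * L2_set (\<lambda>m. norm (c m)) {..<q}
      \<le> sqrt (real M + q) * (sqrt (real L / q + 1) * L2_set (\<lambda>b. norm (\<beta> b)) {1..L})"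
    by (rule mult_left_mono) simp
  have 3: "L2_set (\<lambda>m. norm (S m)) {1..M} \<le> sqrt (real M + q) * L2_set (\<lambda>m. norm (c m)) {..<q}"
    unfolding L2_set_def real_sqrt_mult[symmetric] using 1 by (rule real_sqrt_le_mono)
  have "norm (\<Sum>m=1..M. \<Sum>l=1..L. \<alpha> m * \<beta> l * e (m * l)) = norm (\<Sum>m=1..M. \<alpha> m * S m)"
    by (simp add: S[symmetric] sum_distrib_left mult.assoc)
  also have "\<dots> \<le> (\<Sum>m=1..M. norm (\<alpha> m * S m))" by (rule norm_sum)
  also have "\<dots> = (\<Sum>m=1..M. \<bar>norm (\<alpha> m)\<bar> * \<bar>norm (S m)\<bar>)" by (simp add: norm_mult)
  also have "\<dots> \<le> L2_set (\<lambda>m. norm (\<alpha> m)) {1..M} * L2_set (\<lambda>m. norm (S m)) {1..M}"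
    by (rule L2_set_mult_ineq)
  also have "\<dots> \<le> L2_set (\<lambda>m. norm (\<alpha> m)) {1..M} *
      (sqrt (real M + q) * (sqrt (real L / q + 1) * L2_set (\<lambda>b. norm (\<beta> b)) {1..L}))"
    using 2 3 by (intro mult_left_mono) auto
  also have "\<dots> = sqrt ((real M + q) * (real L / q + 1)) * L2_set (\<lambda>m. norm (\<alpha> m)) {1..M} *
      L2_set (\<lambda>b. norm (\<beta> b)) {1..L}"
    by (simp add: real_sqrt_mult mult.assoc mult.left_commute)
  finally show "norm (\<Sum>m=1..M. \<Sum>l=1..L. \<alpha> m * \<beta> l * e (m * l)) \<le> \<dots>" .
qed

text \<open>The norm is \<open>2 * \<bar>sin (pi * r / q)\<bar>\<close>, and Jordan's inequality is
  applied to the distance of \<open>r / q\<close> from the nearest integer.\<close>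

lemma norm_1_minus_e_ge:
  assumes "r < q" "(a * int n) mod q = r"
  shows "norm (1 - e n) \<ge> 4 * real (min r (q - r)) / q"
proof -
  have "e n = cis (2 * (pi * (real r / q)))"
  proof -
    obtain k where k: "a * int n = k * int q + int r"
      using assms(2) by (metis div_mult_mod_eq)
    have "real_of_int a * real n = real_of_int (a * int n)" by simp
    also have "\<dots> = real_of_int k * real q + real r" unfolding k by simp
    finally have "e n = cis (2 * pi * real_of_int k + 2 * (pi * (real r / q)))"
      using q_pos unfolding e_def by (simp add: add_divide_distrib algebra_simps)
    then show ?thesis using cis_multiple_2pi[of "real_of_int k"] by (simp add: cis_mult[symmetric])
  qed
  then have n: "norm (1 - e n) = 2 * \<bar>sin (pi * (real r / q))\<bar>" by (simp only: norm_1_minus_cis)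
  have qp: "real q > 0" using q_pos by simp
  have "2 * (real (min r (q - r)) / q) \<le> \<bar>sin (pi * (real r / q))\<bar>"
  proof (cases "2 * r \<le> q")
    case True
    then have m: "min r (q - r) = r" by auto
    have "2 * (real r / q) \<le> sin (pi * (real r / q))"
      by (rule sin_pi_ge) (use True qp in \<open>auto simp: field_simps\<close>)
    then show ?thesis using m by simp
  next
    case False
    then have m: "min r (q - r) = q - r" by auto
    have "2 * (real (q - r) / q) \<le> sin (pi * (real (q - r) / q))"
      by (rule sin_pi_ge) (use False qp assms(1) in \<open>auto simp: field_simps\<close>)
    also have "pi * (real (q - r) / q) = pi - pi * (real r / q)"
      using assms(1) qp by (simp add: field_simps of_nat_diff)
    finally show ?thesis using m by simp
  qed
  then show ?thesis using n by simp
qed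

lemma norm_interval_sum_le:
  assumes "\<not> q dvd v"
  shows "norm (\<Sum>k=i..j. e (v * k)) \<le> 2 / norm (1 - e v)"
proof -
  have n1: "e v \<noteq> 1" using assms by (simp add: e_eq_1_iff)
  have "(\<Sum>k=i..j. e (v * k)) = (\<Sum>k=i..j. e v ^ k)"
    by (intro sum.cong refl) (metis e_mult mult.commute)
  also have "\<dots> = (if j < i then 0 else (e v ^ i - e v ^ Suc j) / (1 - e v))"
    using n1 by (simp add: sum_gp)
  finally have eq: "(\<Sum>k=i..j. e (v * k)) = (if j < i then 0 else (e v ^ i - e v ^ Suc j) / (1 - e v))" .
  have "norm (e v ^ i - e v ^ Suc j) \<le> norm (e v ^ i) + norm (e v ^ Suc j)" by (rule norm_triangle_ineq4)
  also have "\<dots> = 2" by (simp add: norm_power norm_mult)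
  finally show ?thesis
    unfolding eq by (auto simp: norm_divide intro: divide_right_mono)
qed

end

section \<open>Counting with multiplicity, harmonic sums, intervals\<close>

lemma fibres_le_subset:
  assumes "fibres_le A v F" "A' \<subseteq> A"
  shows "fibres_le A' v F"
  unfolding fibres_le_def
proof (intro conjI allI)
  have fin: "finite A" and "1 \<le> F" and c: "\<And>n. real (card {a \<in> A. v a = n}) \<le> F"
    using assms unfolding fibres_le_def by auto
  then show "finite A'" "1 \<le> F" using assms(2) finite_subset by auto
  fix n
  have "card {a \<in> A'. v a = n} \<le> card {a \<in> A. v a = n}"
    using fin assms(2) by (intro card_mono) auto
  then show "real (card {a \<in> A'. v a = n}) \<le> F" using c[of n] by linarith
qed

lemma card_le_fibres:
  assumes "fibres_le A v F" "v ` A \<subseteq> {1..N}"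
  shows "real (card A) \<le> F * N"
proof -
  have fin: "finite A" and c: "\<And>n. real (card {a \<in> A. v a = n}) \<le> F"
    using assms unfolding fibres_le_def by auto
  have "real (card A) = (\<Sum>a\<in>A. 1)" by simp
  also have "\<dots> = (\<Sum>n=1..N. \<Sum>a\<in>{a \<in> A. v a = n}. 1)"
    by (rule sum.group[symmetric]) (use fin assms(2) in auto)
  also have "\<dots> = (\<Sum>n=1..N. real (card {a \<in> A. v a = n}))" by simp
  also have "\<dots> \<le> (\<Sum>n=1..N. F)" by (intro sum_mono c)
  finally show ?thesis by (simp add: mult.commute)
qed

lemma L2_set_le_sqrt_card:
  assumes "\<And>a. a \<in> A \<Longrightarrow> norm (\<alpha> a) \<le> 1"
  shows "L2_set (\<lambda>a. norm (\<alpha> a)) A \<le> sqrt (card A)"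
proof -
  have "(\<Sum>a\<in>A. (norm (\<alpha> a))\<^sup>2) \<le> (\<Sum>a\<in>A. 1)"
    using assms by (intro sum_mono) (simp add: power_le_one)
  then show ?thesis unfolding L2_set_def by (intro real_sqrt_le_mono) simp
qed

text \<open>Each dyadic block \<open>{2 ^ K + 1..2 ^ (K + 1)}\<close> contributes at most
  \<open>1\<close>.\<close>

lemma harm_le_log:
  assumes "n \<le> 2 ^ K"
  shows "(\<Sum>k=1..n. 1 / real k) \<le> K + 1"
  using assms
proof (induction K arbitrary: n)
  case 0
  then show ?case by (cases n) auto
next
  case (Suc K)
  show ?case
  proof (cases "n \<le> 2 ^ K")
    case True
    then show ?thesis using Suc.IH[OF True] by simp
  next
    case False
    have "{1..n} = {1..2 ^ K} \<union> {2 ^ K + 1..n}" using False by auto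
    then have "(\<Sum>k=1..n. 1 / real k) = (\<Sum>k=1..2 ^ K. 1 / real k) + (\<Sum>k=2 ^ K + 1..n. 1 / real k)"
      by (simp add: sum.union_disjoint)
    also have "(\<Sum>k=2 ^ K + 1..n. 1 / real k) \<le> (\<Sum>k=2 ^ K + 1..n. 1 / 2 ^ K)"
    proof (intro sum_mono)
      fix k :: nat assume "k \<in> {2 ^ K + 1..n}"
      then have "real (2 ^ K) \<le> real k" by (intro of_nat_mono) auto
      then show "1 / real k \<le> 1 / 2 ^ K" by (intro frac_le) auto
    qed
    also have "\<dots> = real (n - 2 ^ K) / 2 ^ K" by simp
    also have "\<dots> \<le> 1"
    proof -
      have "real (n - 2 ^ K) \<le> real (2 ^ K)" using Suc.prems by (intro of_nat_mono) auto
      then show ?thesis by simp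
    qed
    finally show ?thesis using Suc.IH[of "2 ^ K"] by simp
  qed
qed

lemma finite_convex_nat:
  assumes "finite I" "\<And>i j k. i \<in> I \<Longrightarrow> k \<in> I \<Longrightarrow> i \<le> j \<Longrightarrow> j \<le> k \<Longrightarrow> j \<in> (I :: nat set)"
  shows "\<exists>i j. I = {i..j}"
proof (cases "I = {}")
  case True
  then have "I = {1..0}" by simp
  then show ?thesis by blast
next
  case False
  have "{Min I..Max I} \<subseteq> I"
    using assms(2)[OF Min_in[OF assms(1) False] Max_in[OF assms(1) False]] by auto
  moreover have "I \<subseteq> {Min I..Max I}" using assms(1) by auto
  ultimately have "I = {Min I..Max I}" by auto
  then show ?thesis by blast
qed

section \<open>Type II and type I sums\<close>

text \<open>One integer \<open>G\<close> stands for all admissible losses: it dominates the number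
  of dyadic scales up to \<open>x\<close> and the number of divisors of every integer up to
  \<open>x\<close>. With \<open>10 \<le> G\<close>, numerical constants are absorbed into powers of
  \<open>5 * G\<close>. For \<open>q > x\<close> the theorem is trivial, so that case stays outside
  the locale.\<close>

locale exp_sum_setting = additive_char +
  fixes x :: real and G :: nat
  assumes q_le_x: "real q \<le> x" and x_le: "x \<le> 2 ^ G" and G_ge: "10 \<le> G"
    and divisors_le: "\<And>n. 1 \<le> n \<Longrightarrow> real n \<le> x \<Longrightarrow> card {d. d dvd n} \<le> G"
begin

lemma x_ge_1: "1 \<le> x"
  using q_le_x q_pos by linarith

lemma nat_le_x: "finite {n::nat. real n \<le> x}"
proof (rule finite_subset)
  show "{n::nat. real n \<le> x} \<subseteq> {..nat \<lfloor>x\<rfloor>}" by (auto simp: le_nat_floor)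
qed simp

text \<open>The l2 norms of bounded coefficients on \<open>v w \<le> x\<close> contribute
  \<open>sqrt x\<close>, up to constants and multiplicities; the matrix of the character contributes
  \<open>sqrt (x / q + V + q)\<close> when both variables have size at most about
  \<open>V\<close>.\<close>

definition Bnd :: "real \<Rightarrow> real" where
  "Bnd V = sqrt (x * (x / q + V + q))"

lemma Bnd_ge:
  assumes "0 \<le> V"
  shows "x / q \<le> Bnd V" "real q \<le> Bnd V" "sqrt (x * V) \<le> Bnd V" "0 \<le> Bnd V" "1 \<le> Bnd V"
proof -
  have q: "1 \<le> real q" using q_pos by simp
  have "(x / q)\<^sup>2 \<le> x * (x / q)"
    using q x_ge_1 by (simp add: power2_eq_square field_simps)
  also have "\<dots> \<le> x * (x / q + V + q)" using assms x_ge_1 by (intro mult_left_mono) auto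
  finally show 1: "x / q \<le> Bnd V" unfolding Bnd_def by (rule real_le_rsqrt)
  have "(real q)\<^sup>2 \<le> x * q"
    using q_le_x by (simp add: power2_eq_square mult_right_mono)
  also have "\<dots> \<le> x * (x / q + V + q)" using assms x_ge_1 by (intro mult_left_mono) auto
  finally show 2: "real q \<le> Bnd V" unfolding Bnd_def by (rule real_le_rsqrt)
  show "sqrt (x * V) \<le> Bnd V" unfolding Bnd_def
    using assms x_ge_1 by (intro real_sqrt_le_mono mult_left_mono) auto
  show "0 \<le> Bnd V" "1 \<le> Bnd V" using 2 q by auto
qed

text \<open>Given the product \<open>n\<close>, the value of \<open>v a\<close> is one of at most
  \<open>G\<close> divisors of \<open>n\<close> and determines the value of \<open>w b\<close>. Each
  time a variable is composed of two, the multiplicity grows by a factor \<open>G\<close>.\<close>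

lemma fibres_le_prod:
  assumes v: "fibres_le A v F1" and w: "fibres_le B w F2" and S: "S \<subseteq> A \<times> B"
    and b: "\<And>a b. (a, b) \<in> S \<Longrightarrow> 1 \<le> v a * w b \<and> real (v a * w b) \<le> x"
  shows "fibres_le S (\<lambda>(a, b). v a * w b) (F1 * F2 * G)"
proof -
  have fin: "finite A" "finite B" and F: "1 \<le> F1" "1 \<le> F2"
    and c: "\<And>n. real (card {a \<in> A. v a = n}) \<le> F1" "\<And>n. real (card {b \<in> B. w b = n}) \<le> F2"
    using v w unfolding fibres_le_def by auto
  have G1: "1 \<le> real G" using G_ge by simp
  have "finite S" using S fin finite_subset by blast
  moreover have F12: "1 \<le> F1 * F2" using F mult_mono[of 1 F1 1 F2] by simp
  moreover have "1 \<le> F1 * F2 * G" using F12 G1 mult_mono[of 1 "F1 * F2" 1 "real G"] by simp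
  moreover have "real (card {s \<in> S. (case s of (a, b) \<Rightarrow> v a * w b) = n}) \<le> F1 * F2 * G" for n
  proof (cases "{s \<in> S. (case s of (a, b) \<Rightarrow> v a * w b) = n} = {}")
    case True
    show ?thesis using \<open>1 \<le> F1 * F2 * G\<close> unfolding True by simp
  next
    case False
    then have n: "1 \<le> n" "real n \<le> x" using b by force+
    let ?D = "{d. d dvd n}" and ?f = "\<lambda>d. {a \<in> A. v a = d} \<times> {b \<in> B. w b = n div d}"
    have fD: "finite ?D" using n by simp
    have "{s \<in> S. (case s of (a, b) \<Rightarrow> v a * w b) = n} \<subseteq> (\<Union>d\<in>?D. ?f d)"
    proof
      fix s assume "s \<in> {s \<in> S. (case s of (a, b) \<Rightarrow> v a * w b) = n}"
      then obtain a b where s: "s = (a, b)" "(a, b) \<in> S" "v a * w b = n" by (cases s) auto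
      have "v a \<noteq> 0" using s n by (metis mult_0 not_one_le_zero)
      then have "w b = n div v a" using s(3) by (metis nonzero_mult_div_cancel_left)
      moreover have "v a dvd n" using s(3) by auto
      ultimately show "s \<in> (\<Union>d\<in>?D. ?f d)" using s S by (auto intro!: bexI[of _ "v a"])
    qed
    then have "card {s \<in> S. (case s of (a, b) \<Rightarrow> v a * w b) = n} \<le> card (\<Union>d\<in>?D. ?f d)"
      using fD fin by (intro card_mono) auto
    also have "\<dots> \<le> (\<Sum>d\<in>?D. card (?f d))" by (rule card_UN_le[OF fD])
    finally have "real (card {s \<in> S. (case s of (a, b) \<Rightarrow> v a * w b) = n}) \<le> (\<Sum>d\<in>?D. real (card (?f d)))"
      by (simp only: of_nat_sum[symmetric] of_nat_le_iff)
    also have "\<dots> \<le> (\<Sum>d\<in>?D. F1 * F2)"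
      using c F by (intro sum_mono) (simp add: card_cartesian_product mult_mono)
    also have "\<dots> = real (card ?D) * (F1 * F2)" by simp
    also have "\<dots> \<le> real G * (F1 * F2)"
      using divisors_le[OF n] F12 by (intro mult_right_mono) auto
    finally show ?thesis by (simp add: mult.commute)
  qed
  ultimately show ?thesis unfolding fibres_le_def by blast
qed

text \<open>Confining \<open>v\<close> to \<open>[M, 2 M]\<close> confines \<open>w\<close> to at
  most \<open>x / M\<close>, so that the two l2 norms multiply to about \<open>sqrt x\<close>. The
  coupling of the variables by the bound \<open>x\<close> for their product is a chain relation like
  the others, whence the exponent \<open>length Rs + 1\<close>.\<close>

lemma type_II_block:
  fixes v :: "'a \<Rightarrow> nat" and w :: "'b \<Rightarrow> nat" and M V :: real
  assumes v: "fibres_le A v F1" and w: "fibres_le B w F2" and F2: "F2 \<le> 2 ^ (3 * G)"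
    and A: "\<And>a. a \<in> A \<Longrightarrow> M \<le> v a \<and> v a \<le> 2 * M" and M: "1 \<le> M" "M \<le> V" "x / M \<le> 2 * V"
    and B: "\<And>b. b \<in> B \<Longrightarrow> 1 \<le> w b"
    and \<alpha>: "\<And>a. a \<in> A \<Longrightarrow> norm (\<alpha> a) \<le> 1" and \<beta>: "\<And>b. b \<in> B \<Longrightarrow> norm (\<beta> b) \<le> 1"
    and Rs: "\<And>R. R \<in> set Rs \<Longrightarrow> chain_rel A B R"
  shows "norm (\<Sum>(a, b)\<in>{(a, b) \<in> A \<times> B. real (v a * w b) \<le> x \<and> (\<forall>R\<in>set Rs. R a b)}.
            \<alpha> a * \<beta> b * e (v a * w b)) \<le> F1 * F2 * (5 * real G) ^ (length Rs + 1) * (3 * Bnd V)"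
proof -
  define N where "N = nat \<lfloor>2 * M\<rfloor>"
  define L where "L = nat \<lfloor>x / M\<rfloor>"
  have N: "real N \<le> 2 * M" and L: "real L \<le> x / M" unfolding N_def L_def using M x_ge_1 by (auto simp: floor_less_one intro: order_trans)
  define B' where "B' = {b \<in> B. w b \<le> L}"
  have finAB: "finite A" "finite B'" "finite B" and F: "1 \<le> F1" "1 \<le> F2"
    using v w unfolding fibres_le_def B'_def by auto
  have w': "fibres_le B' w F2" by (rule fibres_le_subset[OF w]) (auto simp: B'_def)
  have vi: "v ` A \<subseteq> {1..N}"
  proof
    fix n assume "n \<in> v ` A"
    then have "M \<le> real n" "real n \<le> 2 * M" using A by auto
    then show "n \<in> {1..N}" using M unfolding N_def by (auto simp: le_nat_floor)
  qed
  have wi: "w ` B' \<subseteq> {1..L}" using B by (auto simp: B'_def)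
  \<comment> \<open>\<open>B'\<close> has at most \<open>F2 * L \<le> 2 ^ (4 * G)\<close> elements,
    hence \<open>4 * G + 1\<close> bisections; this is where the bound for \<open>F2\<close> enters.
    One condition then costs \<open>K + 1 = 4 * G + 2 \<le> 5 * G\<close>.\<close>
  define K where "K = 4 * G + 1"
  have "real (card B') \<le> F2 * L" by (rule card_le_fibres[OF w' wi])
  also have "\<dots> \<le> 2 ^ (3 * G) * 2 ^ G"
  proof (rule mult_mono[OF F2])
    have "x / M \<le> x" using M x_ge_1 by (simp add: field_simps)
    then show "real L \<le> 2 ^ G" using L x_le by linarith
  qed (use F in auto)
  also have "\<dots> < 2 ^ K" unfolding K_def by (simp add: power_add[symmetric])
  finally have cB: "card B' < 2 ^ K" by (metis of_nat_less_iff of_nat_numeral of_nat_power)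
  let ?D = "sqrt F1 * sqrt F2 * sqrt ((real N + q) * (real L / q + 1))"
  have bb: "bilinear_bound A B' (\<lambda>a b. e (v a * w b)) ?D"
    by (rule bilinear_bound_fibres[OF bilinear_bound_e _ _ v vi w' wi]) auto
  have D: "?D \<le> sqrt F1 * sqrt F2 * sqrt (4 * (x / q + V + q))"
  proof (intro mult_left_mono real_sqrt_le_mono)
    have qp: "real q > 0" using q_pos by simp
    have "real N * (real L / q) \<le> (2 * M) * ((x / M) / q)"
      using N L M qp by (intro mult_mono divide_right_mono) auto
    also have "\<dots> = 2 * (x / q)" using M by simp
    finally have 1: "real N * (real L / q) \<le> 2 * (x / q)" .
    have 2: "(real N + q) * (real L / q + 1) = real N * (real L / q) + real N + real L + q"
      using qp by (simp add: field_simps)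
    have 3: "0 \<le> x / q" using x_ge_1 by simp
    have 4: "t + n + l + p \<le> 4 * (u + V + p)"
      if "t \<le> 2 * u" "0 \<le> u" "n \<le> 2 * M" "l \<le> y" "M \<le> V" "y \<le> 2 * V" "0 < p" for t u n l y p :: real
      using that by (auto simp: algebra_simps)
    show "(real N + q) * (real L / q + 1) \<le> 4 * (x / q + V + q)"
      unfolding 2 by (rule 4[OF 1 3 N L M(2,3) qp])
  qed (use F in auto)
  let ?Rs = "(\<lambda>a b. real (v a * w b) \<le> x) # Rs"
  have ch: "chain_rel A B' R" if "R \<in> set ?Rs" for R
  proof -
    have "chain_rel A B' (\<lambda>a b. real (v a * w b) \<le> x)"
    proof (rule chain_rel_leI[where \<psi> = "\<lambda>b. real (w b)" and \<phi> = "\<lambda>a. x / v a"])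
      fix a b assume "a \<in> A" "b \<in> B'"
      then have "real (v a) > 0" using A M by force
      then show "(real (v a * w b) \<le> x) = (real (w b) \<le> x / v a)" by (simp add: field_simps)
    qed
    then show ?thesis using that Rs chain_rel_subset[of A B R A B'] by (auto simp: B'_def)
  qed
  note bc = bilinear_bound_chains[OF finAB(1,2) bb ch cB]
  let ?S = "{(a, b) \<in> A \<times> B. real (v a * w b) \<le> x \<and> (\<forall>R\<in>set Rs. R a b)}"
  have "(\<Sum>(a, b)\<in>?S. \<alpha> a * \<beta> b * e (v a * w b)) =
    (\<Sum>(a, b)\<in>A \<times> B'. \<alpha> a * \<beta> b * (if \<forall>R\<in>set ?Rs. R a b then e (v a * w b) else 0))"
  proof (rule sum.mono_neutral_cong_left)
    show "?S \<subseteq> A \<times> B'"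
    proof
      fix p assume "p \<in> ?S"
      then obtain a b where p: "p = (a, b)" and ab: "a \<in> A" "b \<in> B" "real (v a * w b) \<le> x"
        by (cases p) auto
      have "M * real (w b) \<le> real (v a) * real (w b)" using A[OF ab(1)] by (intro mult_right_mono) auto
      then have "real (w b) \<le> x / M" using ab M by (simp add: field_simps)
      then show "p \<in> A \<times> B'" using p ab unfolding B'_def L_def by (auto simp: le_nat_floor)
    qed
  qed (use finAB in \<open>auto simp: B'_def split: if_splits\<close>)
  also have "\<dots> = (\<Sum>a\<in>A. \<Sum>b\<in>B'. \<alpha> a * \<beta> b * (if \<forall>R\<in>set ?Rs. R a b then e (v a * w b) else 0))"
    by (rule sum.cartesian_product[symmetric])
  finally have eq: "(\<Sum>(a, b)\<in>?S. \<alpha> a * \<beta> b * e (v a * w b)) =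
    (\<Sum>a\<in>A. \<Sum>b\<in>B'. \<alpha> a * \<beta> b * (if \<forall>R\<in>set ?Rs. R a b then e (v a * w b) else 0))" .
  have "norm (\<Sum>(a, b)\<in>?S. \<alpha> a * \<beta> b * e (v a * w b)) \<le>
     real (K + 1) ^ length ?Rs * ?D * L2_set (\<lambda>a. norm (\<alpha> a)) A * L2_set (\<lambda>b. norm (\<beta> b)) B'"
    unfolding eq by (rule bilinear_boundD[OF bc])
  also have "\<dots> \<le> real (K + 1) ^ length ?Rs * ?D * sqrt (F1 * (2 * M)) * sqrt (F2 * (x / M))"
  proof (intro mult_mono mult_nonneg_nonneg)
    have "real (card A) \<le> F1 * N" by (rule card_le_fibres[OF v vi])
    also have "\<dots> \<le> F1 * (2 * M)" using N F by (intro mult_left_mono) auto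
    finally show "L2_set (\<lambda>a. norm (\<alpha> a)) A \<le> sqrt (F1 * (2 * M))"
      using L2_set_le_sqrt_card[of A \<alpha>] \<alpha> by (meson order_trans real_sqrt_le_mono)
    have "real (card B') \<le> F2 * (x / M)" using \<open>real (card B') \<le> F2 * L\<close> L F
      by (meson mult_left_mono order_trans zero_le_one)
    then show "L2_set (\<lambda>b. norm (\<beta> b)) B' \<le> sqrt (F2 * (x / M))"
      using L2_set_le_sqrt_card[of B' \<beta>] \<beta> by (metis (no_types, lifting) B'_def mem_Collect_eq order_trans real_sqrt_le_mono)
  qed (use F M in auto)
  also have "\<dots> \<le> (5 * real G) ^ (length Rs + 1) * ?D * sqrt (F1 * (2 * M)) * sqrt (F2 * (x / M))"
  proof (intro mult_right_mono)
    have "real (K + 1) \<le> 5 * real G" unfolding K_def using G_ge by simp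
    then show "real (K + 1) ^ length ?Rs \<le> (5 * real G) ^ (length Rs + 1)"
      using power_mono[of "real (K + 1)" "5 * real G" "length Rs + 1"] by simp
  qed (use F M x_ge_1 in auto)
  also have "\<dots> \<le> (5 * real G) ^ (length Rs + 1) * (sqrt F1 * sqrt F2 * sqrt (4 * (x / q + V + q))) *
      sqrt (F1 * (2 * M)) * sqrt (F2 * (x / M))"
    using D F M x_ge_1 by (intro mult_right_mono mult_left_mono) auto
  also have "\<dots> =
      F1 * F2 * (5 * real G) ^ (length Rs + 1) * sqrt (8 * (x * (x / q + V + q)))"
  proof -
    have a: "sqrt F1 * sqrt F1 = F1" "sqrt F2 * sqrt F2 = F2" using F by auto
    have "sqrt (8 * (x * (x / q + V + q))) = sqrt (4 * (x / q + V + q)) * sqrt (2 * M) * sqrt (x / M)"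
      using M by (simp add: real_sqrt_mult[symmetric] field_simps)
    note eq = this
    have "P * (sqrt F1 * sqrt F2 * S) * sqrt (F1 * (2 * M)) * sqrt (F2 * (x / M)) =
        (sqrt F1 * sqrt F1) * (sqrt F2 * sqrt F2) * P * (S * sqrt (2 * M) * sqrt (x / M))" for P S
      unfolding real_sqrt_mult[of F1 "2 * M"] real_sqrt_mult[of F2 "x / M"] by (simp only: mult_ac)
    then show ?thesis unfolding a eq .
  qed
  also have "\<dots> \<le> F1 * F2 * (5 * real G) ^ (length Rs + 1) * (3 * Bnd V)"
  proof (rule mult_left_mono)
    have "sqrt 8 \<le> (3::real)" by (rule real_le_lsqrt) auto
    then have "sqrt 8 * Bnd V \<le> 3 * Bnd V" using M Bnd_ge(4)[of V] by (intro mult_right_mono) auto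
    then show "sqrt (8 * (x * (x / q + V + q))) \<le> 3 * Bnd V" unfolding Bnd_def by (simp add: real_sqrt_mult)
  qed (use F in simp)
  finally show ?thesis .
qed

text \<open>The range of \<open>v\<close> is cut dyadically. At most \<open>G + 1\<close> blocks
  occur, and \<open>3 * (G + 1) \<le> 5 * G\<close> turns their number and the constant
  \<open>3\<close> of each block into one more power.\<close>

lemma type_II:
  fixes v :: "'a \<Rightarrow> nat" and w :: "'b \<Rightarrow> nat" and U W V :: real
  assumes v: "fibres_le A v F1" and w: "fibres_le B w F2" and F2: "F2 \<le> 2 ^ (3 * G)"
    and A: "\<And>a. a \<in> A \<Longrightarrow> U < v a \<and> v a \<le> W" and V: "0 < U" "x / U \<le> V" "W \<le> V"
    and B: "\<And>b. b \<in> B \<Longrightarrow> 1 \<le> w b"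
    and \<alpha>: "\<And>a. a \<in> A \<Longrightarrow> norm (\<alpha> a) \<le> 1" and \<beta>: "\<And>b. b \<in> B \<Longrightarrow> norm (\<beta> b) \<le> 1"
    and Rs: "\<And>R. R \<in> set Rs \<Longrightarrow> chain_rel A B R"
  shows "norm (\<Sum>(a, b)\<in>{(a, b) \<in> A \<times> B. real (v a * w b) \<le> x \<and> (\<forall>R\<in>set Rs. R a b)}.
            \<alpha> a * \<beta> b * e (v a * w b)) \<le> F1 * F2 * (5 * real G) ^ (length Rs + 2) * Bnd V"
    (is "norm (\<Sum>(a, b)\<in>?S A. ?t a b) \<le> _")
proof -
  have fin: "finite A" "finite B" and F: "1 \<le> F1" "1 \<le> F2" using v w unfolding fibres_le_def by auto
  have V0: "0 \<le> V" using V x_ge_1 by (meson divide_nonneg_pos order_trans zero_le_one)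
  let ?i = "\<lambda>s. floor_log (v (fst s))"
  let ?A = "\<lambda>i. {a \<in> A. floor_log (v a) = i}"
  let ?E = "F1 * F2 * (5 * real G) ^ (length Rs + 1) * (3 * Bnd V)"
  have E0: "0 \<le> ?E" using F Bnd_ge(4)[OF V0] by simp
  have finS: "finite (?S A)" by (rule finite_subset[of _ "A \<times> B"]) (use fin in auto)
  have im: "?i ` ?S A \<subseteq> {..G}"
  proof
    fix i assume "i \<in> ?i ` ?S A"
    then obtain a b where ab: "a \<in> A" "b \<in> B" "real (v a * w b) \<le> x" "i = floor_log (v a)" by auto
    have v0: "v a > 0" using A[OF ab(1)] V(1) by (metis gr0I less_asym of_nat_0)
    have "v a \<le> v a * w b" using B[OF ab(2)] by simp
    then have "real (v a) \<le> 2 ^ G" using ab(3) x_le by (meson of_nat_le_iff order_trans)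
    then have "v a \<le> 2 ^ G" by (metis of_nat_le_iff of_nat_numeral of_nat_power)
    then have "floor_log (v a) \<le> floor_log (2 ^ G)" by (rule floor_log_le_iff)
    then show "i \<in> {..G}" using ab(4) by simp
  qed
  have blk: "norm (\<Sum>(a, b)\<in>?S (?A i). ?t a b) \<le> ?E" for i
  proof (cases "?A i = {}")
    case True
    then have eq: "?S (?A i) = {}" by auto
    show ?thesis by (simp only: eq sum.empty norm_zero E0)
  next
    case False
    have pw: "2 ^ i \<le> real (v a) \<and> real (v a) \<le> 2 * 2 ^ i" if "a \<in> ?A i" for a
    proof -
      have "real (v a) > 0" using A[of a] that V(1) by auto
      then have v0: "v a > 0" by simp
      have "2 ^ i \<le> v a" "v a < 2 * 2 ^ i"
        using that floor_log_exp2_le[OF v0] floor_log_exp2_gt[of "v a"] by auto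
      then have "real (2 ^ i) \<le> real (v a) \<and> real (v a) \<le> real (2 * 2 ^ i)"
        by (metis less_imp_le of_nat_le_iff)
      then show ?thesis by simp
    qed
    obtain a where a: "a \<in> ?A i" using False by blast
    have aU: "U < v a" "v a \<le> W" using A a by auto
    show ?thesis
    proof (rule type_II_block[OF fibres_le_subset[OF v] w F2 pw])
      show "(2::real) ^ i \<le> V" using pw[OF a] aU V by linarith
      \<comment> \<open>The block containing some \<open>v a > U\<close> may begin below
        \<open>U\<close>, though not below \<open>U / 2\<close>; hence the slack
        \<open>2 * V\<close> that a block allows.\<close>
      have "x / 2 ^ i \<le> 2 * (x / U)"
      proof -
        have "U \<le> 2 * 2 ^ i" using pw[OF a] aU by linarith
        then have "x * U \<le> x * (2 * 2 ^ i)" using x_ge_1 by (intro mult_left_mono) auto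
        then show ?thesis using V(1) by (simp add: field_simps)
      qed
      then show "x / 2 ^ i \<le> 2 * V" using V by linarith
    qed (use B \<alpha> \<beta> Rs chain_rel_subset[of A B] in \<open>auto intro: chain_rel_subset[of A B]\<close>)
  qed
  have "(\<Sum>(a, b)\<in>?S A. ?t a b) = (\<Sum>i\<le>G. \<Sum>s\<in>{s \<in> ?S A. ?i s = i}. case s of (a, b) \<Rightarrow> ?t a b)"
    by (rule sum.group[symmetric]) (use finS im in auto)
  also have "\<dots> = (\<Sum>i\<le>G. \<Sum>(a, b)\<in>?S (?A i). ?t a b)"
    by (intro sum.cong refl) auto
  also have "norm \<dots> \<le> (\<Sum>i\<le>G. ?E)" by (rule sum_norm_le) (rule blk)
  also have "\<dots> = real (3 * (G + 1)) * (F1 * F2 * (5 * real G) ^ (length Rs + 1) * Bnd V)" by simp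
  also have "\<dots> \<le> (5 * real G) * (F1 * F2 * (5 * real G) ^ (length Rs + 1) * Bnd V)"
    using G_ge F Bnd_ge(4)[OF V0] by (intro mult_right_mono) auto
  finally show ?thesis by (simp add: mult_ac)
qed

lemma nat_le_pow_G:
  assumes "real n \<le> x"
  shows "n \<le> 2 ^ G"
proof -
  have "real n \<le> real (2 ^ G)"
    using order_trans[OF assms x_le] by (simp only: of_nat_power of_nat_numeral)
  then show ?thesis by (simp only: of_nat_le_iff)
qed

text \<open>Multiplication by \<open>a\<close> permutes the residues modulo \<open>q\<close>, so up
  to order the terms are bounded by \<open>q / (2 * min r (q - r))\<close>, and the sum is
  harmonic.\<close>

lemma sum_inverse_norm_le:
  "(\<Sum>m<q. 2 / norm (1 - e m)) \<le> real q * (G + 1)"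
proof -
  \<comment> \<open>This is \<open>2\<close> divided by the lower bound of
    \<open>norm_1_minus_e_ge\<close>. The residue \<open>0\<close> causes no trouble:
    \<open>h 0\<close> and the term for \<open>m = 0\<close> are both \<open>0\<close> by the
    convention for division by zero.\<close>
  define h where "h r = real q / (2 * real (min r (q - r)))" for r
  define \<rho> where "\<rho> m = nat ((a * int m) mod int q)" for m
  have qp: "int q > 0" using q_pos by simp
  have \<rho>: "int (\<rho> m) = (a * int m) mod int q" "\<rho> m < q" for m
    using qp unfolding \<rho>_def by (auto simp: nat_less_iff)
  have "2 / norm (1 - e m) \<le> h (\<rho> m)" if "m < q" for m
  proof (cases "m = 0")
    case True
    then show ?thesis by (simp add: e_def h_def)
  next
    case False
    have "\<not> int q dvd a * int m"
    proof
      assume "int q dvd a * int m"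
      then have "int q dvd int m" using coprime_aq by (metis coprime_commute coprime_dvd_mult_right_iff)
      then show False using that False by (simp add: nat_dvd_not_less)
    qed
    then have "\<rho> m \<noteq> 0" using \<rho>(1)[of m] by (metis dvd_eq_mod_eq_0 of_nat_0)
    then have mp: "real (min (\<rho> m) (q - \<rho> m)) > 0" using \<rho>(2)[of m] by simp
    have "4 * real (min (\<rho> m) (q - \<rho> m)) / q \<le> norm (1 - e m)"
      by (rule norm_1_minus_e_ge) (use \<rho> in auto)
    then have "2 / norm (1 - e m) \<le> 2 / (4 * real (min (\<rho> m) (q - \<rho> m)) / q)"
      using mp q_pos by (intro frac_le) auto
    then show ?thesis unfolding h_def by simp
  qed
  then have "(\<Sum>m<q. 2 / norm (1 - e m)) \<le> (\<Sum>m<q. h (\<rho> m))" by (intro sum_mono) auto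
  also have "\<dots> = sum h (\<rho> ` {..<q})"
  proof (rule sum.reindex[symmetric, unfolded o_def])
    show "inj_on \<rho> {..<q}"
    proof (rule inj_onI)
      fix m n assume mn: "m \<in> {..<q}" "n \<in> {..<q}" "\<rho> m = \<rho> n"
      then have "(a * int m) mod int q = (a * int n) mod int q" using \<rho>(1) by metis
      then have "int q dvd a * (int m - int n)" by (simp add: mod_eq_dvd_iff right_diff_distrib)
      then have "int q dvd int m - int n" using coprime_aq by (metis coprime_commute coprime_dvd_mult_right_iff)
      then have "int m mod int q = int n mod int q" by (simp add: mod_eq_dvd_iff)
      then show "m = n" using mn by simp
    qed
  qed
  also have "\<dots> \<le> sum h {..<q}" by (rule sum_mono2) (use \<rho> in \<open>auto simp: h_def\<close>)
  also have "\<dots> = (\<Sum>r=1..q - 1. h r)"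
    by (rule sum.mono_neutral_right) (auto simp: h_def Suc_le_eq)
  also have "\<dots> \<le> (\<Sum>r=1..q - 1. real q / 2 * (1 / real r + 1 / real (q - r)))"
    by (intro sum_mono) (auto simp: h_def min_def field_simps)
  also have "\<dots> = real q / 2 * ((\<Sum>r=1..q - 1. 1 / real r) + (\<Sum>r=1..q - 1. 1 / real (q - r)))"
    by (simp only: sum_distrib_left[symmetric] sum.distrib)
  also have "(\<Sum>r=1..q - 1. 1 / real (q - r)) = (\<Sum>r=1..q - 1. 1 / real r)"
    by (rule sum.reindex_bij_witness[of _ "\<lambda>r. q - r" "\<lambda>r. q - r"]) auto
  also have "real q / 2 * ((\<Sum>r=1..q - 1. 1 / real r) + (\<Sum>r=1..q - 1. 1 / real r)) =
      real q * (\<Sum>r=1..q - 1. 1 / real r)" by simp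
  also have "\<dots> \<le> real q * (G + 1)"
  proof (rule mult_left_mono)
    have "q - 1 \<le> 2 ^ G" using nat_le_pow_G[OF q_le_x] by simp
    then show "(\<Sum>r=1..q - 1. 1 / real r) \<le> G + 1" using harm_le_log[of "q - 1" G] by simp
  qed simp
  finally show ?thesis .
qed

text \<open>A sum over an interval of \<open>k\<close> is geometric with ratio
  \<open>e (v c)\<close>; only when \<open>q\<close> divides \<open>v c\<close> one falls back on
  the trivial \<open>x / v c\<close>. Norms are taken for each \<open>c\<close> separately, so
  bounded coefficients in \<open>c\<close> may be attached later and the interval may depend on
  \<open>c\<close>.\<close>

lemma type_I:
  fixes v :: "'c \<Rightarrow> nat" and Y V :: real
  assumes v: "fibres_le C v F" and C: "\<And>c. c \<in> C \<Longrightarrow> 1 \<le> v c \<and> v c \<le> Y"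
    and Y: "Y \<le> x" "Y \<le> sqrt (x * V)" "0 \<le> V"
    and I: "\<And>c. c \<in> C \<Longrightarrow> I c \<subseteq> {k. 1 \<le> k \<and> real (v c * k) \<le> x}"
    and cvx: "\<And>c i j k. c \<in> C \<Longrightarrow> i \<in> I c \<Longrightarrow> k \<in> I c \<Longrightarrow> i \<le> j \<Longrightarrow> j \<le> k \<Longrightarrow> j \<in> I c"
  shows "(\<Sum>c\<in>C. norm (\<Sum>k\<in>I c. e (v c * k))) \<le> F * (5 * real G) * Bnd V"
proof (cases "C = {}")
  case True
  then show ?thesis using v Bnd_ge(4)[OF Y(3)] unfolding fibres_le_def by simp
next
  case False
  then have Y1: "1 \<le> Y" using C by force
  have fin: "finite C" and F: "1 \<le> F" and c: "\<And>n. real (card {c \<in> C. v c = n}) \<le> F"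
    using v unfolding fibres_le_def by auto
  define N where "N = nat \<lfloor>Y\<rfloor>"
  have N: "real N \<le> Y" unfolding N_def using Y1 by auto
  define f where "f m = 2 / norm (1 - e m)" for m
  \<comment> \<open>\<open>g\<close> takes over at the multiples of \<open>q\<close>, where
    \<open>f\<close> is \<open>0\<close> by the convention for division by zero.\<close>
  define g where "g m = (if q dvd m then x / m else 0)" for m
  have pt: "norm (\<Sum>k\<in>I c. e (v c * k)) \<le> f (v c) + g (v c)" if "c \<in> C" for c
  proof (cases "q dvd v c")
    case True
    have vp: "real (v c) > 0" using C[OF that] by simp
    have sub: "I c \<subseteq> {1..nat \<lfloor>x / v c\<rfloor>}"
      using I[OF that] vp by (auto simp: le_nat_floor field_simps)
    have "norm (\<Sum>k\<in>I c. e (v c * k)) \<le> (\<Sum>k\<in>I c. 1)" by (rule sum_norm_le) simp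
    also have "\<dots> = real (card (I c))" by simp
    also have "\<dots> \<le> real (nat \<lfloor>x / v c\<rfloor>)" using card_mono[OF _ sub] by simp
    also have "\<dots> \<le> x / v c" using x_ge_1 by (intro of_nat_floor) simp
    finally show ?thesis using True by (simp add: f_def g_def e_eq_1_iff[THEN iffD2])
  next
    case False
    have "finite (I c)"
    proof (rule finite_subset[OF I[OF that] finite_subset[OF _ nat_le_x]])
      show "{k. 1 \<le> k \<and> real (v c * k) \<le> x} \<subseteq> {k. real k \<le> x}"
      proof clarify
        fix k assume "1 \<le> k" "real (v c * k) \<le> x"
        moreover have "k \<le> v c * k" using C[OF that] by simp
        ultimately show "real k \<le> x" by (meson of_nat_le_iff order_trans)
      qed
    qed
    then have "\<exists>i j. I c = {i..j}"
      by (rule finite_convex_nat) (rule cvx[OF that])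
    then obtain i j where "I c = {i..j}" by blast
    then show ?thesis using norm_interval_sum_le[OF False, of i j] False by (simp add: f_def g_def)
  qed
  have f0: "0 \<le> f m" "0 \<le> g m" for m using x_ge_1 by (auto simp: f_def g_def)
  have "(\<Sum>c\<in>C. norm (\<Sum>k\<in>I c. e (v c * k))) \<le> (\<Sum>c\<in>C. f (v c) + g (v c))"
    by (rule sum_mono) (rule pt)
  also have "\<dots> = (\<Sum>n=1..N. \<Sum>c\<in>{c \<in> C. v c = n}. f (v c) + g (v c))"
    by (rule sum.group[symmetric]) (use fin C in \<open>auto simp: N_def le_nat_floor\<close>)
  also have "\<dots> = (\<Sum>n=1..N. real (card {c \<in> C. v c = n}) * (f n + g n))"
    by (intro sum.cong refl) simp
  also have "\<dots> \<le> (\<Sum>n=1..N. F * (f n + g n))"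
    using c f0 by (intro sum_mono mult_right_mono) auto
  also have "\<dots> = F * ((\<Sum>n=1..N. f n) + (\<Sum>n=1..N. g n))"
    by (simp add: sum_distrib_left sum.distrib distrib_left)
  also have "\<dots> \<le> F * ((Y + q) * (G + 1) + x / q * (G + 1))"
  proof (intro mult_left_mono add_mono)
    have "(\<Sum>n=1..N. f n) \<le> (real N / q + 1) * (\<Sum>m<q. f m)"
      by (rule periodic_sum_le[OF q_pos f0(1)]) (simp add: f_def e_mod)
    also have "\<dots> \<le> (Y / q + 1) * (real q * (G + 1))"
      using sum_inverse_norm_le N Y1 q_pos unfolding f_def
      by (intro mult_mono add_right_mono divide_right_mono sum_nonneg) auto
    also have "\<dots> = (Y + q) * (G + 1)" using q_pos by (simp add: field_simps)
    finally show "(\<Sum>n=1..N. f n) \<le> (Y + q) * (G + 1)" .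
    have "(\<Sum>n=1..N. g n) = (\<Sum>n\<in>{n \<in> {1..N}. q dvd n}. x / n)"
      by (rule sum.mono_neutral_cong_right) (auto simp: g_def)
    also have "\<dots> \<le> (\<Sum>n\<in>(\<lambda>j. q * j) ` {1..N}. x / n)"
    proof (rule sum_mono2)
      show "{n \<in> {1..N}. q dvd n} \<subseteq> (\<lambda>j. q * j) ` {1..N}"
      proof clarify
        fix n assume n: "n \<in> {1..N}" "q dvd n"
        then obtain j where j: "n = q * j" by (elim dvdE)
        have "j \<le> q * j" using q_pos by simp
        then have "j \<in> {1..N}" using n j by (cases j) auto
        then show "n \<in> (\<lambda>j. q * j) ` {1..N}" using j by blast
      qed
    qed (use x_ge_1 in auto)
    also have "\<dots> = (\<Sum>j=1..N. x / real (q * j))"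
      by (subst sum.reindex) (use q_pos in \<open>auto simp: inj_on_def\<close>)
    also have "\<dots> = x / q * (\<Sum>j=1..N. 1 / real j)" by (simp add: sum_distrib_left)
    also have "\<dots> \<le> x / q * (G + 1)"
    proof (rule mult_left_mono)
      have "N \<le> 2 ^ G" using N Y by (intro nat_le_pow_G) linarith
      then show "(\<Sum>j=1..N. 1 / real j) \<le> G + 1" using harm_le_log[of N G] by simp
    qed (use x_ge_1 in simp)
    finally show "(\<Sum>n=1..N. g n) \<le> x / q * (G + 1)" .
  qed (use F in simp)
  also have "\<dots> = F * (G + 1) * (Y + q + x / q)"
    by (simp only: distrib_right[symmetric] mult.assoc mult.commute[of "real (G + 1)"])
  also have "\<dots> \<le> F * (G + 1) * (3 * Bnd V)"
    using F Bnd_ge[OF Y(3)] Y(2) by (intro mult_left_mono) auto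
  also have "\<dots> = F * (3 * (G + 1)) * Bnd V" by simp
  also have "\<dots> \<le> F * (5 * real G) * Bnd V"
    using F G_ge Bnd_ge[OF Y(3)] by (intro mult_right_mono mult_left_mono) auto
  finally show ?thesis .
qed

end

section \<open>Smooth numbers and the Legendre sieve\<close>

text \<open>A \<open>z\<close>-smooth number is encoded by the list of its prime factors in increasing order, strictly
  increasing (\<open>t = 1\<close>) for the squarefree numbers occurring in the Legendre sieve.\<close>

definition prime_lists :: "nat \<Rightarrow> real \<Rightarrow> real \<Rightarrow> nat list set" where
  "prime_lists t z X = {ps. sorted_wrt (\<lambda>i j. i + t \<le> j) ps \<and> (\<forall>p\<in>set ps. prime p \<and> real p \<le> z)
     \<and> real (prod_list ps) \<le> X}"

lemma prime_lists_sorted: "ps \<in> prime_lists t z X \<Longrightarrow> sorted ps"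
  unfolding prime_lists_def by (auto elim!: sorted_wrt_mono_rel[rotated])

lemma prime_factorization_prod_list:
  assumes "\<forall>p\<in>set ps. prime (p::nat)"
  shows "prime_factorization (prod_list ps) = mset ps"
  using prime_factorization_prod_mset_primes[of "mset ps"] assms by (simp add: prod_mset_prod_list)

lemma prod_list_prime_ge_1: "\<forall>p\<in>set ps. prime (p::nat) \<Longrightarrow> 1 \<le> prod_list ps"
  by (induction ps) (auto simp: prime_gt_0_nat Suc_le_eq)

lemma prime_lists_ge_1: "ps \<in> prime_lists t z X \<Longrightarrow> 1 \<le> prod_list ps"
  unfolding prime_lists_def by (intro prod_list_prime_ge_1) auto

lemma inj_on_prod_list_prime_lists: "inj_on prod_list (prime_lists t z X)"
proof (rule inj_onI)
  fix ps qs assume a: "ps \<in> prime_lists t z X" "qs \<in> prime_lists t z X" "prod_list ps = prod_list qs"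
  then have "mset ps = mset qs"
    using prime_factorization_prod_list[of ps] prime_factorization_prod_list[of qs]
    unfolding prime_lists_def by auto
  then show "ps = qs" using a(1,2)[THEN prime_lists_sorted] by (metis properties_for_sort)
qed

lemma finite_prime_lists: "finite (prime_lists t z X)"
proof (rule finite_imageD[OF _ inj_on_prod_list_prime_lists])
  have "prod_list ` prime_lists t z X \<subseteq> {..nat \<lfloor>X\<rfloor>}"
    by (auto simp: prime_lists_def le_nat_floor)
  then show "finite (prod_list ` prime_lists t z X)" by (rule finite_subset) simp
qed

lemma fibres_le_inj:
  assumes "finite A" "inj_on v A"
  shows "fibres_le A v 1"
  unfolding fibres_le_def
proof (intro conjI allI)
  fix n
  have "card {a \<in> A. v a = n} \<le> 1"
    using assms by (auto simp: card_le_Suc0_iff_eq inj_on_def)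
  then show "real (card {a \<in> A. v a = n}) \<le> 1" by simp
qed (use assms in auto)

lemma prime_lists_append:
  "ds @ es \<in> prime_lists t z X \<longleftrightarrow> sorted_wrt (\<lambda>i j. i + t \<le> j) ds \<and> sorted_wrt (\<lambda>i j. i + t \<le> j) es \<and>
     (\<forall>i\<in>set ds. \<forall>j\<in>set es. i + t \<le> j) \<and> (\<forall>p\<in>set ds. prime p \<and> real p \<le> z) \<and>
     (\<forall>p\<in>set es. prime p \<and> real p \<le> z) \<and> real (prod_list ds * prod_list es) \<le> X"
  unfolding prime_lists_def by (auto simp: sorted_wrt_append)

text \<open>\<open>ds\<close> is the shortest prefix whose product with \<open>v\<close> exceeds
  \<open>U\<close>; the bound for \<open>butlast ds\<close> expresses minimality. It keeps that
  product within one prime factor of \<open>U\<close> and makes the cut unique.\<close>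

lemma exists_cut:
  fixes U :: real and v :: nat
  assumes "U < real (v * prod_list ps)" "real v \<le> U"
  shows "\<exists>ds es. ps = ds @ es \<and> ds \<noteq> [] \<and> U < real (v * prod_list ds) \<and> real (v * prod_list (butlast ds)) \<le> U"
  using assms
proof (induction ps rule: rev_induct)
  case Nil
  then show ?case by simp
next
  case (snoc p ps)
  show ?case
  proof (cases "U < real (v * prod_list ps)")
    case True
    then obtain ds es where "ps = ds @ es" "ds \<noteq> []" "U < real (v * prod_list ds)"
      "real (v * prod_list (butlast ds)) \<le> U" using snoc by blast
    then show ?thesis by (intro exI[of _ ds] exI[of _ "es @ [p]"]) auto
  next
    case False
    then show ?thesis using snoc.prems by (intro exI[of _ "ps @ [p]"] exI[of _ "[]"]) auto
  qed
qed

lemma cut_aux: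
  fixes U :: real and v :: nat
  assumes "ds = es @ us" "U < real (v * prod_list es)" "real (v * prod_list (butlast ds)) \<le> U"
    "\<forall>p\<in>set ds. prime p"
  shows "us = []"
proof (rule ccontr)
  assume "us \<noteq> []"
  then have "butlast ds = es @ butlast us" using assms(1) by (simp add: butlast_append)
  moreover have "1 \<le> prod_list (butlast us)"
    using assms(1,4) by (intro prod_list_prime_ge_1) (auto dest: in_set_butlastD)
  ultimately have "prod_list es \<le> prod_list (butlast ds)" by simp
  then have "real (v * prod_list es) \<le> real (v * prod_list (butlast ds))"
    by (intro of_nat_mono mult_le_mono2)
  then show False using assms by linarith
qed

text \<open>Of two cuts of the same list one is a prefix of the other. If it were a proper prefix,
  its product could not exceed that of the \<open>butlast\<close> of the longer one, contrary to
  being larger than \<open>U\<close>.\<close>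

lemma cut_unique:
  fixes U :: real and v :: nat
  assumes "ds @ ds' = es @ es'" "U < real (v * prod_list ds)" "real (v * prod_list (butlast ds)) \<le> U"
    "U < real (v * prod_list es)" "real (v * prod_list (butlast es)) \<le> U"
    "\<forall>p\<in>set (ds @ ds'). prime p"
  shows "ds = es \<and> ds' = es'"
proof -
  obtain us where "ds = es @ us \<and> us @ ds' = es' \<or> ds @ us = es \<and> ds' = us @ es'"
    using assms(1) unfolding append_eq_append_conv2 by blast
  then show ?thesis
  proof
    assume a: "ds = es @ us \<and> us @ ds' = es'"
    moreover have "\<forall>p\<in>set ds. prime p" using assms(6) by simp
    ultimately have "us = []" using cut_aux[OF _ assms(4,3)] by blast
    then show ?thesis using a by simp
  next
    assume a: "ds @ us = es \<and> ds' = us @ es'"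
    moreover have "\<forall>p\<in>set es. prime p" using assms(1,6) by (simp only: set_append) simp
    ultimately have "us = []" using cut_aux[OF _ assms(2,5)] by blast
    then show ?thesis using a by simp
  qed
qed

lemma sum_Pow_alternating:
  assumes "finite P"
  shows "(\<Sum>X\<in>Pow P. (- 1 :: complex) ^ card X) = (if P = {} then 1 else 0)"
proof -
  have "(\<Sum>X\<in>Pow P. (- 1 :: complex) ^ card X) = (\<Prod>x\<in>P. (- 1 :: complex) + 1)"
    using prod_add[OF assms, of "\<lambda>_. - 1 :: complex" "\<lambda>_. 1"] by simp
  also have "\<dots> = (if P = {} then 1 else 0)" using assms by (simp add: card_gt_0_iff)
  finally show ?thesis .
qed

definition rough :: "real \<Rightarrow> nat \<Rightarrow> bool" where
  "rough z k \<longleftrightarrow> (\<forall>p. prime p \<longrightarrow> p dvd k \<longrightarrow> z < real p)"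

lemma prod_primes_dvd:
  assumes "finite X" "\<And>p. p \<in> X \<Longrightarrow> prime p \<and> p dvd (k::nat)"
  shows "\<Prod>X dvd k"
  using assms
proof (induction X rule: finite_induct)
  case (insert p X)
  have "coprime p (\<Prod>X)"
    by (rule prod_coprime_right) (use insert in \<open>auto intro!: primes_coprime\<close>)
  then show ?case using insert by (simp add: divides_mult)
qed simp

lemma add_one_le_eq_less: "(\<lambda>i j :: nat. i + 1 \<le> j) = (<)"
  by (auto simp: fun_eq_iff)

text \<open>Inclusion-exclusion: the strictly increasing lists whose product divides
  \<open>k\<close> are the subsets of the primes up to \<open>z\<close> that divide
  \<open>k\<close>, and the alternating sum is a power of \<open>1 - 1\<close>. The bound
  \<open>X\<close> for \<open>k\<close> ensures that none of these products is lost in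
  \<open>prime_lists\<close>.\<close>

lemma legendre_sieve:
  assumes k: "1 \<le> k" "real k \<le> X"
  shows "(\<Sum>ps\<in>{ps \<in> prime_lists 1 z X. prod_list ps dvd k}. (- 1 :: complex) ^ length ps) =
    (if rough z k then 1 else 0)"
proof -
  define P where "P = {p. prime p \<and> p dvd k \<and> real p \<le> z}"
  have finP: "finite P"
    by (rule finite_subset[of _ "{d. d dvd k}"]) (use k in \<open>auto simp: P_def\<close>)
  have "(\<Sum>ps\<in>{ps \<in> prime_lists 1 z X. prod_list ps dvd k}. (- 1 :: complex) ^ length ps) =
    (\<Sum>X\<in>Pow P. (- 1) ^ card X)"
  proof (rule sum.reindex_bij_witness[of _ sorted_list_of_set set])
    fix ps assume "ps \<in> {ps \<in> prime_lists 1 z X. prod_list ps dvd k}"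
    then have s: "sorted_wrt (<) ps" and p: "\<forall>p\<in>set ps. prime p \<and> real p \<le> z" and d: "prod_list ps dvd k"
      unfolding prime_lists_def add_one_le_eq_less by auto
    show "sorted_list_of_set (set ps) = ps"
      using s by (simp add: strict_sorted_iff sorted_list_of_set.idem_if_sorted_distinct)
    show "set ps \<in> Pow P"
      using p d unfolding P_def by (auto intro: dvd_trans[OF prod_list_dvd])
    show "(- 1 :: complex) ^ card (set ps) = (- 1) ^ length ps"
      using s by (simp add: strict_sorted_iff distinct_card)
  next
    fix Q assume "Q \<in> Pow P"
    then have Q: "Q \<subseteq> P" "finite Q" using finP finite_subset by auto
    show "set (sorted_list_of_set Q) = Q" using Q by simp
    have pl: "prod_list (sorted_list_of_set Q) = \<Prod>Q"
      using prod.distinct_set_conv_list[of "sorted_list_of_set Q" id] Q by simp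
    have "\<Prod>Q dvd k" by (rule prod_primes_dvd) (use Q in \<open>auto simp: P_def\<close>)
    moreover from this have "real (\<Prod>Q) \<le> X"
      using k dvd_imp_le[of "\<Prod>Q" k] by (meson less_le_trans less_one of_nat_le_iff order_trans zero_less_one)
    ultimately show "sorted_list_of_set Q \<in> {ps \<in> prime_lists 1 z X. prod_list ps dvd k}"
      using Q strict_sorted_list_of_set[of Q] pl unfolding prime_lists_def P_def add_one_le_eq_less by auto
  qed
  also have "\<dots> = (if P = {} then 1 else 0)" by (rule sum_Pow_alternating[OF finP])
  also have "P = {} \<longleftrightarrow> rough z k" unfolding P_def rough_def by (auto simp: not_le)
  finally show ?thesis by simp
qed

type_synonym ('a, 'b) cond = "('a \<Rightarrow> real) \<times> ('b \<Rightarrow> real) \<times> nat \<times> bool"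

text \<open>Side conditions compare a monomial with \<open>1\<close>. This shape survives every
  splitting of \<open>k\<close> into factors, since these can be moved to either variable, and
  afterwards the condition is again a chain relation. With \<open>\<theta> = 0\<close> it ignores
  \<open>k\<close>.\<close>

definition holds :: "('a, 'b) cond \<Rightarrow> 'a \<Rightarrow> 'b \<Rightarrow> nat \<Rightarrow> bool" where
  "holds c a b k = (case c of (f, h, \<theta>, s) \<Rightarrow> (f a * h b * real k ^ \<theta> \<le> 1) = s)"

text \<open>Positive \<open>f\<close> yields the chain relation; together with nonnegative
  \<open>h\<close> it makes the monomial monotone in \<open>k\<close>.\<close>

definition pos_cond :: "'a set \<Rightarrow> 'b set \<Rightarrow> ('a, 'b) cond \<Rightarrow> bool" where
  "pos_cond A B c = (case c of (f, h, \<theta>, s) \<Rightarrow> (\<forall>a\<in>A. 0 < f a) \<and> (\<forall>b\<in>B. 0 \<le> h b))"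

section \<open>Cutting a list of primes into type II form\<close>

context exp_sum_setting
begin

text \<open>The list \<open>ps\<close> is cut where its product with \<open>v a\<close> first
  exceeds \<open>U\<close>: the left variable \<open>(a, ds)\<close> then lies in
  \<open>(U, U * z]\<close>, and the right one is \<open>(b, es)\<close>. The weight
  \<open>c ^ length ps\<close> factors along the cut; \<open>c = 1\<close> serves smooth numbers and
  \<open>c = - 1\<close> the sieve. The exponent collects \<open>length cs + 1\<close> conditions,
  \<open>2\<close> from \<open>type_II\<close>, and \<open>2\<close> for the multiplicities of the
  new variables.\<close>

lemma smooth_type_II:
  fixes v :: "'a \<Rightarrow> nat" and w :: "'b \<Rightarrow> nat" and z U V F1 F2 :: real and c :: complex
  assumes v: "fibres_le A v F1" and w: "fibres_le B w F2" and F2: "F2 * G \<le> 2 ^ (3 * G)"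
    and A: "\<And>a. a \<in> A \<Longrightarrow> 1 \<le> v a \<and> v a \<le> U" and B: "\<And>b. b \<in> B \<Longrightarrow> 1 \<le> w b"
    and V: "0 < U" "U * z \<le> V" "x / U \<le> V"
    and \<alpha>: "\<And>a. a \<in> A \<Longrightarrow> norm (\<alpha> a) \<le> 1" and \<beta>: "\<And>b. b \<in> B \<Longrightarrow> norm (\<beta> b) \<le> 1"
    and c: "norm c = 1" and cs: "\<And>d. d \<in> set cs \<Longrightarrow> pos_cond A B d"
  shows "norm (\<Sum>(a, ps, b)\<in>{(a, ps, b). a \<in> A \<and> ps \<in> prime_lists t z x \<and> b \<in> B \<and>
       real (v a * prod_list ps * w b) \<le> x \<and> U < real (v a * prod_list ps) \<and>
       (\<forall>d\<in>set cs. holds d a b (prod_list ps))}.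
       \<alpha> a * c ^ length ps * \<beta> b * e (v a * prod_list ps * w b)) \<le> F1 * F2 * (5 * real G) ^ (length cs + 5) * Bnd V"
    (is "norm (sum ?g ?S) \<le> _")
proof -
  have finA: "finite A" "finite B" and F: "1 \<le> F1" "1 \<le> F2" using v w unfolding fibres_le_def by auto
  have "0 \<le> x / U" using V(1) x_ge_1 by simp
  then have V0: "0 \<le> V" using V(3) by linarith
  define PL where "PL = prime_lists t z x"
  have finPL: "finite PL" and fPL: "fibres_le PL prod_list 1"
    unfolding PL_def by (auto intro: finite_prime_lists fibres_le_inj inj_on_prod_list_prime_lists)
  define v' where "v' = (\<lambda>(a, ds). v a * prod_list ds)"
  define w' where "w' = (\<lambda>(b, es). w b * prod_list es)"
  define A' where "A' = {(a, ds). a \<in> A \<and> ds \<in> PL \<and> ds \<noteq> [] \<and> U < real (v a * prod_list ds) \<and>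
      real (v a * prod_list (butlast ds)) \<le> U \<and> real (v a * prod_list ds) \<le> x}"
  define B' where "B' = {(b, es). b \<in> B \<and> es \<in> PL \<and> real (w b * prod_list es) \<le> x}"
  define R1 :: "'a \<times> nat list \<Rightarrow> 'b \<times> nat list \<Rightarrow> bool"
    where "R1 = (\<lambda>p r. \<forall>i\<in>set (snd p). \<forall>j\<in>set (snd r). i + t \<le> j)"
  define Rc :: "('a, 'b) cond \<Rightarrow> 'a \<times> nat list \<Rightarrow> 'b \<times> nat list \<Rightarrow> bool"
    where "Rc d = (\<lambda>p r. holds d (fst p) (fst r) (prod_list (snd p) * prod_list (snd r)))" for d
  let ?Rs = "R1 # map Rc cs"
  have v': "fibres_le A' v' (F1 * 1 * G)" unfolding v'_def
    by (rule fibres_le_prod[OF v fPL])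
       (use A prime_lists_ge_1 in \<open>auto simp: A'_def PL_def simp del: One_nat_def intro: mult_le_mono[of 1 _ 1, simplified]\<close>)
  have w': "fibres_le B' w' (F2 * 1 * G)" unfolding w'_def
    by (rule fibres_le_prod[OF w fPL])
       (use B prime_lists_ge_1 in \<open>auto simp: B'_def PL_def simp del: One_nat_def intro: mult_le_mono[of 1 _ 1, simplified]\<close>)
  have chain: "chain_rel A' B' R" if "R \<in> set ?Rs" for R
  proof -
    have "chain_rel A' B' R1"
    \<comment> \<open>Only the largest entry of \<open>ds\<close> and the smallest entry of
      \<open>es\<close> matter. For empty \<open>es\<close> the stand-in \<open>z + t + 1\<close>
      lies above \<open>t\<close> plus any entry of \<open>ds\<close>, so that the condition holds
      as it should.\<close>
    proof (rule chain_rel_leI[where \<phi> = "\<lambda>p. - real (Max (set (snd p)) + t)"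
          and \<psi> = "\<lambda>r. - (if snd r = [] then z + t + 1 else real (Min (set (snd r))))"])
      fix p r assume p: "p \<in> A'" and r: "r \<in> B'"
      have ne: "snd p \<noteq> []" and le: "\<forall>i\<in>set (snd p). real i \<le> z"
        using p by (auto simp: A'_def PL_def prime_lists_def)
      have M: "Max (set (snd p)) \<in> set (snd p)" using ne by simp
      show "R1 p r \<longleftrightarrow> - (if snd r = [] then z + t + 1 else real (Min (set (snd r)))) \<le> - real (Max (set (snd p)) + t)"
      proof (cases "snd r = []")
        case True
        have "real (Max (set (snd p))) \<le> z" using le M by blast
        then show ?thesis using True by (simp add: R1_def)
      next
        case False
        have m: "Min (set (snd r)) \<in> set (snd r)" using False by simp
        have "R1 p r \<longleftrightarrow> Max (set (snd p)) + t \<le> Min (set (snd r))"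
        proof
          assume "R1 p r" then show "Max (set (snd p)) + t \<le> Min (set (snd r))"
            using M m unfolding R1_def by blast
        next
          assume *: "Max (set (snd p)) + t \<le> Min (set (snd r))"
          have "i + t \<le> j" if "i \<in> set (snd p)" "j \<in> set (snd r)" for i j
            using Max_ge[OF _ that(1)] Min_le[OF _ that(2)] * by simp
          then show "R1 p r" unfolding R1_def by blast
        qed
        then show ?thesis using False by (simp flip: of_nat_add)
      qed
    qed
    moreover have "chain_rel A' B' (Rc d)" if d: "d \<in> set cs" for d
    proof -
      obtain f h \<theta> s where d': "d = (f, h, \<theta>, s)" by (cases d) auto
      show ?thesis
      proof (rule chain_rel_prodI[where f = "\<lambda>p. f (fst p) * real (prod_list (snd p)) ^ \<theta>"
            and h = "\<lambda>r. h (fst r) * real (prod_list (snd r)) ^ \<theta>" and s = s])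
        show "Rc d p r \<longleftrightarrow> (f (fst p) * real (prod_list (snd p)) ^ \<theta> * (h (fst r) * real (prod_list (snd r)) ^ \<theta>) \<le> 1) = s"
          for p r by (simp add: Rc_def holds_def d' power_mult_distrib mult_ac)
        show "0 < f (fst p) * real (prod_list (snd p)) ^ \<theta>" if "p \<in> A'" for p
        proof -
          have "0 < f (fst p)" using cs[OF d] that by (auto simp: pos_cond_def d' A'_def)
          moreover have "1 \<le> prod_list (snd p)" using that prime_lists_ge_1 by (auto simp: A'_def PL_def)
          ultimately show ?thesis by simp
        qed
      qed
    qed
    ultimately show ?thesis using that by auto
  qed
  define \<alpha>' where "\<alpha>' = (\<lambda>(a, ds :: nat list). \<alpha> a * c ^ length ds)"
  define \<beta>' where "\<beta>' = (\<lambda>(b, es :: nat list). \<beta> b * c ^ length es)"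
  define T where "T = {(p, r) \<in> A' \<times> B'. real (v' p * w' r) \<le> x \<and> (\<forall>R\<in>set ?Rs. R p r)}"
  have "norm (\<Sum>(p, r)\<in>T. \<alpha>' p * \<beta>' r * e (v' p * w' r)) \<le>
      (F1 * 1 * G) * (F2 * 1 * G) * (5 * real G) ^ (length ?Rs + 2) * Bnd V"
    unfolding T_def
  proof (rule type_II[OF v' w'])
    show "F2 * 1 * G \<le> 2 ^ (3 * G)" using F2 by simp
    show "U < v' p \<and> v' p \<le> U * z" if p: "p \<in> A'" for p
    proof -
      obtain a ds where p': "p = (a, ds)" by (cases p)
      have ds: "ds \<noteq> []" "\<forall>i\<in>set ds. real i \<le> z" "real (v a * prod_list (butlast ds)) \<le> U" "U < real (v a * prod_list ds)"
        using p by (auto simp: A'_def PL_def prime_lists_def p')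
      have "prod_list ds = prod_list (butlast ds) * last ds"
        using append_butlast_last_id[OF ds(1)] by (metis mult.right_neutral prod_list.Cons prod_list.Nil prod_list.append)
      then have "real (v a * prod_list ds) = real (v a * prod_list (butlast ds)) * real (last ds)" by simp
      also have "\<dots> \<le> U * z" using ds last_in_set[OF ds(1)] V(1) by (intro mult_mono) auto
      finally show ?thesis using ds(4) by (simp add: p' v'_def)
    qed
    show "1 \<le> w' r" if "r \<in> B'" for r
      using that B[of "fst r"] prime_lists_ge_1[of "snd r" t z x] by (cases r) (auto simp: B'_def w'_def PL_def)
    show "norm (\<alpha>' p) \<le> 1" if "p \<in> A'" for p
      using that \<alpha> c by (auto simp: A'_def \<alpha>'_def norm_mult norm_power)
    show "norm (\<beta>' r) \<le> 1" if "r \<in> B'" for r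
      using that \<beta> c by (auto simp: B'_def \<beta>'_def norm_mult norm_power)
  qed (use V chain in auto)
  also have "\<dots> \<le> F1 * F2 * (5 * real G) ^ (length cs + 5) * Bnd V"
  proof -
    have "real G * real G \<le> (5 * real G) ^ 2" by (simp add: power2_eq_square)
    then have "F1 * F2 * (5 * real G) ^ (length cs + 3) * Bnd V * (real G * real G) \<le>
        F1 * F2 * (5 * real G) ^ (length cs + 3) * Bnd V * (5 * real G) ^ 2"
      using F Bnd_ge(4)[OF V0] by (intro mult_left_mono mult_nonneg_nonneg) auto
    then show ?thesis by (simp add: power_add mult_ac eval_nat_numeral)
  qed
  also have "(\<Sum>(p, r)\<in>T. \<alpha>' p * \<beta>' r * e (v' p * w' r)) = sum ?g ?S"
  proof -
    \<comment> \<open>Concatenation undoes the cut; it is injective because the cut is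
      unique.\<close>
    define i :: "('a \<times> nat list) \<times> ('b \<times> nat list) \<Rightarrow> 'a \<times> nat list \<times> 'b"
      where "i = (\<lambda>((a, ds), (b, es)). (a, ds @ es, b))"
    have inj: "inj_on i T"
    proof (rule inj_onI)
      fix s1 s2 assume s: "s1 \<in> T" "s2 \<in> T" "i s1 = i s2"
      obtain a1 d1 b1 e1 where s1: "s1 = ((a1, d1), (b1, e1))" by (metis prod.exhaust)
      obtain a2 d2 b2 e2 where s2: "s2 = ((a2, d2), (b2, e2))" by (metis prod.exhaust)
      have ab: "a1 = a2" "b1 = b2" "d1 @ e1 = d2 @ e2" using s(3) by (auto simp: s1 s2 i_def)
      have t1: "U < real (v a1 * prod_list d1)" "real (v a1 * prod_list (butlast d1)) \<le> U" "\<forall>p\<in>set (d1 @ e1). prime p"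
        using s(1) by (auto simp: s1 T_def A'_def B'_def PL_def prime_lists_def)
      have t2: "U < real (v a1 * prod_list d2)" "real (v a1 * prod_list (butlast d2)) \<le> U"
        using s(2) ab(1) by (auto simp: s2 T_def A'_def)
      show "s1 = s2" using cut_unique[OF ab(3) t1(1,2) t2 t1(3)] ab by (simp add: s1 s2)
    qed
    have "i ` T = ?S"
    proof (intro equalityI subsetI)
      fix s assume "s \<in> i ` T"
      then obtain a ds b es where s: "s = (a, ds @ es, b)" and T: "((a, ds), (b, es)) \<in> T"
        by (auto simp: i_def)
      have p: "a \<in> A" "b \<in> B" "ds \<in> PL" "es \<in> PL" "U < real (v a * prod_list ds)" "R1 (a, ds) (b, es)"
        "\<forall>d\<in>set cs. Rc d (a, ds) (b, es)" and le: "real (v a * prod_list ds * (w b * prod_list es)) \<le> x"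
        using T by (auto simp: T_def A'_def B'_def v'_def w'_def)
      have e1: "1 \<le> prod_list es" "1 \<le> prod_list ds" using p prime_lists_ge_1 by (auto simp: PL_def)
      have va: "1 \<le> v a" "1 \<le> w b" using A B p by auto
      have "prod_list ds * prod_list es \<le> (v a * w b) * (prod_list ds * prod_list es)" using va by simp
      then have "real (prod_list ds * prod_list es) \<le> real ((v a * w b) * (prod_list ds * prod_list es))"
        by (rule of_nat_mono)
      also have "\<dots> \<le> x" using le by (simp add: mult_ac)
      finally have "ds @ es \<in> PL"
        using p unfolding PL_def prime_lists_append by (auto simp: prime_lists_def R1_def)
      moreover have "v a * prod_list ds \<le> v a * prod_list (ds @ es)" using e1 by simp
      then have "U < real (v a * prod_list (ds @ es))" using p(5) by (meson of_nat_le_iff less_le_trans)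
      moreover have "real (v a * prod_list (ds @ es) * w b) \<le> x" using le by (simp add: mult_ac)
      moreover have "\<forall>d\<in>set cs. holds d a b (prod_list (ds @ es))" using p(7) by (simp add: Rc_def)
      ultimately show "s \<in> ?S" using p s by (simp add: PL_def)
    next
      fix s assume "s \<in> ?S"
      then obtain a ps b where s: "s = (a, ps, b)" and p: "a \<in> A" "ps \<in> PL" "b \<in> B"
        "real (v a * prod_list ps * w b) \<le> x" "U < real (v a * prod_list ps)"
        "\<forall>d\<in>set cs. holds d a b (prod_list ps)" unfolding PL_def by auto
      have va: "1 \<le> v a" "1 \<le> w b" "real (v a) \<le> U" "1 \<le> prod_list ps"
        using A B p prime_lists_ge_1 by (auto simp: PL_def)
      obtain ds es where c: "ps = ds @ es" "ds \<noteq> []" "U < real (v a * prod_list ds)"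
        "real (v a * prod_list (butlast ds)) \<le> U" using exists_cut[OF p(5) va(3)] by blast
      have le: "real d \<le> x" if "d dvd v a * prod_list ps * w b" for d
      proof -
        have "d \<le> v a * prod_list ps * w b" using that va by (intro dvd_imp_le) auto
        then show ?thesis using p(4) by (meson of_nat_le_iff order_trans)
      qed
      have l: "real (v a * prod_list ds) \<le> x" "real (w b * prod_list es) \<le> x" "real (prod_list ds) \<le> x" "real (prod_list es) \<le> x"
        by (intro le; simp add: c mult_dvd_mono)+
      have "ds \<in> PL" "es \<in> PL" "R1 (a, ds) (b, es)"
        using p(2) l unfolding PL_def c prime_lists_append by (auto simp: prime_lists_def R1_def)
      then have "((a, ds), (b, es)) \<in> T"
        using p c l by (auto simp: T_def A'_def B'_def v'_def w'_def Rc_def mult_ac)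
      then show "s \<in> i ` T" by (rule rev_image_eqI) (simp add: s c i_def)
    qed
    then have "sum ?g ?S = sum (?g \<circ> i) T" using sum.reindex[OF inj, of ?g] by simp
    also have "\<dots> = (\<Sum>(p, r)\<in>T. \<alpha>' p * \<beta>' r * e (v' p * w' r))"
      by (rule sum.cong[OF refl]) (auto simp: i_def \<alpha>'_def \<beta>'_def v'_def w'_def power_add mult_ac)
    finally show ?thesis by simp
  qed
  finally show ?thesis .
qed

end

section \<open>Sums over sieved numbers\<close>

text \<open>By monotonicity in the last argument the solutions form an interval, as type I sums
  require; the factor \<open>m\<close> is the part of \<open>k\<close> that is held fixed
  there.\<close>

lemma holds_convex:
  assumes "pos_cond A B d" "a \<in> A" "b \<in> B" "holds d a b (m * i)" "holds d a b (m * k)" "i \<le> j" "j \<le> (k::nat)"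
  shows "holds d a b (m * j)"
proof -
  obtain f h \<theta> s where d: "d = (f, h, \<theta>, s)" by (cases d) auto
  have "0 < f a" "0 \<le> h b" using assms(1-3) by (auto simp: pos_cond_def d)
  then have n: "0 \<le> f a * h b" by simp
  have mono: "f a * h b * real (m * l) ^ \<theta> \<le> f a * h b * real (m * l') ^ \<theta>" if "l \<le> l'" for l l'
    using n that by (intro mult_left_mono power_mono of_nat_mono mult_le_mono2) auto
  show ?thesis using assms(4,5) mono[OF assms(6)] mono[OF assms(7)] by (cases s) (auto simp: holds_def d)
qed

lemma real_le_of_dvd:
  assumes "d dvd n" "0 < n" "real n \<le> X"
  shows "real d \<le> X"
  using dvd_imp_le[OF assms(1,2)] assms(3) by (meson of_nat_le_iff order_trans)

locale fifth_root_setting = exp_sum_setting +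
  fixes z :: real
  assumes z_pow: "z ^ 5 = x" and z_ge_1: "1 \<le> z"
begin

text \<open>For \<open>V = z ^ 3\<close> the error \<open>sqrt (x * V)\<close> is exactly
  \<open>z ^ 4\<close>, so the admissible length of type I sums coincides with the target
  x^(4/5).\<close>

lemma z_powers:
  "0 < z" "x / z ^ 2 = z ^ 3" "z ^ 2 * z = z ^ 3" "z ^ 4 \<le> x" "z ^ 4 \<le> sqrt (x * z ^ 3)" "0 \<le> z ^ 3" "0 < z ^ 2"
proof -
  show z: "0 < z" using z_ge_1 by simp
  then show "x / z ^ 2 = z ^ 3" using z_pow[symmetric] by (simp add: field_simps eval_nat_numeral)
  show "z ^ 2 * z = z ^ 3" by (simp add: eval_nat_numeral)
  show "z ^ 4 \<le> x" using z_ge_1 z_pow power_increasing[of 4 5 z] by simp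
  have "(z ^ 4)\<^sup>2 = x * z ^ 3" using z_pow[symmetric] by (simp add: eval_nat_numeral)
  then show "z ^ 4 \<le> sqrt (x * z ^ 3)" by (simp add: real_le_rsqrt)
  show "0 \<le> z ^ 3" "0 < z ^ 2" using z by auto
qed

text \<open>With \<open>v\<close> already in type II position the sieve need not be opened:
  \<open>k\<close> joins \<open>b\<close> in the right variable, and roughness restricts that
  variable alone.\<close>

lemma rough_sum_type_II:
  fixes v :: "'a \<Rightarrow> nat" and w :: "'b \<Rightarrow> nat" and F1 F2 :: real
  assumes v: "fibres_le A v F1" and w: "fibres_le B w F2" and F2: "F2 * G \<le> 2 ^ (3 * G)"
    and A: "\<And>a. a \<in> A \<Longrightarrow> z ^ 2 < v a \<and> v a \<le> z ^ 3" and B: "\<And>b. b \<in> B \<Longrightarrow> 1 \<le> w b"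
    and \<alpha>: "\<And>a. a \<in> A \<Longrightarrow> norm (\<alpha> a) \<le> 1" and \<beta>: "\<And>b. b \<in> B \<Longrightarrow> norm (\<beta> b) \<le> 1"
    and cs: "\<And>d. d \<in> set cs \<Longrightarrow> pos_cond A B d"
  shows "norm (\<Sum>(a, b, k)\<in>{(a, b, k). a \<in> A \<and> b \<in> B \<and> 1 \<le> k \<and> rough z k \<and> real (v a * w b * k) \<le> x \<and>
      (\<forall>d\<in>set cs. holds d a b k)}. \<alpha> a * \<beta> b * e (v a * w b * k)) \<le>
      F1 * F2 * (5 * real G) ^ (length cs + 3) * Bnd (z ^ 3)" (is "norm (sum ?g ?S) \<le> _")
proof -
  define B1 where "B1 = {(b, k). b \<in> B \<and> 1 \<le> k \<and> rough z k \<and> real (w b * k) \<le> x}"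
  define w1 where "w1 = (\<lambda>(b, k). w b * k)"
  define \<beta>1 where "\<beta>1 = (\<lambda>(b, k :: nat). \<beta> b)"
  define Rc :: "('a, 'b) cond \<Rightarrow> 'a \<Rightarrow> 'b \<times> nat \<Rightarrow> bool" where "Rc d = (\<lambda>a r. holds d a (fst r) (snd r))" for d
  let ?Rs = "map Rc cs"
  have F: "1 \<le> F1" "1 \<le> F2" using v w unfolding fibres_le_def by auto
  have fK: "fibres_le {k. real k \<le> x} (\<lambda>k. k) 1" by (rule fibres_le_inj[OF nat_le_x]) auto
  have w1: "fibres_le B1 w1 (F2 * 1 * G)" unfolding w1_def
  proof (rule fibres_le_prod[OF w fK])
    show "B1 \<subseteq> B \<times> {k. real k \<le> x}"
    proof (clarsimp simp: B1_def)
      fix b k assume b: "b \<in> B" "Suc 0 \<le> k" "real (w b) * real k \<le> x"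
      show "real k \<le> x" by (rule real_le_of_dvd[of k "w b * k"]) (use b B[OF b(1)] in auto)
    qed
    show "1 \<le> w b * k \<and> real (w b * k) \<le> x" if "(b, k) \<in> B1" for b k
      using that B[of b] by (auto simp: B1_def)
  qed
  have chain: "chain_rel A B1 R" if "R \<in> set ?Rs" for R
  proof -
    obtain d where d: "d \<in> set cs" "R = Rc d" using \<open>R \<in> set ?Rs\<close> by auto
    obtain f h \<theta> s where d': "d = (f, h, \<theta>, s)" by (cases d) auto
    show ?thesis
      by (rule chain_rel_prodI[where f = f and h = "\<lambda>r. h (fst r) * real (snd r) ^ \<theta>" and s = s])
         (use cs[OF d(1)] in \<open>auto simp: d(2) Rc_def holds_def d' pos_cond_def mult_ac\<close>)
  qed
  let ?T = "{(a, r) \<in> A \<times> B1. real (v a * w1 r) \<le> x \<and> (\<forall>R\<in>set ?Rs. R a r)}"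
  have "norm (\<Sum>(a, r)\<in>?T. \<alpha> a * \<beta>1 r * e (v a * w1 r)) \<le> F1 * (F2 * 1 * G) * (5 * real G) ^ (length ?Rs + 2) * Bnd (z ^ 3)"
    by (rule type_II[OF v w1 _ A _ _ _ _ \<alpha>])
       (use F2 z_powers B \<beta> chain in \<open>auto simp: B1_def w1_def \<beta>1_def\<close>)
  also have "?T = ?S"
  proof (intro equalityI subsetI)
    fix s assume "s \<in> ?S"
    then obtain a b k where s: "s = (a, b, k)" and p: "a \<in> A" "b \<in> B" "1 \<le> k" "rough z k" "real (v a * w b * k) \<le> x"
      "\<forall>d\<in>set cs. holds d a b k" by auto
    have "real (v a) > 0" using A[OF p(1)] z_powers(7) by linarith
    then have "real (w b * k) \<le> x"
      by (intro real_le_of_dvd[of "w b * k" "v a * w b * k"]) (use p B[OF p(2)] in auto)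
    then show "s \<in> ?T" using p by (auto simp: s B1_def w1_def Rc_def mult.assoc)
  qed (auto simp: B1_def w1_def Rc_def mult.assoc)
  also have "(\<Sum>(a, r)\<in>?S. \<alpha> a * \<beta>1 r * e (v a * w1 r)) = sum ?g ?S"
    by (rule sum.cong) (auto simp: \<beta>1_def w1_def mult.assoc)
  also have "F1 * (F2 * 1 * G) * (5 * real G) ^ (length ?Rs + 2) * Bnd (z ^ 3) =
      F1 * F2 * (5 * real G) ^ (length cs + 2) * Bnd (z ^ 3) * G" by simp
  also have "\<dots> \<le> F1 * F2 * (5 * real G) ^ (length cs + 2) * Bnd (z ^ 3) * (5 * real G)"
    using F Bnd_ge(4)[OF z_powers(6)] by (intro mult_left_mono) auto
  also have "\<dots> = F1 * F2 * (5 * real G) ^ (length cs + 3) * Bnd (z ^ 3)" by (simp add: eval_nat_numeral)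
  finally show ?thesis .
qed

text \<open>Legendre's identity is inserted and \<open>k\<close> becomes
  \<open>prod_list ps * l\<close>. The free cofactor \<open>l\<close> is grouped with
  \<open>w b\<close>, leaving \<open>v a * prod_list ps\<close> ready for a cut.\<close>

lemma legendre_sum_expand:
  fixes v :: "'a \<Rightarrow> nat" and w :: "'b \<Rightarrow> nat"
  assumes fin: "finite A" "finite B" and A: "\<And>a. a \<in> A \<Longrightarrow> 1 \<le> v a" and B: "\<And>b. b \<in> B \<Longrightarrow> 1 \<le> w b"
  shows "(\<Sum>(a, b, k)\<in>{(a, b, k). a \<in> A \<and> b \<in> B \<and> 1 \<le> k \<and> rough z k \<and> real (v a * w b * k) \<le> x \<and> Q a b k}.
      \<alpha> a * \<beta> b * e (v a * w b * k)) =
    (\<Sum>(a, ps, b, l)\<in>{(a, ps, b, l). a \<in> A \<and> ps \<in> prime_lists 1 z x \<and> b \<in> B \<and> 1 \<le> l \<and>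
        real (v a * prod_list ps * (w b * l)) \<le> x \<and> Q a b (prod_list ps * l)}.
      \<alpha> a * (- 1) ^ length ps * \<beta> b * e (v a * prod_list ps * (w b * l)))" (is "sum ?g ?S = sum ?h ?T")
proof -
  define S0 where "S0 = {(a, b, k). a \<in> A \<and> b \<in> B \<and> 1 \<le> k \<and> real (v a * w b * k) \<le> x \<and> Q a b k}"
  have kx: "real k \<le> x" if "(a, b, k) \<in> S0" for a b k
    by (rule real_le_of_dvd[of k "v a * w b * k"]) (use that A[of a] B[of b] in \<open>auto simp: S0_def\<close>)
  have finS0: "finite S0"
    by (rule finite_subset[of _ "A \<times> B \<times> {k. real k \<le> x}"])
       (use kx fin nat_le_x in \<open>auto simp: S0_def\<close>)
  let ?D = "\<lambda>s. {ps \<in> prime_lists 1 z x. prod_list ps dvd snd (snd s)}"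
  have "sum ?g ?S = (\<Sum>s\<in>S0. ?g s * (if rough z (snd (snd s)) then 1 else 0))"
    by (rule sum.mono_neutral_cong_left[OF finS0]) (auto simp: S0_def)
  also have "\<dots> = (\<Sum>s\<in>S0. \<Sum>ps\<in>?D s. ?g s * (- 1) ^ length ps)"
  proof (rule sum.cong[OF refl])
    fix s assume s: "s \<in> S0"
    obtain a b k where s': "s = (a, b, k)" by (cases s) auto
    have "(\<Sum>ps\<in>?D s. (- 1 :: complex) ^ length ps) = (if rough z (snd (snd s)) then 1 else 0)"
      using legendre_sieve[of k x z] kx[of a b k] s by (simp add: s' S0_def)
    then show "?g s * (if rough z (snd (snd s)) then 1 else 0) = (\<Sum>ps\<in>?D s. ?g s * (- 1) ^ length ps)"
      by (simp only: sum_distrib_left[symmetric])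
  qed
  also have "\<dots> = (\<Sum>(s, ps)\<in>Sigma S0 ?D. ?g s * (- 1) ^ length ps)"
    by (rule sum.Sigma[OF finS0]) (auto intro: finite_subset[OF _ finite_prime_lists])
  also have "\<dots> = sum ?h ?T"
  proof -
    define J where "J = (\<lambda>(a, ps, b, l). ((a :: 'a, b :: 'b, prod_list ps * l), ps :: nat list))"
    have inj: "inj_on J ?T"
      by (auto simp: J_def inj_on_def dest!: prime_lists_ge_1)
    have val: "v a * prod_list ps * (w b * l) = v a * w b * (prod_list ps * l)" for a ps b l by (simp add: mult_ac)
    have "J ` ?T = Sigma S0 ?D"
    proof (intro equalityI subsetI)
      fix s assume "s \<in> J ` ?T"
      then obtain a ps b l where s: "s = ((a, b, prod_list ps * l), ps)"
        and p: "a \<in> A" "ps \<in> prime_lists 1 z x" "b \<in> B" "1 \<le> l" "real (v a * prod_list ps * (w b * l)) \<le> x"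
        "Q a b (prod_list ps * l)" by (auto simp: J_def)
      have "1 \<le> prod_list ps * l" using prime_lists_ge_1[OF p(2)] p(4) by simp
      then have "(a, b, prod_list ps * l) \<in> S0" using p unfolding val S0_def by blast
      then show "s \<in> Sigma S0 ?D" using p(2) by (simp add: s)
    next
      fix s assume sp: "s \<in> Sigma S0 ?D"
      obtain a b k ps where s: "s = ((a, b, k), ps)" by (metis prod.exhaust)
      have p: "(a, b, k) \<in> S0" "ps \<in> prime_lists 1 z x" "prod_list ps dvd k" using sp by (auto simp: s)
      obtain l where l: "k = prod_list ps * l" using p(3) by (elim dvdE)
      have q: "a \<in> A" "b \<in> B" "1 \<le> k" "real (v a * w b * k) \<le> x" "Q a b k" using p(1) unfolding S0_def by auto
      have "1 \<le> l" using q(3) l by (cases l) auto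
      then have "(a, ps, b, l) \<in> ?T" using q p(2) unfolding l val by blast
      then show "s \<in> J ` ?T" by (rule rev_image_eqI) (simp add: s l J_def)
    qed
    then have "(\<Sum>(s, ps)\<in>Sigma S0 ?D. ?g s * (- 1) ^ length ps) = (\<Sum>t\<in>?T. case J t of (s, ps) \<Rightarrow> ?g s * (- 1) ^ length ps)"
      using sum.reindex[OF inj, of "\<lambda>(s, ps). ?g s * (- 1) ^ length ps"] by simp
    also have "\<dots> = sum ?h ?T"
      by (rule sum.cong[OF refl]) (auto simp: J_def val mult_ac)
    finally show ?thesis .
  qed
  finally show ?thesis .
qed

text \<open>Once the sieve is opened, the terms with
  \<open>v a * prod_list ps * w b \<le> z ^ 4\<close> are type I in \<open>l\<close>. In the others
  \<open>w b \<le> z ^ 2\<close> forces \<open>v a * prod_list ps > z ^ 2\<close>, and since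
  \<open>v a \<le> z ^ 2\<close> the list can be cut at \<open>U = z ^ 2\<close>.\<close>

lemma rough_sum_small:
  fixes v :: "'a \<Rightarrow> nat" and w :: "'b \<Rightarrow> nat" and F1 F2 :: real
  assumes v: "fibres_le A v F1" and w: "fibres_le B w F2" and F2: "F2 * G * G \<le> 2 ^ (3 * G)"
    and A: "\<And>a. a \<in> A \<Longrightarrow> 1 \<le> v a \<and> v a \<le> z ^ 2" and B: "\<And>b. b \<in> B \<Longrightarrow> 1 \<le> w b \<and> w b \<le> z ^ 2"
    and \<alpha>: "\<And>a. a \<in> A \<Longrightarrow> norm (\<alpha> a) \<le> 1" and \<beta>: "\<And>b. b \<in> B \<Longrightarrow> norm (\<beta> b) \<le> 1"
    and cs: "\<And>d. d \<in> set cs \<Longrightarrow> pos_cond A B d"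
  shows "norm (\<Sum>(a, b, k)\<in>{(a, b, k). a \<in> A \<and> b \<in> B \<and> 1 \<le> k \<and> rough z k \<and> real (v a * w b * k) \<le> x \<and>
      (\<forall>d\<in>set cs. holds d a b k)}. \<alpha> a * \<beta> b * e (v a * w b * k)) \<le>
      F1 * F2 * (2 * (5 * real G) ^ (length cs + 7)) * Bnd (z ^ 3)" (is "norm ?lhs \<le> _")
proof -
  have fin: "finite A" "finite B" and F: "1 \<le> F1" "1 \<le> F2" using v w unfolding fibres_le_def by auto
  have F12: "1 \<le> F1 * F2" using F mult_mono[of 1 F1 1 F2] by simp
  have Bn: "0 \<le> Bnd (z ^ 3)" using Bnd_ge(4)[OF z_powers(6)] .
  define PL where "PL = prime_lists 1 z x"
  have finPL: "finite PL" and fPL: "fibres_le PL prod_list 1"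
    unfolding PL_def by (auto intro: finite_prime_lists fibres_le_inj inj_on_prod_list_prime_lists)
  define T where "T = {(a, ps, b, l). a \<in> A \<and> ps \<in> PL \<and> b \<in> B \<and> 1 \<le> l \<and>
        real (v a * prod_list ps * (w b * l)) \<le> x \<and> (\<forall>d\<in>set cs. holds d a b (prod_list ps * l))}"
  define h where "h = (\<lambda>(a, ps, b, l). \<alpha> a * (- 1) ^ length ps * \<beta> b * e (v a * prod_list ps * (w b * l)))"
  define T1 where "T1 = {(a, ps, b, l) \<in> T. real (v a * prod_list ps * w b) \<le> z ^ 4}"
  define T2 where "T2 = {(a, ps, b, l) \<in> T. z ^ 4 < real (v a * prod_list ps * w b)}"
  have lhs: "?lhs = sum h T"
    unfolding h_def T_def PL_def by (rule legendre_sum_expand) (use fin A B in auto)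
  have ge1: "1 \<le> v a" "1 \<le> w b" "1 \<le> prod_list ps" if "a \<in> A" "b \<in> B" "ps \<in> PL" for a b ps
    using A B prime_lists_ge_1 that by (auto simp: PL_def)
  have le_x: "real d \<le> x" if "(a, ps, b, l) \<in> T" "d dvd v a * prod_list ps * (w b * l)" for a ps b l d
    by (rule real_le_of_dvd[OF that(2)]) (use that(1) ge1[of a b ps] in \<open>auto simp: T_def\<close>)
  have finT: "finite T"
  proof (rule finite_subset[of _ "A \<times> PL \<times> B \<times> {k. real k \<le> x}"])
    show "T \<subseteq> A \<times> PL \<times> B \<times> {k. real k \<le> x}"
    proof
      fix t assume t: "t \<in> T"
      obtain a ps b l where t': "t = (a, ps, b, l)" by (metis prod.exhaust)
      have "real l \<le> x" using t unfolding t' by (rule le_x) simp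
      then show "t \<in> A \<times> PL \<times> B \<times> {k. real k \<le> x}" using t by (auto simp: t' T_def)
    qed
  qed (use fin finPL nat_le_x in auto)
  have T: "T = T1 \<union> T2" "T1 \<inter> T2 = {}" unfolding T1_def T2_def by auto
  have "sum h T = sum h T1 + sum h T2" using finT T by (metis finite_Un sum.union_disjoint)
  then have split: "norm (sum h T) \<le> norm (sum h T1) + norm (sum h T2)" by (simp add: norm_triangle_ineq)
  have b1: "norm (sum h T1) \<le> F1 * F2 * (5 * real G) ^ (length cs + 7) * Bnd (z ^ 3)"
  proof -
    define C where "C = {((a, b), ps). a \<in> A \<and> b \<in> B \<and> ps \<in> PL \<and> real (v a * w b * prod_list ps) \<le> z ^ 4}"
    define u where "u = (\<lambda>((a, b), ps). (v a * w b) * prod_list ps)"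
    define I where "I = (\<lambda>((a, b), ps). {l. 1 \<le> l \<and> real (v a * prod_list ps * (w b * l)) \<le> x \<and>
        (\<forall>d\<in>set cs. holds d a b (prod_list ps * l))})"
    define AB where "AB = {(a, b). a \<in> A \<and> b \<in> B \<and> real (v a * w b) \<le> x}"
    have fAB: "fibres_le AB (\<lambda>(a, b). v a * w b) (F1 * F2 * G)"
      by (rule fibres_le_prod[OF v w]) (use A B in \<open>auto simp: AB_def\<close>)
    have fC: "fibres_le C (\<lambda>(p, ps). (case p of (a, b) \<Rightarrow> v a * w b) * prod_list ps) (F1 * F2 * G * 1 * G)"
    proof (rule fibres_le_prod[OF fAB fPL])
      have x: "real (v a * w b * prod_list ps) \<le> x" if "((a, b), ps) \<in> C" for a b ps
        using that z_powers(4) by (simp add: C_def)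
      show "C \<subseteq> AB \<times> PL"
      proof
        fix s assume s: "s \<in> C"
        obtain a b ps where s': "s = ((a, b), ps)" by (metis prod.exhaust)
        have "real (v a * w b) \<le> x"
          by (rule real_le_of_dvd[OF _ _ x[of a b ps]]) (use s ge1[of a b ps] in \<open>auto simp: s' C_def\<close>)
        then show "s \<in> AB \<times> PL" using s by (auto simp: s' C_def AB_def)
      qed
      show "1 \<le> (case p of (a, b) \<Rightarrow> v a * w b) * prod_list ps \<and> real ((case p of (a, b) \<Rightarrow> v a * w b) * prod_list ps) \<le> x"
        if "(p, ps) \<in> C" for p ps
        using that x[of "fst p" "snd p" ps] ge1[of "fst p" "snd p" ps] by (cases p) (auto simp: C_def)
    qed
    then have fCu: "fibres_le C u (F1 * F2 * G * 1 * G)" unfolding u_def by (simp add: case_prod_beta')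
    have "sum h T1 = (\<Sum>(c, l)\<in>Sigma C I. case c of ((a, b), ps) \<Rightarrow> \<alpha> a * (- 1) ^ length ps * \<beta> b * e (u c * l))"
      by (rule sum.reindex_bij_witness[of _ "\<lambda>(((a, b), ps), l). (a, ps, b, l)" "\<lambda>(a, ps, b, l). (((a, b), ps), l)"])
         (auto simp: T1_def T_def C_def I_def h_def u_def mult_ac)
    also have "\<dots> = (\<Sum>c\<in>C. \<Sum>l\<in>I c. case c of ((a, b), ps) \<Rightarrow> \<alpha> a * (- 1) ^ length ps * \<beta> b * e (u c * l))"
    proof (rule sum.Sigma[symmetric])
      show "finite C" using fC unfolding fibres_le_def by simp
      show "\<forall>c\<in>C. finite (I c)"
      proof
        fix c assume c: "c \<in> C"
        obtain a b ps where c': "c = ((a, b), ps)" by (metis prod.exhaust)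
        have "I c \<subseteq> {k. real k \<le> x}"
        proof
          fix l assume l: "l \<in> I c"
          have "(a, ps, b, l) \<in> T" using c l by (auto simp: c' T_def C_def I_def)
          then have "real l \<le> x" by (rule le_x) simp
          then show "l \<in> {k. real k \<le> x}" by simp
        qed
        then show "finite (I c)" using nat_le_x finite_subset by blast
      qed
    qed
    also have "norm \<dots> \<le> (\<Sum>c\<in>C. norm (\<Sum>l\<in>I c. e (u c * l)))"
    proof (rule sum_norm_le)
      fix c assume c: "c \<in> C"
      obtain a b ps where c': "c = ((a, b), ps)" by (metis prod.exhaust)
      have "norm (\<alpha> a * (- 1) ^ length ps * \<beta> b) \<le> 1"
        using c \<alpha>[of a] \<beta>[of b] by (auto simp: c' C_def norm_mult norm_power intro: mult_le_one)
      then have "norm ((\<alpha> a * (- 1) ^ length ps * \<beta> b) * (\<Sum>l\<in>I c. e (u c * l))) \<le> 1 * norm (\<Sum>l\<in>I c. e (u c * l))"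
        unfolding norm_mult[of "\<alpha> a * (- 1) ^ length ps * \<beta> b"] by (rule mult_right_mono) simp
      then show "norm (\<Sum>l\<in>I c. case c of ((a, b), ps) \<Rightarrow> \<alpha> a * (- 1) ^ length ps * \<beta> b * e (u c * l))
          \<le> norm (\<Sum>l\<in>I c. e (u c * l))"
        by (simp add: c' sum_distrib_left mult.assoc)
    qed
    also have "\<dots> \<le> (F1 * F2 * G * 1 * G) * (5 * real G) * Bnd (z ^ 3)"
    proof (rule type_I[OF fCu _ z_powers(4-6)])
      show "1 \<le> u c \<and> real (u c) \<le> z ^ 4" if "c \<in> C" for c
        using that ge1 by (auto simp: C_def u_def)
      show "I c \<subseteq> {k. 1 \<le> k \<and> real (u c * k) \<le> x}" if "c \<in> C" for c
        by (auto simp: I_def u_def mult_ac split: prod.splits)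
      show "j \<in> I c" if c: "c \<in> C" and l: "i \<in> I c" "k \<in> I c" "i \<le> j" "j \<le> k" for c i j k
      proof -
        obtain a b ps where c': "c = ((a, b), ps)" by (metis prod.exhaust)
        have ab: "a \<in> A" "b \<in> B" using c by (auto simp: c' C_def)
        have "holds d a b (prod_list ps * j)" if d: "d \<in> set cs" for d
          by (rule holds_convex[OF cs[OF d] ab _ _ l(3,4)]) (use l d in \<open>auto simp: c' I_def\<close>)
        moreover have "v a * prod_list ps * (w b * j) \<le> v a * prod_list ps * (w b * k)" using l(4) by simp
        then have "real (v a * prod_list ps * (w b * j)) \<le> x"
          using l(2) by (simp only: c' I_def case_prod_conv mem_Collect_eq) (meson of_nat_le_iff order_trans)
        moreover have "1 \<le> j" using l by (auto simp: c' I_def)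
        ultimately show ?thesis by (simp add: c' I_def)
      qed
    qed
    also have "\<dots> = F1 * F2 * (5 * real G ^ 3) * Bnd (z ^ 3)" by (simp add: eval_nat_numeral mult_ac)
    also have "\<dots> \<le> F1 * F2 * (5 * real G) ^ (length cs + 7) * Bnd (z ^ 3)"
    proof (intro mult_right_mono mult_left_mono)
      have "5 * real G ^ 3 \<le> (5 * real G) ^ 3" by (simp add: power_mult_distrib)
      also have "\<dots> \<le> (5 * real G) ^ (length cs + 7)" using G_ge by (intro power_increasing) auto
      finally show "5 * real G ^ 3 \<le> (5 * real G) ^ (length cs + 7)" .
    qed (use F12 Bn in auto)
    finally show ?thesis .
  qed
  have b2: "norm (sum h T2) \<le> F1 * F2 * (5 * real G) ^ (length cs + 7) * Bnd (z ^ 3)"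
  proof -
    define B1 where "B1 = {(b, k). b \<in> B \<and> 1 \<le> k \<and> real (w b * k) \<le> x}"
    define w1 where "w1 = (\<lambda>(b, k). w b * k)"
    define \<beta>1 where "\<beta>1 = (\<lambda>(b, k :: nat). \<beta> b)"
    \<comment> \<open>The cofactor \<open>l\<close> moves into the right variable;
      \<open>lift\<close> transfers its power to \<open>h\<close>, and \<open>c0\<close> records the
      split at \<open>z ^ 4\<close> as one more condition.\<close>
    define lift :: "('a, 'b) cond \<Rightarrow> ('a, 'b \<times> nat) cond"
      where "lift = (\<lambda>(f, h, \<theta>, s). (f, \<lambda>r. h (fst r) * real (snd r) ^ \<theta>, \<theta>, s))"
    define c0 :: "('a, 'b \<times> nat) cond"
      where "c0 = (\<lambda>a. real (v a) / z ^ 4, \<lambda>r. real (w (fst r)), 1, False)"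
    let ?cs = "c0 # map lift cs"
    have fK: "fibres_le {k. real k \<le> x} (\<lambda>k. k) 1" by (rule fibres_le_inj[OF nat_le_x]) auto
    have w1: "fibres_le B1 w1 (F2 * 1 * G)" unfolding w1_def
    proof (rule fibres_le_prod[OF w fK])
      show "B1 \<subseteq> B \<times> {k. real k \<le> x}"
      proof (clarsimp simp: B1_def)
        fix b k assume b: "b \<in> B" "Suc 0 \<le> k" "real (w b) * real k \<le> x"
        show "real k \<le> x" by (rule real_le_of_dvd[of k "w b * k"]) (use b B[OF b(1)] in auto)
      qed
      show "1 \<le> w b * k \<and> real (w b * k) \<le> x" if "(b, k) \<in> B1" for b k
        using that B[of b] by (auto simp: B1_def)
    qed
    have lift: "holds (lift d) a r k \<longleftrightarrow> holds d a (fst r) (k * snd r)" for d a r k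
      by (cases d) (simp add: lift_def holds_def power_mult_distrib mult_ac)
    have c0: "holds c0 a r k \<longleftrightarrow> z ^ 4 < real (v a * k * w (fst r))" for a r k
      using z_powers(1) by (simp add: c0_def holds_def field_simps not_le)
    have pc: "pos_cond A B1 d" if "d \<in> set ?cs" for d
    proof -
      have "pos_cond A B1 c0" using z_powers(1) A by (force simp: pos_cond_def c0_def)
      moreover have "pos_cond A B1 (lift d)" if "d \<in> set cs" for d
        using cs[OF that] by (cases d) (auto simp: pos_cond_def lift_def B1_def)
      ultimately show ?thesis using that by auto
    qed
    let ?S = "{(a, ps, r). a \<in> A \<and> ps \<in> prime_lists 1 z x \<and> r \<in> B1 \<and>
       real (v a * prod_list ps * w1 r) \<le> x \<and> z ^ 2 < real (v a * prod_list ps) \<and>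
       (\<forall>d\<in>set ?cs. holds d a r (prod_list ps))}"
    have "norm (\<Sum>(a, ps, r)\<in>?S. \<alpha> a * (- 1) ^ length ps * \<beta>1 r * e (v a * prod_list ps * w1 r)) \<le>
      F1 * (F2 * 1 * G) * (5 * real G) ^ (length ?cs + 5) * Bnd (z ^ 3)"
      by (rule smooth_type_II[OF v w1 _ A _ _ _ _ \<alpha> _ _ pc])
         (use F2 z_powers B \<beta> in \<open>auto simp: B1_def w1_def \<beta>1_def\<close>)
    also have "?S = T2"
    proof (intro equalityI subsetI)
      fix s assume "s \<in> ?S"
      then show "s \<in> T2" by (auto simp: T2_def T_def PL_def B1_def w1_def c0 lift)
    next
      fix s assume s: "s \<in> T2"
      obtain a ps b l where s': "s = (a, ps, b, l)" by (metis prod.exhaust)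
      have p: "a \<in> A" "ps \<in> PL" "b \<in> B" "1 \<le> l" "real (v a * prod_list ps * (w b * l)) \<le> x"
        "\<forall>d\<in>set cs. holds d a b (prod_list ps * l)" "z ^ 4 < real (v a * prod_list ps * w b)" "(a, ps, b, l) \<in> T"
        using s by (auto simp: s' T2_def T_def)
      have "real (w b * l) \<le> x" by (rule le_x[OF p(8)]) simp
      moreover have "z ^ 2 < real (v a * prod_list ps)"
      proof (rule ccontr)
        assume "\<not> z ^ 2 < real (v a * prod_list ps)"
        then have "real (v a * prod_list ps) * real (w b) \<le> z ^ 2 * z ^ 2"
          using B[OF p(3)] by (intro mult_mono) auto
        then show False using p(7) by (simp add: power_add[symmetric])
      qed
      ultimately show "s \<in> ?S" using p by (simp add: s' PL_def B1_def w1_def c0 lift)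
    qed
    also have "(\<Sum>(a, ps, r)\<in>T2. \<alpha> a * (- 1) ^ length ps * \<beta>1 r * e (v a * prod_list ps * w1 r)) = sum h T2"
      by (rule sum.cong) (auto simp: h_def \<beta>1_def w1_def)
    also have "F1 * (F2 * 1 * G) * (5 * real G) ^ (length ?cs + 5) * Bnd (z ^ 3) =
      F1 * F2 * (5 * real G) ^ (length cs + 6) * Bnd (z ^ 3) * G" by (simp add: add.commute)
    also have "\<dots> \<le> F1 * F2 * (5 * real G) ^ (length cs + 6) * Bnd (z ^ 3) * (5 * real G)"
      using F Bn by (intro mult_left_mono) auto
    also have "\<dots> = F1 * F2 * (5 * real G) ^ (length cs + 7) * Bnd (z ^ 3)" by (simp add: eval_nat_numeral)
    finally show ?thesis .
  qed
  show ?thesis unfolding lhs using split b1 b2 by (simp add: algebra_simps)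
qed

text \<open>Values of \<open>v\<close> above \<open>z ^ 2\<close> are in type II position as they
  stand; only the smaller ones need the sieve to be opened.\<close>

lemma rough_sum:
  fixes v :: "'a \<Rightarrow> nat" and w :: "'b \<Rightarrow> nat" and F1 F2 :: real
  assumes v: "fibres_le A v F1" and w: "fibres_le B w F2" and F2: "F2 * G * G \<le> 2 ^ (3 * G)"
    and A: "\<And>a. a \<in> A \<Longrightarrow> 1 \<le> v a \<and> v a \<le> z ^ 3" and B: "\<And>b. b \<in> B \<Longrightarrow> 1 \<le> w b \<and> w b \<le> z ^ 2"
    and cs: "\<And>d. d \<in> set cs \<Longrightarrow> pos_cond A B d"
  shows "norm (\<Sum>(a, b, k)\<in>{(a, b, k). a \<in> A \<and> b \<in> B \<and> 1 \<le> k \<and> rough z k \<and> real (v a * w b * k) \<le> x \<and>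
      (\<forall>d\<in>set cs. holds d a b k)}. e (v a * w b * k)) \<le>
      F1 * F2 * (5 * real G) ^ (length cs + 8) * Bnd (z ^ 3)"
proof -
  let ?S = "\<lambda>A. {(a, b, k). a \<in> A \<and> b \<in> B \<and> 1 \<le> k \<and> rough z k \<and> real (v a * w b * k) \<le> x \<and>
      (\<forall>d\<in>set cs. holds d a b k)}"
  let ?g = "\<lambda>(a, b, k). e (v a * w b * k)"
  define A1 where "A1 = {a \<in> A. z ^ 2 < v a}"
  define A2 where "A2 = {a \<in> A. v a \<le> z ^ 2}"
  have fin: "finite A" "finite B" and F: "1 \<le> F1" "1 \<le> F2" using v w unfolding fibres_le_def by auto
  have Bn: "0 \<le> Bnd (z ^ 3)" using Bnd_ge(4)[OF z_powers(6)] .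
  have finS: "finite (?S A)"
  proof (rule finite_subset[of _ "A \<times> B \<times> {k. real k \<le> x}"])
    show "?S A \<subseteq> A \<times> B \<times> {k. real k \<le> x}"
    proof clarsimp
      fix a b k assume p: "a \<in> A" "b \<in> B" "Suc 0 \<le> k" "real (v a) * real (w b) * real k \<le> x"
      show "real k \<le> x" by (rule real_le_of_dvd[of k "v a * w b * k"]) (use p A[of a] B[of b] in auto)
    qed
  qed (use fin nat_le_x in auto)
  have S: "?S A = ?S A1 \<union> ?S A2" "?S A1 \<inter> ?S A2 = {}" unfolding A1_def A2_def by auto
  have "finite (?S A1)" by (rule finite_subset[OF _ finS]) (auto simp: A1_def)
  moreover have "finite (?S A2)" by (rule finite_subset[OF _ finS]) (auto simp: A2_def)
  ultimately have "sum ?g (?S A) = sum ?g (?S A1) + sum ?g (?S A2)"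
    unfolding S(1) using S(2) by (rule sum.union_disjoint)
  then have n: "norm (sum ?g (?S A)) \<le> norm (sum ?g (?S A1)) + norm (sum ?g (?S A2))"
    by (simp only: norm_triangle_ineq)
  have G1: "1 \<le> real G" using G_ge by simp
  have F2': "F2 * G \<le> 2 ^ (3 * G)"
  proof -
    have "F2 * G * 1 \<le> F2 * G * G" using F G1 by (intro mult_left_mono) auto
    then show ?thesis using F2 by simp
  qed
  have sub: "A1 \<subseteq> A" "A2 \<subseteq> A" by (auto simp: A1_def A2_def)
  have pc: "d \<in> set cs \<Longrightarrow> pos_cond A1 B d" "d \<in> set cs \<Longrightarrow> pos_cond A2 B d" for d
    using cs[of d] sub by (cases d; auto simp: pos_cond_def)+
  have 1: "norm (sum ?g (?S A1)) \<le> F1 * F2 * (5 * real G) ^ (length cs + 3) * Bnd (z ^ 3)"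
    using rough_sum_type_II[OF fibres_le_subset[OF v sub(1)] w F2' _ _ _ _ pc(1), of "\<lambda>_. 1" "\<lambda>_. 1"] A B
    by (simp add: A1_def)
  have 2: "norm (sum ?g (?S A2)) \<le> F1 * F2 * (2 * (5 * real G) ^ (length cs + 7)) * Bnd (z ^ 3)"
    using rough_sum_small[OF fibres_le_subset[OF v sub(2)] w F2 _ B _ _ pc(2), of "\<lambda>_. 1" "\<lambda>_. 1"] A
    by (simp add: A2_def)
  have "F1 * F2 * Bnd (z ^ 3) * ((5 * real G) ^ (length cs + 3) + 2 * (5 * real G) ^ (length cs + 7)) \<le>
      F1 * F2 * Bnd (z ^ 3) * (5 * real G) ^ (length cs + 8)"
  proof (rule mult_left_mono)
    have "(5 * real G) ^ (length cs + 3) \<le> (5 * real G) ^ (length cs + 7)"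
      using G1 by (intro power_increasing) auto
    then have "(5 * real G) ^ (length cs + 3) + 2 * (5 * real G) ^ (length cs + 7) \<le> 3 * (5 * real G) ^ (length cs + 7)"
      by linarith
    also have "\<dots> \<le> (5 * real G) * (5 * real G) ^ (length cs + 7)"
      using G1 by (intro mult_right_mono) auto
    also have "\<dots> = (5 * real G) ^ (length cs + 8)" by (simp add: eval_nat_numeral)
    finally show "(5 * real G) ^ (length cs + 3) + 2 * (5 * real G) ^ (length cs + 7) \<le> (5 * real G) ^ (length cs + 8)" .
  qed (use F Bn in auto)
  then show ?thesis using n 1 2 by (simp add: algebra_simps)
qed

end

section \<open>Splitting off extreme prime factors\<close>

definition y_smooth :: "real \<Rightarrow> nat \<Rightarrow> bool" where
  "y_smooth y n \<longleftrightarrow> (\<forall>p. prime p \<longrightarrow> p dvd n \<longrightarrow> real p \<le> y)"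

definition primes_ge :: "nat \<Rightarrow> nat \<Rightarrow> bool" where
  "primes_ge p k \<longleftrightarrow> (\<forall>r. prime r \<longrightarrow> r dvd k \<longrightarrow> p \<le> r)"

text \<open>A condition that persists when \<open>\<phi> a\<close> decreases is a threshold for
  \<open>\<phi> a\<close>: \<open>\<psi> b\<close> is one more than the largest admissible value, or
  \<open>0\<close> if there is none. This covers conditions on prime factors, which do not compare
  sizes of the variables.\<close>

lemma chain_rel_antimono:
  fixes \<phi> :: "'a \<Rightarrow> nat"
  assumes fin: "finite A" and R: "\<And>a b. a \<in> A \<Longrightarrow> b \<in> B \<Longrightarrow> R a b \<longleftrightarrow> S (\<phi> a) b"
    and S: "\<And>m n b. S n b \<Longrightarrow> m \<le> n \<Longrightarrow> S m b"
  shows "chain_rel A B R"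
proof -
  define \<psi> where "\<psi> b = Max (insert 0 ((\<lambda>a. \<phi> a + 1) ` {a \<in> A. R a b}))" for b
  have "R a b \<longleftrightarrow> \<phi> a < \<psi> b" if a: "a \<in> A" and b: "b \<in> B" for a b
  proof
    assume "R a b"
    then have "\<phi> a + 1 \<le> \<psi> b" unfolding \<psi>_def using fin a by (intro Max_ge) auto
    then show "\<phi> a < \<psi> b" by simp
  next
    assume l: "\<phi> a < \<psi> b"
    have "\<psi> b \<in> insert 0 ((\<lambda>a. \<phi> a + 1) ` {a \<in> A. R a b})" unfolding \<psi>_def using fin by (intro Max_in) auto
    then obtain a' where "a' \<in> A" "R a' b" "\<psi> b = \<phi> a' + 1" using l by auto
    then show "R a b" using l R a b S[of "\<phi> a'" b "\<phi> a"] by auto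
  qed
  then show ?thesis
    by (intro chain_rel_lessI[where \<psi> = "\<lambda>b. - real (\<psi> b)" and \<phi> = "\<lambda>a. - real (\<phi> a)"]) auto
qed

lemma chain_rel_flip:
  assumes "chain_rel A B R"
  shows "chain_rel B A (\<lambda>b a. R a b)"
proof -
  obtain \<phi> :: "'a \<Rightarrow> real" and \<psi> where
    "(\<forall>a\<in>A. \<forall>b\<in>B. R a b \<longleftrightarrow> \<psi> b < \<phi> a) \<or> (\<forall>a\<in>A. \<forall>b\<in>B. R a b \<longleftrightarrow> \<psi> b \<le> \<phi> a)"
    using assms unfolding chain_rel_def by blast
  then show ?thesis
  proof
    assume "\<forall>a\<in>A. \<forall>b\<in>B. R a b \<longleftrightarrow> \<psi> b < \<phi> a"
    then show ?thesis by (intro chain_rel_lessI[where \<psi> = "\<lambda>a. - \<phi> a" and \<phi> = "\<lambda>b. - \<psi> b"]) auto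
  next
    assume "\<forall>a\<in>A. \<forall>b\<in>B. R a b \<longleftrightarrow> \<psi> b \<le> \<phi> a"
    then show ?thesis by (intro chain_rel_leI[where \<psi> = "\<lambda>a. - \<phi> a" and \<phi> = "\<lambda>b. - \<psi> b"]) auto
  qed
qed

text \<open>Smoothness persists when its bound grows, so it is the negation that
  \<open>chain_rel_antimono\<close> handles.\<close>

lemma chain_rel_y_smooth:
  assumes "finite A" "\<And>a b. a \<in> A \<Longrightarrow> b \<in> B \<Longrightarrow> R a b \<longleftrightarrow> y_smooth (real (\<phi> a)) (m b)"
  shows "chain_rel A B R"
proof -
  have "chain_rel A B (\<lambda>a b. \<not> R a b)"
  proof (rule chain_rel_antimono[OF assms(1)])
    show "\<not> R a b \<longleftrightarrow> \<not> y_smooth (real (\<phi> a)) (m b)" if "a \<in> A" "b \<in> B" for a b using assms(2) that by simp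
    show "\<not> y_smooth (real i) (m b) \<Longrightarrow> j \<le> i \<Longrightarrow> \<not> y_smooth (real j) (m b)" for i j b
      unfolding y_smooth_def by (meson of_nat_le_iff order_trans)
  qed
  from chain_rel_not[OF this] show ?thesis by simp
qed

lemma chain_rel_primes_ge:
  assumes "finite A" "\<And>a b. a \<in> A \<Longrightarrow> b \<in> B \<Longrightarrow> R a b \<longleftrightarrow> primes_ge (\<phi> a) (k b)"
  shows "chain_rel A B R"
  by (rule chain_rel_antimono[where S = "\<lambda>n b. primes_ge n (k b)", OF assms])
     (auto simp: primes_ge_def intro: order_trans)

text \<open>The combinatorial form of Buchstab's identity. The least prime factor makes the
  decomposition unique, and the set \<open>D\<close> may couple the number to the index
  \<open>c\<close>.\<close>

lemma sum_split_least:
  fixes g :: "'c \<Rightarrow> nat \<Rightarrow> complex"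
  assumes gt: "\<And>c k. (c, k) \<in> D \<Longrightarrow> 1 < k"
  shows "(\<Sum>(c, k)\<in>D. g c k) = (\<Sum>(c, p, k)\<in>{(c, p, k). prime p \<and> primes_ge p k \<and> (c, p * k) \<in> D}. g c (p * k))"
proof -
  let ?T = "{(c, p, k). prime p \<and> primes_ge p k \<and> (c, p * k) \<in> D}"
  define J :: "'c \<times> nat \<times> nat \<Rightarrow> 'c \<times> nat" where "J = (\<lambda>(c, p, k). (c, p * k))"
  have "inj_on J ?T"
  proof (rule inj_onI)
    fix s t assume st: "s \<in> ?T" "t \<in> ?T" "J s = J t"
    obtain c p k where s: "s = (c, p, k)" by (metis prod.exhaust)
    obtain c' p' k' where t: "t = (c', p', k')" by (metis prod.exhaust)
    have e: "c = c'" "p * k = p' * k'" and p: "prime p" "prime p'" "primes_ge p k" "primes_ge p' k'"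
      using st by (auto simp: s t J_def)
    have "p' dvd p * k" "p dvd p' * k'" using e by (metis dvd_triv_left)+
    then have "p' dvd p \<or> p' dvd k" "p dvd p' \<or> p dvd k'" using p by (simp_all add: prime_dvd_mult_iff)
    then have "p \<le> p'" "p' \<le> p"
      using p unfolding primes_ge_def by (auto simp: primes_dvd_imp_eq dest: primes_dvd_imp_eq)
    then have "p = p'" by simp
    then show "s = t" using e p by (auto simp: s t)
  qed
  moreover have "J ` ?T = D"
  proof (intro equalityI subsetI)
    fix d assume d: "d \<in> D"
    obtain c n where d': "d = (c, n)" by (cases d)
    have n: "1 < n" using gt d d' by auto
    define p where "p = (LEAST p. prime p \<and> p dvd n)"
    have ex: "\<exists>p. prime p \<and> p dvd n" using prime_factor_nat[of n] n by auto
    have p: "prime p" "p dvd n" using LeastI_ex[OF ex] unfolding p_def by auto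
    have pl: "p \<le> r" if "prime r" "r dvd n" for r unfolding p_def by (rule Least_le) (use that in auto)
    obtain k where k: "n = p * k" using p(2) by (elim dvdE)
    have "primes_ge p k" unfolding primes_ge_def using pl k by auto
    then have "(c, p, k) \<in> ?T" using p d d' k by simp
    then show "d \<in> J ` ?T" by (rule rev_image_eqI) (simp add: J_def d' k)
  qed (auto simp: J_def)
  ultimately have "(\<Sum>(c, k)\<in>D. g c k) = (\<Sum>t\<in>?T. case J t of (c, k) \<Rightarrow> g c k)"
    using sum.reindex[of J ?T "\<lambda>(c, k). g c k"] by simp
  also have "\<dots> = (\<Sum>(c, p, k)\<in>?T. g c (p * k))"
    by (rule sum.cong) (auto simp: J_def)
  finally show ?thesis .
qed

lemma sum_split_greatest:
  fixes g :: "'c \<Rightarrow> nat \<Rightarrow> complex"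
  assumes gt: "\<And>c k. (c, k) \<in> D \<Longrightarrow> 1 < k"
  shows "(\<Sum>(c, k)\<in>D. g c k) = (\<Sum>(c, p, k)\<in>{(c, p, k). prime p \<and> y_smooth p k \<and> (c, p * k) \<in> D}. g c (p * k))"
proof -
  let ?T = "{(c, p, k). prime p \<and> y_smooth p k \<and> (c, p * k) \<in> D}"
  define J :: "'c \<times> nat \<times> nat \<Rightarrow> 'c \<times> nat" where "J = (\<lambda>(c, p, k). (c, p * k))"
  have "inj_on J ?T"
  proof (rule inj_onI)
    fix s t assume st: "s \<in> ?T" "t \<in> ?T" "J s = J t"
    obtain c p k where s: "s = (c, p, k)" by (metis prod.exhaust)
    obtain c' p' k' where t: "t = (c', p', k')" by (metis prod.exhaust)
    have e: "c = c'" "p * k = p' * k'" and p: "prime p" "prime p'" "y_smooth p k" "y_smooth p' k'"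
      using st by (auto simp: s t J_def)
    have "p' dvd p * k" "p dvd p' * k'" using e by (metis dvd_triv_left)+
    then have "p' dvd p \<or> p' dvd k" "p dvd p' \<or> p dvd k'" using p by (simp_all add: prime_dvd_mult_iff)
    then have "p' \<le> p" "p \<le> p'"
      using p unfolding y_smooth_def by (auto dest: primes_dvd_imp_eq)
    then have "p = p'" by simp
    then show "s = t" using e p by (auto simp: s t)
  qed
  moreover have "J ` ?T = D"
  proof (intro equalityI subsetI)
    fix d assume d: "d \<in> D"
    obtain c n where d': "d = (c, n)" by (cases d)
    have n: "1 < n" using gt d d' by auto
    let ?P = "{p. prime p \<and> p dvd n}"
    have fin: "finite ?P" by (rule finite_subset[of _ "{d. d dvd n}"]) (use n in auto)
    have ne: "?P \<noteq> {}" using prime_factor_nat[of n] n by auto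
    define p where "p = Max ?P"
    have p: "prime p" "p dvd n" using Max_in[OF fin ne] unfolding p_def by auto
    have pl: "r \<le> p" if "prime r" "r dvd n" for r unfolding p_def using fin that by (intro Max_ge) auto
    obtain k where k: "n = p * k" using p(2) by (elim dvdE)
    have "y_smooth p k" unfolding y_smooth_def using pl k by auto
    then have "(c, p, k) \<in> ?T" using p d d' k by simp
    then show "d \<in> J ` ?T" by (rule rev_image_eqI) (simp add: J_def d' k)
  qed (auto simp: J_def)
  ultimately have "(\<Sum>(c, k)\<in>D. g c k) = (\<Sum>t\<in>?T. case J t of (c, k) \<Rightarrow> g c k)"
    using sum.reindex[of J ?T "\<lambda>(c, k). g c k"] by simp
  also have "\<dots> = (\<Sum>(c, p, k)\<in>?T. g c (p * k))"
    by (rule sum.cong) (auto simp: J_def)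
  finally show ?thesis .
qed

text \<open>\<open>1 \<le> y\<close> takes care of \<open>n = 1\<close>, whose largest prime divisor
  is set to \<open>1\<close>.\<close>

lemma smooth_upto_eq:
  assumes "1 \<le> y"
  shows "smooth_upto X y = {n. 1 \<le> n \<and> real n \<le> X \<and> y_smooth y n}"
proof -
  have "real (largest_prime_divisor n) \<le> y \<longleftrightarrow> y_smooth y n" if n: "1 \<le> n" for n
  proof (cases "n = 1")
    case True
    then show ?thesis using assms by (auto simp: largest_prime_divisor_def y_smooth_def)
  next
    case False
    let ?P = "{p. prime p \<and> p dvd n}"
    have fin: "finite ?P" by (rule finite_subset[of _ "{d. d dvd n}"]) (use n in auto)
    have ne: "?P \<noteq> {}" using prime_factor_nat[of n] False by auto
    have "Max ?P \<in> ?P" using fin ne by (rule Max_in)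
    moreover have "r \<le> Max ?P" if "r \<in> ?P" for r using fin that by (rule Max_ge)
    ultimately show ?thesis using False unfolding largest_prime_divisor_def y_smooth_def
      by (auto intro: order_trans[of _ "real (Max ?P)"])
  qed
  then show ?thesis unfolding smooth_upto_def by auto
qed

text \<open>With \<open>t = 0\<close> repeated primes are allowed; together with
  \<open>inj_on_prod_list_prime_lists\<close> this parametrizes all smooth numbers, not just the
  squarefree ones.\<close>

lemma prod_list_image_prime_lists:
  "prod_list ` prime_lists 0 z X = {m. 1 \<le> m \<and> real m \<le> X \<and> y_smooth z m}"
proof (intro equalityI subsetI)
  fix m assume "m \<in> prod_list ` prime_lists 0 z X"
  then obtain ps where m: "m = prod_list ps" and ps: "ps \<in> prime_lists 0 z X" by auto
  have pr: "\<forall>p\<in>set ps. prime p \<and> real p \<le> z" "real (prod_list ps) \<le> X" using ps by (auto simp: prime_lists_def)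
  have "y_smooth z m" unfolding y_smooth_def
  proof (intro allI impI)
    fix p assume p: "prime p" "p dvd m"
    have "m \<noteq> 0" using prime_lists_ge_1[OF ps] m by simp
    then have "p \<in># prime_factorization m" using p by (simp add: in_prime_factors_iff)
    then show "real p \<le> z" using pr prime_factorization_prod_list[of ps] m by auto
  qed
  then show "m \<in> {m. 1 \<le> m \<and> real m \<le> X \<and> y_smooth z m}" using pr prime_lists_ge_1[OF ps] m by auto
next
  fix m assume "m \<in> {m. 1 \<le> m \<and> real m \<le> X \<and> y_smooth z m}"
  then have m: "1 \<le> m" "real m \<le> X" "y_smooth z m" by auto
  let ?ps = "sorted_list_of_multiset (prime_factorization m)"
  have ms: "mset ?ps = prime_factorization m" by simp
  then have pl: "prod_list ?ps = m"
    using prod_mset_prime_factorization_nat[of m] m by (metis less_le_trans less_one prod_mset_prod_list zero_less_one)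
  have "?ps \<in> prime_lists 0 z X"
    using m pl unfolding prime_lists_def y_smooth_def
    by (auto simp: in_prime_factors_iff)
  then show "m \<in> prod_list ` prime_lists 0 z X" using pl by (metis image_eqI)
qed

lemma norm_sum_split:
  fixes f :: "'a \<Rightarrow> complex"
  assumes "finite S" "norm (sum f {s \<in> S. P s}) \<le> a" "norm (sum f {s \<in> S. \<not> P s}) \<le> b"
  shows "norm (sum f S) \<le> a + b"
proof -
  have "sum f S = sum f {s \<in> S. P s} + sum f {s \<in> S. \<not> P s}"
    using assms(1) by (subst sum.union_disjoint[symmetric]) (auto intro!: sum.cong)
  then show ?thesis using assms norm_triangle_mono by metis
qed

text \<open>A condition that does not fit the bilinear machinery is removed by bounding the sum
  without it and the sum over its failures.\<close>

lemma norm_sum_diff: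
  fixes f :: "'a \<Rightarrow> complex"
  assumes "finite S" "norm (sum f S) \<le> a" "norm (sum f {s \<in> S. \<not> P s}) \<le> b"
  shows "norm (sum f {s \<in> S. P s}) \<le> a + b"
proof -
  have "sum f S = sum f {s \<in> S. P s} + sum f {s \<in> S. \<not> P s}"
    using assms(1) by (subst sum.union_disjoint[symmetric]) (auto intro!: sum.cong)
  then have "sum f {s \<in> S. P s} = sum f S - sum f {s \<in> S. \<not> P s}" by simp
  then show ?thesis using assms norm_triangle_ineq4[of "sum f S" "sum f {s \<in> S. \<not> P s}"] by simp
qed

lemma rough_less_square_prime:
  assumes z: "0 < z" and k: "1 < k" "rough z k" "real k < z ^ 2"
  shows "prime k"
proof (rule ccontr)
  assume np: "\<not> prime k"
  obtain p where p: "prime p" "p dvd k" using prime_factor_nat[of k] k(1) by auto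
  then obtain j where j: "k = p * j" by (elim dvdE)
  have "j \<noteq> 1" using np p j by auto
  then obtain r where r: "prime r" "r dvd j" using prime_factor_nat[of j] by auto
  have j0: "0 < j" using k(1) j by (cases j) auto
  have "z < real p" "z < real r" using k(2) p r j unfolding rough_def by auto
  moreover have "r \<le> j" using r j0 by (simp add: dvd_imp_le)
  ultimately have "z * z < real p * real j" using z by (intro mult_strict_mono) auto
  then show False using k(3) j by (simp add: power2_eq_square)
qed

section \<open>Small integers times smooth numbers\<close>

context exp_sum_setting
begin

text \<open>Products up to \<open>U\<close> are counted trivially, which is harmless as
  \<open>U \<le> sqrt (x * V)\<close>. Beyond \<open>U\<close> the cut applies with \<open>a\<close>
  as the fixed factor and a trivial third variable of type \<open>unit\<close>. \<open>U\<close>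
  stays free because small and large \<open>y\<close> call for different choices.\<close>

lemma smooth_multiples:
  fixes A0 :: "nat set" and U V z :: real
  assumes A0: "finite A0" "\<And>a. a \<in> A0 \<Longrightarrow> 1 \<le> a \<and> real a \<le> U"
    and V: "1 \<le> U" "U \<le> x" "U \<le> V" "U * z \<le> V" "x / U \<le> V"
  shows "norm (\<Sum>(a, m)\<in>{(a, m). a \<in> A0 \<and> 1 \<le> m \<and> y_smooth z m \<and> real (a * m) \<le> x}. e (a * m)) \<le>
    (5 * real G) ^ 6 * Bnd V" (is "norm (sum ?g ?S) \<le> _")
proof -
  have V0: "0 \<le> V" using V by linarith
  have G1: "1 \<le> real G" using G_ge by simp
  have fK: "fibres_le {k. real k \<le> x} (\<lambda>k. k) 1" by (rule fibres_le_inj[OF nat_le_x]) auto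
  have fA: "fibres_le A0 (\<lambda>k. k) 1" by (rule fibres_le_inj[OF A0(1)]) auto
  have sub: "?S \<subseteq> A0 \<times> {k. real k \<le> x}"
  proof clarsimp
    fix a m assume p: "a \<in> A0" "Suc 0 \<le> m" "real a * real m \<le> x"
    show "real m \<le> x" by (rule real_le_of_dvd[of m "a * m"]) (use p A0(2)[of a] in auto)
  qed
  have fS: "fibres_le ?S (\<lambda>(a, m). a * m) (1 * 1 * real G)"
    by (rule fibres_le_prod[OF fA fK sub]) (use A0(2) in auto)
  then have finS: "finite ?S" unfolding fibres_le_def by simp
  let ?S1 = "{s \<in> ?S. real (fst s * snd s) \<le> U}" and ?S2 = "{s \<in> ?S. \<not> real (fst s * snd s) \<le> U}"
  have "norm (sum ?g ?S1) \<le> real G * Bnd V"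
  proof -
    have "norm (sum ?g ?S1) \<le> (\<Sum>s\<in>?S1. 1)" by (rule sum_norm_le) auto
    also have "\<dots> = real (card ?S1)" by simp
    also have "\<dots> \<le> (1 * 1 * real G) * real (nat \<lfloor>U\<rfloor>)"
    proof (rule card_le_fibres[OF fibres_le_subset[OF fS]])
      show "(\<lambda>(a, m). a * m) ` ?S1 \<subseteq> {1..nat \<lfloor>U\<rfloor>}"
        using A0(2) by (auto simp: le_nat_floor)
    qed auto
    also have "\<dots> \<le> real G * Bnd V"
    proof -
      have "U\<^sup>2 \<le> x * V" using V unfolding power2_eq_square by (intro mult_mono) auto
      then have "U \<le> Bnd V" using Bnd_ge(3)[OF V0] real_le_rsqrt[of U "x * V"] by linarith
      moreover have "real (nat \<lfloor>U\<rfloor>) \<le> U" using V by simp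
      ultimately show ?thesis by (simp add: mult_left_mono)
    qed
    finally show ?thesis .
  qed
  moreover have "norm (sum ?g ?S2) \<le> (5 * real G) ^ 5 * Bnd V"
  proof -
    define T where "T = {(a, ps, b :: unit). a \<in> A0 \<and> ps \<in> prime_lists 0 z x \<and> b \<in> {()} \<and>
       real (a * prod_list ps * 1) \<le> x \<and> U < real (a * prod_list ps) \<and>
       (\<forall>d\<in>set ([] :: (nat, unit) cond list). holds d a b (prod_list ps))}"
    have fu: "fibres_le {()} (\<lambda>_. 1 :: nat) 1" by (rule fibres_le_inj) auto
    have "norm (\<Sum>(a, ps, b)\<in>T. 1 * 1 ^ length ps * 1 * e (a * prod_list ps * 1)) \<le>
        1 * 1 * (5 * real G) ^ (length ([] :: (nat, unit) cond list) + 5) * Bnd V"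
      unfolding T_def
    proof (rule smooth_type_II[OF fA fu])
      have "real G \<le> 2 ^ G" using less_exp[of G] by (metis of_nat_le_iff of_nat_numeral of_nat_power less_imp_le)
      also have "\<dots> \<le> 2 ^ (3 * G)" by (rule power_increasing) auto
      finally show "1 * real G \<le> 2 ^ (3 * G)" by simp
    qed (use A0(2) V in auto)
    also have "(\<Sum>(a, ps, b)\<in>T. 1 * 1 ^ length ps * 1 * e (a * prod_list ps * 1)) = sum ?g ?S2"
    proof -
      define J where "J = (\<lambda>(a :: nat, ps :: nat list, b :: unit). (a, prod_list ps))"
      have inj: "inj_on J T"
        using inj_on_prod_list_prime_lists[of 0 z x] by (auto simp: J_def T_def inj_on_def)
      have "J ` T = ?S2"
      proof (intro equalityI subsetI)
        fix s assume "s \<in> J ` T"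
        then obtain a ps where s: "s = (a, prod_list ps)" and p: "a \<in> A0" "ps \<in> prime_lists 0 z x"
          "real (a * prod_list ps) \<le> x" "U < real (a * prod_list ps)" by (auto simp: J_def T_def)
        have "prod_list ps \<in> {m. 1 \<le> m \<and> real m \<le> x \<and> y_smooth z m}"
          unfolding prod_list_image_prime_lists[symmetric] using p(2) by blast
        then show "s \<in> ?S2" using p s by auto
      next
        fix s assume s: "s \<in> ?S2"
        obtain a m where s': "s = (a, m)" by (cases s)
        have p: "a \<in> A0" "1 \<le> m" "y_smooth z m" "real (a * m) \<le> x" "U < real (a * m)" "real m \<le> x"
          using s sub by (auto simp: s' not_le)
        have "m \<in> prod_list ` prime_lists 0 z x" unfolding prod_list_image_prime_lists using p by simp
        then obtain ps where "ps \<in> prime_lists 0 z x" "m = prod_list ps" by auto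
        then have "(a, ps, ()) \<in> T" "s = J (a, ps, ())" using p s' by (auto simp: T_def J_def)
        then show "s \<in> J ` T" by blast
      qed
      then have "sum ?g ?S2 = sum (?g \<circ> J) T" using sum.reindex[OF inj, of ?g] by simp
      then show ?thesis by (simp add: J_def case_prod_beta' comp_def)
    qed
    finally show ?thesis by simp
  qed
  ultimately have "norm (sum ?g ?S) \<le> real G * Bnd V + (5 * real G) ^ 5 * Bnd V"
    by (rule norm_sum_split[OF finS])
  also have "\<dots> = (real G + (5 * real G) ^ 5) * Bnd V" by (simp add: distrib_right)
  also have "\<dots> \<le> (5 * real G) ^ 6 * Bnd V"
  proof (rule mult_right_mono)
    have "real G \<le> (5 * real G) ^ 5"
      using G1 self_le_power[of "5 * real G" 5] by linarith
    then have "real G + (5 * real G) ^ 5 \<le> 2 * (5 * real G) ^ 5" by linarith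
    also have "\<dots> \<le> (5 * real G) * (5 * real G) ^ 5" using G1 by (intro mult_right_mono) auto
    finally show "real G + (5 * real G) ^ 5 \<le> (5 * real G) ^ 6" by (simp add: eval_nat_numeral)
  qed (use Bnd_ge(4)[OF V0] in auto)
  finally show ?thesis .
qed

end

section \<open>Estimates with a common error term\<close>

context fifth_root_setting
begin

text \<open>The exponent is dictated by \<open>least_two_primes_rough\<close>: one factor
  \<open>G\<close> for the pair \<open>(m, p)\<close>, six conditions, and the \<open>8\<close> of
  \<open>rough_sum\<close>.\<close>

definition E :: real where "E = (5 * real G) ^ 15 * Bnd (z ^ 3)"

lemma power_Bnd_le_E:
  assumes "j \<le> 15" "t \<le> (5 * real G) ^ j * Bnd (z ^ 3)"
  shows "t \<le> E"
proof -
  have "(5 * real G) ^ j \<le> (5 * real G) ^ 15" using assms(1) G_ge by (intro power_increasing) auto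
  then have "(5 * real G) ^ j * Bnd (z ^ 3) \<le> E"
    unfolding E_def using Bnd_ge(4)[OF z_powers(6)] by (rule mult_right_mono)
  then show ?thesis using assms(2) by linarith
qed

lemma G_power_le:
  "real G ^ i * (5 * real G) ^ j * Bnd (z ^ 3) \<le> (5 * real G) ^ (i + j) * Bnd (z ^ 3)"
  unfolding power_add using Bnd_ge(4)[OF z_powers(6)] by (intro mult_right_mono power_mono) auto

lemma G_le_pow: "real G * real G \<le> 2 ^ (3 * G)" "real G \<le> 2 ^ (3 * G)"
proof -
  have g: "real G \<le> 2 ^ G" using less_exp[of G] by (metis of_nat_le_iff of_nat_numeral of_nat_power less_imp_le)
  then have "real G * real G \<le> 2 ^ G * 2 ^ G" by (intro mult_mono) auto
  also have "\<dots> = 2 ^ (2 * G)" by (simp add: power_add[symmetric] mult_2)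
  also have "\<dots> \<le> 2 ^ (3 * G)" by (rule power_increasing) auto
  finally show "real G * real G \<le> 2 ^ (3 * G)" .
  have "(2::real) ^ G \<le> 2 ^ (3 * G)" by (rule power_increasing) auto
  then show "real G \<le> 2 ^ (3 * G)" using g by linarith
qed

lemma type_II_middle:
  fixes v :: "'a \<Rightarrow> nat" and w :: "'b \<Rightarrow> nat" and i j :: nat
  assumes v: "fibres_le A v (real G ^ i)" and w: "fibres_le B w (real G ^ j)" "j \<le> 1"
    and A: "\<And>a. a \<in> A \<Longrightarrow> z ^ 2 < v a \<and> v a \<le> z ^ 3" and B: "\<And>b. b \<in> B \<Longrightarrow> 1 \<le> w b"
    and Rs: "\<And>R. R \<in> set Rs \<Longrightarrow> chain_rel A B R" and le: "i + j + length Rs \<le> 13"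
  shows "norm (\<Sum>(a, b)\<in>{(a, b) \<in> A \<times> B. real (v a * w b) \<le> x \<and> (\<forall>R\<in>set Rs. R a b)}. e (v a * w b)) \<le> E"
proof -
  have "real G ^ j \<le> 2 ^ (3 * G)"
    using w(2) G_le_pow by (cases j) (auto simp: le_Suc_eq)
  then have "norm (\<Sum>(a, b)\<in>{(a, b) \<in> A \<times> B. real (v a * w b) \<le> x \<and> (\<forall>R\<in>set Rs. R a b)}.
      1 * 1 * e (v a * w b)) \<le> real G ^ i * real G ^ j * (5 * real G) ^ (length Rs + 2) * Bnd (z ^ 3)"
    by (intro type_II[where \<alpha> = "\<lambda>_. 1" and \<beta> = "\<lambda>_. 1", OF v w(1) _ A]) (use z_powers B Rs in auto)
  then have "norm (\<Sum>(a, b)\<in>{(a, b) \<in> A \<times> B. real (v a * w b) \<le> x \<and> (\<forall>R\<in>set Rs. R a b)}. e (v a * w b))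
     \<le> real G ^ i * real G ^ j * (5 * real G) ^ (length Rs + 2) * Bnd (z ^ 3)"
    by (simp only: mult_1)
  also have "\<dots> = real G ^ (i + j) * (5 * real G) ^ (length Rs + 2) * Bnd (z ^ 3)" by (simp add: power_add)
  also have "\<dots> \<le> (5 * real G) ^ (i + j + (length Rs + 2)) * Bnd (z ^ 3)" by (rule G_power_le)
  finally show ?thesis by (rule power_Bnd_le_E[rotated]) (use le in simp)
qed

lemma rough_sum_E:
  fixes v :: "'a \<Rightarrow> nat" and w :: "'b \<Rightarrow> nat" and i :: nat
  assumes v: "fibres_le A v (real G ^ i)" and w: "fibres_le B w 1"
    and A: "\<And>a. a \<in> A \<Longrightarrow> 1 \<le> v a \<and> v a \<le> z ^ 3" and B: "\<And>b. b \<in> B \<Longrightarrow> 1 \<le> w b \<and> w b \<le> z ^ 2"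
    and cs: "\<And>d. d \<in> set cs \<Longrightarrow> pos_cond A B d" and le: "i + length cs \<le> 7"
  shows "norm (\<Sum>(a, b, k)\<in>{(a, b, k). a \<in> A \<and> b \<in> B \<and> 1 \<le> k \<and> rough z k \<and> real (v a * w b * k) \<le> x \<and>
      (\<forall>d\<in>set cs. holds d a b k)}. e (v a * w b * k)) \<le> E"
proof -
  have "1 * real G * real G \<le> 2 ^ (3 * G)" using G_le_pow by simp
  from rough_sum[OF v w this A B cs]
  have "norm (\<Sum>(a, b, k)\<in>{(a, b, k). a \<in> A \<and> b \<in> B \<and> 1 \<le> k \<and> rough z k \<and> real (v a * w b * k) \<le> x \<and>
      (\<forall>d\<in>set cs. holds d a b k)}. e (v a * w b * k)) \<le> real G ^ i * 1 * (5 * real G) ^ (length cs + 8) * Bnd (z ^ 3)"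
    by blast
  also have "\<dots> = real G ^ i * (5 * real G) ^ (length cs + 8) * Bnd (z ^ 3)" by simp
  also have "\<dots> \<le> (5 * real G) ^ (i + (length cs + 8)) * Bnd (z ^ 3)" by (rule G_power_le)
  finally show ?thesis by (rule power_Bnd_le_E[rotated]) (use le in simp)
qed

lemma type_I_E:
  fixes v :: "'c \<Rightarrow> nat" and i :: nat
  assumes v: "fibres_le C v (real G ^ i)" and C: "\<And>c. c \<in> C \<Longrightarrow> 1 \<le> v c \<and> v c \<le> z ^ 4" and le: "i \<le> 14"
  shows "norm (\<Sum>(c, k)\<in>{(c, k). c \<in> C \<and> 1 \<le> k \<and> real (v c * k) \<le> x}. e (v c * k)) \<le> E"
proof -
  define I where "I c = {k. 1 \<le> k \<and> real (v c * k) \<le> x}" for c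
  have finI: "finite (I c)" if "c \<in> C" for c
  proof (rule finite_subset[OF _ nat_le_x], rule subsetI)
    fix k assume "k \<in> I c"
    then have "real k \<le> x"
      by (intro real_le_of_dvd[of k "v c * k"]) (use C[OF that] in \<open>auto simp: I_def\<close>)
    then show "k \<in> {n. real n \<le> x}" by simp
  qed
  have finC: "finite C" using v unfolding fibres_le_def by simp
  have "{(c, k). c \<in> C \<and> 1 \<le> k \<and> real (v c * k) \<le> x} = Sigma C I" by (auto simp: I_def)
  then have "(\<Sum>(c, k)\<in>{(c, k). c \<in> C \<and> 1 \<le> k \<and> real (v c * k) \<le> x}. e (v c * k)) = (\<Sum>c\<in>C. \<Sum>k\<in>I c. e (v c * k))"
    using sum.Sigma[of C I "\<lambda>c k. e (v c * k)"] finC finI by simp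
  also have "norm \<dots> \<le> (\<Sum>c\<in>C. norm (\<Sum>k\<in>I c. e (v c * k)))" by (rule norm_sum)
  also have "\<dots> \<le> real G ^ i * (5 * real G) * Bnd (z ^ 3)"
  proof (rule type_I[OF v C z_powers(4-6)])
    fix c l j k assume "l \<in> I c" "k \<in> I c" "l \<le> j" "j \<le> k"
    moreover from this have "real (v c * j) \<le> real (v c * k)" by (intro of_nat_mono mult_le_mono2)
    ultimately show "j \<in> I c" by (auto simp: I_def)
  qed (auto simp: I_def)
  also have "\<dots> = real G ^ i * (5 * real G) ^ 1 * Bnd (z ^ 3)" by simp
  also have "\<dots> \<le> (5 * real G) ^ (i + 1) * Bnd (z ^ 3)" by (rule G_power_le)
  finally show ?thesis by (rule power_Bnd_le_E[rotated]) (use le in simp)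
qed

lemma fibres_le_nat:
  assumes "\<And>n. n \<in> A \<Longrightarrow> real n \<le> x"
  shows "fibres_le A (\<lambda>n. n) 1"
  by (rule fibres_le_subset[OF fibres_le_inj[OF nat_le_x]]) (use assms in auto)

lemma fibres_le_nat_pair:
  assumes "\<And>m n. (m, n) \<in> A \<Longrightarrow> 1 \<le> m \<and> 1 \<le> n \<and> real (m * n) \<le> x"
  shows "fibres_le A (\<lambda>(m, n). m * n) (real G ^ 1)"
proof -
  have f: "fibres_le {n. real n \<le> x} (\<lambda>n. n) 1" by (rule fibres_le_nat) auto
  have "A \<subseteq> {n. real n \<le> x} \<times> {n. real n \<le> x}"
  proof
    fix s assume s: "s \<in> A"
    obtain m n where s': "s = (m, n)" by (cases s)
    have p: "1 \<le> m" "1 \<le> n" "real (m * n) \<le> x" using assms[of m n] s s' by auto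
    have "real m \<le> x" "real n \<le> x" by (rule real_le_of_dvd[OF _ _ p(3)]; use p(1,2) in auto)+
    then show "s \<in> {n. real n \<le> x} \<times> {n. real n \<le> x}" by (simp add: s')
  qed
  then have "fibres_le A (\<lambda>(m, n). m * n) (1 * 1 * real G)"
    by (rule fibres_le_prod[OF f f]) (use assms in auto)
  then show ?thesis by simp
qed

lemma z_le: "z \<le> z ^ 2" "z ^ 2 \<le> z ^ 3" "z ^ 3 \<le> z ^ 4" "z ^ 3 \<le> x" "z \<le> z ^ 3" "z ^ 2 \<le> x"
proof -
  have "z ^ 1 \<le> z ^ 2" "z ^ 2 \<le> z ^ 3" "z ^ 3 \<le> z ^ 4" "z ^ 3 \<le> z ^ 5" "z ^ 1 \<le> z ^ 3" "z ^ 2 \<le> z ^ 5"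
    by (rule power_increasing; use z_ge_1 in simp)+
  then show "z \<le> z ^ 2" "z ^ 2 \<le> z ^ 3" "z ^ 3 \<le> z ^ 4" "z ^ 3 \<le> x" "z \<le> z ^ 3" "z ^ 2 \<le> x" using z_pow by auto
qed

text \<open>The prime itself is in type II position, and the smoothness of \<open>m\<close> with
  respect to it is a chain relation.\<close>

lemma largest_prime_middle:
  "norm (\<Sum>(p, m)\<in>{(p, m). prime p \<and> z ^ 2 < real p \<and> real p \<le> z ^ 3 \<and> real p \<le> y \<and> 1 \<le> m \<and>
     y_smooth (real p) m \<and> real (p * m) \<le> x}. e (p * m)) \<le> E"
proof -
  define A where "A = {p. prime p \<and> z ^ 2 < real p \<and> real p \<le> z ^ 3 \<and> real p \<le> y}"
  define B where "B = {m. 1 \<le> m \<and> real m \<le> x}"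
  let ?R = "\<lambda>p m. y_smooth (real p) m"
  have fA: "fibres_le A (\<lambda>n. n) (real G ^ 0)" and fB: "fibres_le B (\<lambda>n. n) (real G ^ 0)"
    using fibres_le_nat[of A] fibres_le_nat[of B] z_le(4) by (auto simp: A_def B_def)
  have finA: "finite A" using fA unfolding fibres_le_def by simp
  have "norm (\<Sum>(a, b)\<in>{(a, b) \<in> A \<times> B. real (a * b) \<le> x \<and> (\<forall>R\<in>set [?R]. R a b)}. e (a * b)) \<le> E"
  proof (rule type_II_middle[OF fA fB])
    show "chain_rel A B R" if "R \<in> set [?R]" for R
      by (rule chain_rel_y_smooth[OF finA, where \<phi> = "\<lambda>p. p" and m = "\<lambda>m. m"]) (use that in auto)
  qed (auto simp: A_def B_def)
  also have "{(a, b) \<in> A \<times> B. real (a * b) \<le> x \<and> (\<forall>R\<in>set [?R]. R a b)} =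
     {(p, m). prime p \<and> z ^ 2 < real p \<and> real p \<le> z ^ 3 \<and> real p \<le> y \<and> 1 \<le> m \<and>
     y_smooth (real p) m \<and> real (p * m) \<le> x}" (is "?L = ?R'")
  proof (intro equalityI subsetI)
    fix s assume s: "s \<in> ?R'"
    obtain p m where s': "s = (p, m)" by (cases s)
    have "prime p" "1 \<le> m" "real (p * m) \<le> x" using s s' by auto
    then have "real m \<le> x" by (intro real_le_of_dvd[of m "p * m"]) (auto simp: prime_gt_0_nat)
    then show "s \<in> ?L" using s by (auto simp: s' A_def B_def)
  qed (auto simp: A_def B_def)
  finally show ?thesis .
qed

text \<open>Smoothness of \<open>m\<close> need not be imposed: \<open>p > z ^ 3\<close> leaves only
  \<open>m < z ^ 2 < p\<close>. So \<open>m\<close> runs through an interval and the sum is type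
  I.\<close>

lemma largest_prime_upper:
  "norm (\<Sum>(p, m)\<in>{(p, m). prime p \<and> z ^ 3 < real p \<and> real p \<le> z ^ 4 \<and> real p \<le> y \<and> 1 \<le> m \<and>
     real (p * m) \<le> x}. e (p * m)) \<le> E"
proof -
  define C where "C = {p. prime p \<and> z ^ 3 < real p \<and> real p \<le> z ^ 4 \<and> real p \<le> y}"
  have fC: "fibres_le C (\<lambda>n. n) (real G ^ 0)"
    using fibres_le_nat[of C] z_powers(4) by (auto simp: C_def)
  have "norm (\<Sum>(c, k)\<in>{(c, k). c \<in> C \<and> 1 \<le> k \<and> real (c * k) \<le> x}. e (c * k)) \<le> E"
    by (rule type_I_E[OF fC]) (auto simp: C_def prime_gt_0_nat Suc_le_eq)
  also have "{(c, k). c \<in> C \<and> 1 \<le> k \<and> real (c * k) \<le> x} = {(p, m). prime p \<and> z ^ 3 < real p \<and> real p \<le> z ^ 4 \<and> real p \<le> y \<and> 1 \<le> m \<and>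
     real (p * m) \<le> x}" by (auto simp: C_def)
  finally show ?thesis .
qed

text \<open>The candidates for the two largest prime factors when both lie in
  \<open>(z, z ^ 2]\<close>. Their product is in \<open>(z ^ 2, z ^ 4]\<close>, within reach of type
  II or type I.\<close>

definition prime_pairs :: "real \<Rightarrow> (nat \<times> nat) set" where
  "prime_pairs y = {(p, r). prime p \<and> prime r \<and> z < real r \<and> r \<le> p \<and> real p \<le> z ^ 2 \<and> real p \<le> y}"

lemma prime_pairs_bounds:
  assumes "(p, r) \<in> prime_pairs y"
  shows "1 \<le> p" "1 \<le> r" "z ^ 2 < real (p * r)" "real (p * r) \<le> z ^ 4" "real p > 0" "real r > 0"
proof -
  have p: "prime p" "prime r" "z < real r" "real r \<le> real p" "real p \<le> z ^ 2" using assms by (auto simp: prime_pairs_def)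
  show "1 \<le> p" "1 \<le> r" "real p > 0" "real r > 0" using p(1,2) by (auto simp: prime_gt_0_nat Suc_le_eq)
  have "z * z < real p * real r" using p z_powers(1) by (intro mult_strict_mono) auto
  then show "z ^ 2 < real (p * r)" by (simp add: power2_eq_square)
  have "real p * real r \<le> z ^ 2 * z ^ 2" using p by (intro mult_mono) auto
  then show "real (p * r) \<le> z ^ 4" by (simp add: power_add[symmetric])
qed

text \<open>The product \<open>p * r\<close> is in type II position; smoothness of \<open>m\<close>
  involves only \<open>r\<close>, so it is again a chain relation.\<close>

lemma two_primes_type_II:
  "norm (\<Sum>((p, r), m)\<in>{((p, r), m). (p, r) \<in> prime_pairs y \<and> real (p * r) \<le> z ^ 3 \<and> 1 \<le> m \<and>
     y_smooth (real r) m \<and> real (p * r * m) \<le> x}. e (p * r * m)) \<le> E"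
proof -
  define A where "A = {(p, r). (p, r) \<in> prime_pairs y \<and> real (p * r) \<le> z ^ 3}"
  define B where "B = {m. 1 \<le> m \<and> real m \<le> x}"
  let ?R = "\<lambda>s m. y_smooth (real (snd s)) m" and ?v = "\<lambda>(p, r). p * r"
  have b: "1 \<le> p \<and> 1 \<le> r \<and> real (p * r) \<le> x" if "(p, r) \<in> A" for p r
    using that prime_pairs_bounds[of p r y] z_le(4) by (auto simp: A_def)
  have fA: "fibres_le A ?v (real G ^ 1)" by (rule fibres_le_nat_pair) (rule b)
  have fB: "fibres_le B (\<lambda>n. n) (real G ^ 0)"
    using fibres_le_nat[of B] by (auto simp: B_def)
  have finA: "finite A" using fA unfolding fibres_le_def by simp
  have "norm (\<Sum>(a, b)\<in>{(a, b) \<in> A \<times> B. real (?v a * b) \<le> x \<and> (\<forall>R\<in>set [?R]. R a b)}. e (?v a * b)) \<le> E"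
  proof (rule type_II_middle[OF fA fB])
    show "chain_rel A B R" if "R \<in> set [?R]" for R
      by (rule chain_rel_y_smooth[OF finA, where \<phi> = snd and m = "\<lambda>m. m"]) (use that in auto)
    show "z ^ 2 < real (?v a) \<and> real (?v a) \<le> z ^ 3" if "a \<in> A" for a
      using that prime_pairs_bounds(3)[of "fst a" "snd a" y] by (cases a) (auto simp: A_def)
  qed (auto simp: B_def)
  also have "{(a, b) \<in> A \<times> B. real (?v a * b) \<le> x \<and> (\<forall>R\<in>set [?R]. R a b)} =
     {((p, r), m). (p, r) \<in> prime_pairs y \<and> real (p * r) \<le> z ^ 3 \<and> 1 \<le> m \<and>
     y_smooth (real r) m \<and> real (p * r * m) \<le> x}" (is "?L = ?R'")
  proof (intro equalityI subsetI)
    fix s assume s: "s \<in> ?R'"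
    obtain p r m where s': "s = ((p, r), m)" by (metis prod.exhaust)
    have t: "(p, r) \<in> prime_pairs y" "1 \<le> m" "real (p * r * m) \<le> x" using s s' by auto
    then have "real m \<le> x" by (intro real_le_of_dvd[of m "p * r * m"]) (use prime_pairs_bounds[OF t(1)] in auto)
    then show "s \<in> ?L" using s by (auto simp: s' A_def B_def)
  qed (auto simp: A_def B_def)
  finally show ?thesis by (simp add: case_prod_beta')
qed

text \<open>Beyond \<open>z ^ 3\<close> the smoothness of \<open>m\<close> is dropped so that
  \<open>m\<close> runs through an interval. The surplus thus created is handled by
  \<open>two_primes_rough\<close>.\<close>

lemma two_primes_type_I:
  "norm (\<Sum>((p, r), m)\<in>{((p, r), m). (p, r) \<in> prime_pairs y \<and> z ^ 3 < real (p * r) \<and> 1 \<le> m \<and>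
     real (p * r * m) \<le> x}. e (p * r * m)) \<le> E"
proof -
  define C where "C = {(p, r). (p, r) \<in> prime_pairs y \<and> z ^ 3 < real (p * r)}"
  let ?v = "\<lambda>(p, r). p * r"
  have b: "1 \<le> p \<and> 1 \<le> r \<and> real (p * r) \<le> z ^ 4" if "(p, r) \<in> C" for p r
    using that prime_pairs_bounds[of p r y] by (auto simp: C_def)
  have fC: "fibres_le C ?v (real G ^ 1)" by (rule fibres_le_nat_pair) (use b z_powers(4) in force)
  have "norm (\<Sum>(c, k)\<in>{(c, k). c \<in> C \<and> 1 \<le> k \<and> real (?v c * k) \<le> x}. e (?v c * k)) \<le> E"
    by (rule type_I_E[OF fC]) (use b in auto)
  also have "{(c, k). c \<in> C \<and> 1 \<le> k \<and> real (?v c * k) \<le> x} = {((p, r), m). (p, r) \<in> prime_pairs y \<and> z ^ 3 < real (p * r) \<and> 1 \<le> m \<and>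
     real (p * r * m) \<le> x}" by (auto simp: C_def)
  finally show ?thesis by (simp add: case_prod_beta')
qed

text \<open>As \<open>p r > z\<^sup>3\<close>, the cofactor \<open>m\<close> is smaller than \<open>z\<^sup>2\<close>, so it has only one prime factor
  \<open>k > r > z\<close>; conversely a \<open>z\<close>-rough number below \<open>z\<^sup>2\<close> is a prime.\<close>

lemma two_primes_rough:
  "norm (\<Sum>((p, r), m)\<in>{((p, r), m). (p, r) \<in> prime_pairs y \<and> z ^ 3 < real (p * r) \<and> 1 \<le> m \<and>
     real (p * r * m) \<le> x \<and> \<not> y_smooth (real r) m}. e (p * r * m)) \<le> E"
    (is "norm (sum ?g ?S) \<le> E")
proof -
  \<comment> \<open>The surplus cofactor is written \<open>k * m\<close> with \<open>k\<close>
    prime. It is below \<open>z ^ 2\<close> and \<open>k > z\<close>, so \<open>m \<le> z\<close>.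
    Hence \<open>m * p \<le> z ^ 3\<close> and \<open>r \<le> z ^ 2\<close> fit the two bounded
    variables of \<open>rough_sum_E\<close>, and \<open>k\<close> is the sieved one.\<close>
  define A where "A = {(m, p). 1 \<le> m \<and> real m \<le> z \<and> prime p \<and> z < real p \<and> real p \<le> z ^ 2 \<and> real p \<le> y}"
  define B where "B = {r. prime r \<and> z < real r \<and> real r \<le> z ^ 2}"
  define c1 :: "(nat \<times> nat, nat) cond" where "c1 = (\<lambda>a. real (snd a) / z ^ 3, \<lambda>r. real r, 0, False)"
  define c2 :: "(nat \<times> nat, nat) cond" where "c2 = (\<lambda>a. 1 / real (snd a), \<lambda>r. real r, 0, True)"
  define c3 :: "(nat \<times> nat, nat) cond" where "c3 = (\<lambda>a. 1, \<lambda>r. 1 / real r, 1, False)"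
  let ?v = "\<lambda>(m, p). m * p"
  have bA: "1 \<le> m \<and> 1 \<le> p \<and> real (m * p) \<le> z ^ 3" if "(m, p) \<in> A" for m p
  proof -
    have "real m * real p \<le> z * z ^ 2" using that z_powers(1) by (intro mult_mono) (auto simp: A_def)
    then show ?thesis using that by (auto simp: A_def prime_gt_0_nat Suc_le_eq eval_nat_numeral)
  qed
  have fA: "fibres_le A ?v (real G ^ 1)" by (rule fibres_le_nat_pair) (use bA z_le(4) in force)
  have fB: "fibres_le B (\<lambda>n. n) 1" by (rule fibres_le_nat) (use z_le(6) in \<open>auto simp: B_def\<close>)
  have posA: "0 < real (snd a)" if "a \<in> A" for a using that by (auto simp: A_def prime_gt_0_nat)
  have posB: "0 < real r" if "r \<in> B" for r using that by (auto simp: B_def prime_gt_0_nat)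
  let ?T = "{(a, b, k). a \<in> A \<and> b \<in> B \<and> 1 \<le> k \<and> rough z k \<and> real (?v a * b * k) \<le> x \<and>
      (\<forall>d\<in>set [c1, c2, c3]. holds d a b k)}"
  have bound: "norm (\<Sum>(a, b, k)\<in>?T. e (?v a * b * k)) \<le> E"
  proof (rule rough_sum_E[OF fA fB])
    show "pos_cond A B d" if "d \<in> set [c1, c2, c3]" for d
      using that posA posB z_powers(1) by (auto simp: pos_cond_def c1_def c2_def c3_def)
  qed (use bA in \<open>auto simp: B_def prime_gt_0_nat Suc_le_eq\<close>)
  have T: "?T = {((m, p), r, k). (m, p) \<in> A \<and> r \<in> B \<and> rough z k \<and> real (m * p * r * k) \<le> x \<and>
      z ^ 3 < real (p * r) \<and> r \<le> p \<and> r < k}" (is "_ = ?T'")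
  proof -
    have "(\<forall>d\<in>set [c1, c2, c3]. holds d (m, p) r k) \<longleftrightarrow> z ^ 3 < real (p * r) \<and> r \<le> p \<and> r < k"
      if "(m, p) \<in> A" "r \<in> B" for m p r k
      using posA[OF that(1)] posB[OF that(2)] z_powers(1)
      by (auto simp: holds_def c1_def c2_def c3_def field_simps)
    then show ?thesis by (auto simp: Suc_le_eq)
  qed
  define J where "J = (\<lambda>((m, p), r, k). ((p :: nat, r :: nat), k * m :: nat))"
  have pk: "prime k \<and> z < real k" if "((m, p), r, k) \<in> ?T'" for m p r k
  proof -
    have t: "(m, p) \<in> A" "r \<in> B" "rough z k" "real (m * p * r * k) \<le> x" "z ^ 3 < real (p * r)" "r < k" using that by auto
    have zk: "z < real k" using t by (auto simp: B_def)
    have "real (p * r) * real k * 1 \<le> real (p * r) * real k * real m"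
      using bA[OF t(1)] by (intro mult_left_mono) auto
    also have "\<dots> \<le> x" using t(4) by (simp add: mult_ac)
    finally have a: "real (p * r) * real k \<le> z ^ 5" using z_pow by simp
    have "z ^ 3 * real k < real (p * r) * real k" using t(5) zk z_powers(1) by (intro mult_strict_right_mono) auto
    then have "z ^ 3 * real k < z ^ 3 * z ^ 2" using a by (simp add: power_add[symmetric])
    then have "real k < z ^ 2" by (rule mult_left_less_imp_less) (rule z_powers(6))
    moreover have "1 < k" using zk z_ge_1 by linarith
    ultimately show ?thesis using rough_less_square_prime[OF z_powers(1) _ t(3)] zk by blast
  qed
  \<comment> \<open>\<open>k\<close> is a prime above \<open>z\<close> while
    \<open>m \<le> z\<close>, so \<open>k\<close> can be recovered from
    \<open>k * m\<close>.\<close>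
  have inj: "inj_on J ?T'"
  proof (rule inj_onI)
    fix s t assume st: "s \<in> ?T'" "t \<in> ?T'" "J s = J t"
    obtain m p r k where s: "s = ((m, p), r, k)" by (metis prod.exhaust)
    obtain m' p' r' k' where t: "t = ((m', p'), r', k')" by (metis prod.exhaust)
    have e: "p = p'" "r = r'" "k * m = k' * m'" using st(3) by (auto simp: s t J_def)
    have k: "prime k" "z < real k" "prime k'" using pk st(1,2) s t by blast+
    have m': "1 \<le> m'" "real m' \<le> z" using st(2) by (auto simp: t A_def)
    have "k dvd k' * m'" using e by (metis dvd_triv_left)
    moreover have "\<not> k dvd m'"
    proof
      assume "k dvd m'"
      then have "k \<le> m'" using m' by (intro dvd_imp_le) auto
      then show False using k m' by linarith
    qed
    ultimately have "k = k'" using k by (metis prime_dvd_mult_iff primes_dvd_imp_eq)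
    then show "s = t" using e k by (auto simp: s t)
  qed
  have img: "J ` ?T' = ?S"
  proof (intro equalityI subsetI)
    fix s assume "s \<in> J ` ?T'"
    then obtain m p r k where s: "s = ((p, r), k * m)" and T: "((m, p), r, k) \<in> ?T'" by (auto simp: J_def)
    have t: "(m, p) \<in> A" "r \<in> B" "rough z k" "real (m * p * r * k) \<le> x" "z ^ 3 < real (p * r)" "r \<le> p" "r < k" using T by auto
    have "\<not> y_smooth (real r) (k * m)"
      unfolding y_smooth_def using pk[OF T] t(7) by (metis dvd_triv_left linorder_not_le of_nat_less_iff)
    moreover have "(p, r) \<in> prime_pairs y" using t by (auto simp: prime_pairs_def A_def B_def)
    moreover have "1 \<le> k * m" using t(1,7) by (auto simp: A_def)
    moreover have "real (p * r * (k * m)) \<le> x" using t(4) by (simp add: mult_ac)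
    ultimately show "s \<in> ?S" using t(5) by (simp add: s)
  next
    fix s assume s: "s \<in> ?S"
    obtain p r n where s': "s = ((p, r), n)" by (metis prod.exhaust)
    have t: "(p, r) \<in> prime_pairs y" "z ^ 3 < real (p * r)" "1 \<le> n" "real (p * r * n) \<le> x" "\<not> y_smooth (real r) n"
      using s by (auto simp: s')
    have pr: "prime p" "prime r" "z < real r" "r \<le> p" "real p \<le> z ^ 2" "real p \<le> y" using t(1) by (auto simp: prime_pairs_def)
    obtain k where k: "prime k" "k dvd n" "r < k" using t(5) by (auto simp: y_smooth_def not_le)
    obtain m where m: "n = k * m" using k(2) by (elim dvdE)
    have m1: "1 \<le> m" using t(3) m by (cases m) auto
    have n2: "real n < z ^ 2"
    proof (rule ccontr)
      assume "\<not> real n < z ^ 2"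
      then have "z ^ 3 * z ^ 2 < real (p * r) * real n" using t(2) z_powers(7) z_powers(1) by (intro mult_less_le_imp_less) auto
      then show False using t(4) z_pow by (simp add: power_add[symmetric])
    qed
    have zk: "z < real k" using pr k by linarith
    have "real m \<le> z"
    proof (rule ccontr)
      assume "\<not> real m \<le> z"
      then have "z * z < real k * real m" using zk z_powers(1) by (intro mult_strict_mono) auto
      then show False using n2 m by (simp add: power2_eq_square)
    qed
    moreover have "rough z k" unfolding rough_def using k(1) zk primes_dvd_imp_eq by blast
    moreover have "real (m * p * r * k) \<le> x" using t(4) m by (simp add: mult_ac)
    moreover have "real r \<le> z ^ 2" using pr by linarith
    ultimately have "((m, p), r, k) \<in> ?T'" using pr t k m1 by (auto simp: A_def B_def)
    then show "s \<in> J ` ?T'" by (rule rev_image_eqI) (simp add: J_def s' m)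
  qed
  have "sum ?g ?S = sum (?g \<circ> J) ?T'" using sum.reindex[OF inj, of ?g] img by simp
  also have "\<dots> = (\<Sum>(a, b, k)\<in>?T'. e (?v a * b * k))"
    by (rule sum.cong[OF refl]) (auto simp: J_def mult_ac)
  finally show ?thesis using bound unfolding T by simp
qed

text \<open>One \<open>E\<close> comes from \<open>p * r \<le> z ^ 3\<close>; beyond that, one from
  unrestricted \<open>m\<close> and one from the surplus.\<close>

lemma two_primes:
  "norm (\<Sum>((p, r), m)\<in>{((p, r), m). (p, r) \<in> prime_pairs y \<and> 1 \<le> m \<and>
     y_smooth (real r) m \<and> real (p * r * m) \<le> x}. e (p * r * m)) \<le> 3 * E"
    (is "norm (sum ?g ?S) \<le> _")
proof -
  define S0 where "S0 = {((p, r), m). (p, r) \<in> prime_pairs y \<and> 1 \<le> m \<and> real (p * r * m) \<le> x}"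
  have finS0: "finite S0"
  proof (rule finite_subset)
    show "S0 \<subseteq> ({n. real n \<le> x} \<times> {n. real n \<le> x}) \<times> {n. real n \<le> x}"
    proof
      fix s assume s: "s \<in> S0"
      obtain p r n where s': "s = ((p, r), n)" by (metis prod.exhaust)
      have t: "(p, r) \<in> prime_pairs y" "1 \<le> n" "real (p * r * n) \<le> x" using s by (auto simp: s' S0_def)
      have "real p \<le> x" "real r \<le> x" "real n \<le> x"
        by (rule real_le_of_dvd[OF _ _ t(3)]; use prime_pairs_bounds[OF t(1)] t(2) in auto)+
      then show "s \<in> ({n. real n \<le> x} \<times> {n. real n \<le> x}) \<times> {n. real n \<le> x}" by (simp add: s')
    qed
  qed (simp add: nat_le_x)
  define S1 where "S1 = {((p, r), m). (p, r) \<in> prime_pairs y \<and> z ^ 3 < real (p * r) \<and> 1 \<le> m \<and> real (p * r * m) \<le> x}"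
  have finS: "finite ?S" by (rule finite_subset[OF _ finS0]) (auto simp: S0_def)
  have finS1: "finite S1" by (rule finite_subset[OF _ finS0]) (auto simp: S0_def S1_def)
  have s1: "{s \<in> ?S. real (fst (fst s) * snd (fst s)) \<le> z ^ 3} = {((p, r), m). (p, r) \<in> prime_pairs y \<and> real (p * r) \<le> z ^ 3 \<and> 1 \<le> m \<and>
     y_smooth (real r) m \<and> real (p * r * m) \<le> x}" by auto
  have s2: "{s \<in> ?S. \<not> real (fst (fst s) * snd (fst s)) \<le> z ^ 3} = {s \<in> S1. y_smooth (real (snd (fst s))) (snd s)}"
    by (auto simp: S1_def)
  have s3: "{s \<in> S1. \<not> y_smooth (real (snd (fst s))) (snd s)} = {((p, r), m). (p, r) \<in> prime_pairs y \<and> z ^ 3 < real (p * r) \<and> 1 \<le> m \<and>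
     real (p * r * m) \<le> x \<and> \<not> y_smooth (real r) m}" by (auto simp: S1_def)
  have n1: "norm (sum ?g S1) \<le> E" unfolding S1_def by (rule two_primes_type_I)
  have n2: "norm (sum ?g {s \<in> S1. \<not> y_smooth (real (snd (fst s))) (snd s)}) \<le> E"
    unfolding s3 by (rule two_primes_rough)
  have n3: "norm (sum ?g {s \<in> ?S. \<not> real (fst (fst s) * snd (fst s)) \<le> z ^ 3}) \<le> E + E"
    unfolding s2 by (rule norm_sum_diff[OF finS1 n1 n2])
  have n4: "norm (sum ?g {s \<in> ?S. real (fst (fst s) * snd (fst s)) \<le> z ^ 3}) \<le> E"
    unfolding s1 by (rule two_primes_type_II)
  show ?thesis using norm_sum_split[OF finS n4 n3] by simp
qed

end

lemma primes_ge_le: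
  assumes "primes_ge p k" "1 < k"
  shows "p \<le> k"
proof -
  obtain r where r: "prime r" "r dvd k" using prime_factor_nat[of k] assms(2) by auto
  then have "r \<le> k" using assms(2) by (intro dvd_imp_le) auto
  then show ?thesis using assms(1) r unfolding primes_ge_def by (meson order_trans)
qed

lemma rough_mult_iff:
  assumes "prime p" "primes_ge p k"
  shows "rough z (p * k) \<longleftrightarrow> z < real p"
proof
  assume "z < real p"
  moreover have "real p \<le> real r" if "prime r" "r dvd p * k" for r
  proof -
    have "r dvd p \<or> r dvd k" using that by (simp add: prime_dvd_mult_iff)
    then have "p \<le> r" using assms that(1) primes_dvd_imp_eq[of r p] unfolding primes_ge_def by auto
    then show ?thesis by simp
  qed
  ultimately show "rough z (p * k)" unfolding rough_def by (meson order.strict_trans2)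
qed (use assms in \<open>auto simp: rough_def\<close>)

lemma y_smooth_mult_iff:
  assumes "prime p" "y_smooth p k"
  shows "y_smooth y (p * k) \<longleftrightarrow> real p \<le> y"
proof
  assume "real p \<le> y"
  moreover have "real r \<le> real p" if "prime r" "r dvd p * k" for r
  proof -
    have "r dvd p \<or> r dvd k" using that by (simp add: prime_dvd_mult_iff)
    then show ?thesis using assms that(1) primes_dvd_imp_eq[of r p] unfolding y_smooth_def by auto
  qed
  ultimately show "y_smooth y (p * k)" unfolding y_smooth_def by (meson order_trans)
qed (use assms in \<open>auto simp: y_smooth_def\<close>)

section \<open>Primes beyond \<open>z ^ 4\<close>: sieving up to \<open>z\<close> and removing
  composites\<close>

context fifth_root_setting
begin

lemma finite_triples:
  "finite {((m, p), k). 1 \<le> m \<and> 1 \<le> p \<and> 1 \<le> k \<and> real (m * p * k) \<le> x}" (is "finite ?S")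
proof (rule finite_subset)
  show "?S \<subseteq> ({n. real n \<le> x} \<times> {n. real n \<le> x}) \<times> {n. real n \<le> x}"
  proof
    fix s assume s: "s \<in> ?S"
    obtain m p k where s': "s = ((m, p), k)" by (metis prod.exhaust)
    have t: "1 \<le> m" "1 \<le> p" "1 \<le> k" "real (m * p * k) \<le> x" using s by (auto simp: s')
    have "real m \<le> x" "real p \<le> x" "real k \<le> x"
      by (rule real_le_of_dvd[OF _ _ t(4)]; use t(1-3) in auto)+
    then show "s \<in> ({n. real n \<le> x} \<times> {n. real n \<le> x}) \<times> {n. real n \<le> x}" by (simp add: s')
  qed
qed (simp add: nat_le_x)

lemma cofactor_le:
  assumes "real (m * k) \<le> x" "z ^ 4 < real k"
  shows "real m \<le> z"
proof (rule ccontr)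
  assume "\<not> real m \<le> z"
  then have "z * z ^ 4 < real m * real k" using assms(2) z_powers(1) by (intro mult_strict_mono) auto
  then show False using assms(1) z_pow by (simp add: eval_nat_numeral)
qed

text \<open>To reach the primes beyond \<open>z ^ 4\<close>, \<open>k\<close> is at first only
  sieved up to \<open>z\<close>. The cofactor satisfies \<open>m \<le> z\<close> and serves as one
  bounded variable; the other is trivial.\<close>

lemma large_rough:
  assumes "1 \<le> y"
  shows "norm (\<Sum>(m, k)\<in>{(m, k). rough z k \<and> z ^ 4 < real k \<and> real k \<le> y \<and> 1 \<le> m \<and> real (m * k) \<le> x}. e (m * k)) \<le> E"
    (is "norm (sum ?g ?S) \<le> E")
proof -
  define A where "A = {m :: nat. 1 \<le> m \<and> real m \<le> z}"
  define c1 :: "(nat, unit) cond" where "c1 = (\<lambda>_. 1 / z ^ 4, \<lambda>_. 1, 1, False)"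
  define c2 :: "(nat, unit) cond" where "c2 = (\<lambda>_. 1 / y, \<lambda>_. 1, 1, True)"
  have fA: "fibres_le A (\<lambda>n. n) (real G ^ 0)" using fibres_le_nat[of A] z_le by (auto simp: A_def)
  have fu: "fibres_le {()} (\<lambda>_. 1 :: nat) 1" by (rule fibres_le_inj) auto
  let ?T = "{(a, b, k). a \<in> A \<and> b \<in> {()} \<and> 1 \<le> k \<and> rough z k \<and> real (a * 1 * k) \<le> x \<and>
      (\<forall>d\<in>set [c1, c2]. holds d a b k)}"
  have bound: "norm (\<Sum>(a, b, k)\<in>?T. e (a * 1 * k)) \<le> E"
  proof (rule rough_sum_E[OF fA fu])
    show "pos_cond A {()} d" if "d \<in> set [c1, c2]" for d
      using that z_powers(1) assms by (auto simp: pos_cond_def c1_def c2_def)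
  qed (use z_le z_ge_1 in \<open>auto simp: A_def\<close>)
  have conds: "(\<forall>d\<in>set [c1, c2]. holds d a b k) \<longleftrightarrow> z ^ 4 < real k \<and> real k \<le> y" for a b k
    using z_powers(1) assms by (auto simp: holds_def c1_def c2_def field_simps)
  have "sum ?g ?S = (\<Sum>(a, b, k)\<in>?T. e (a * 1 * k))"
  proof (rule sum.reindex_bij_witness[of _ "\<lambda>(a, b, k). (a, k)" "\<lambda>(a, k). (a, (), k)"])
    fix s assume s: "s \<in> ?S"
    obtain m k where s': "s = (m, k)" by (cases s)
    have "real m \<le> z" by (rule cofactor_le) (use s in \<open>auto simp: s'\<close>)
    moreover have "1 \<le> k" using s z_powers(1) by (auto simp: s' Suc_le_eq intro: gr0I)
    ultimately show "(case s of (a, k) \<Rightarrow> (a, (), k)) \<in> ?T" using s unfolding conds by (simp add: s' A_def)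
  next
    fix s assume "s \<in> ?T"
    then show "(case s of (a, b, k) \<Rightarrow> (a, k)) \<in> ?S" unfolding conds by (auto simp: A_def)
  qed auto
  then show ?thesis using bound by simp
qed

text \<open>Here \<open>p\<close> is the least prime factor of the composite rough number
  \<open>p * k\<close>. Since \<open>k \<ge> p > z ^ 2\<close> and \<open>p * k \<le> z ^ 5\<close>,
  also \<open>p \<le> z ^ 3\<close>, so \<open>p\<close> is in type II position.\<close>

lemma composite_least_large:
  assumes "1 \<le> y"
  shows "norm (\<Sum>((m, p), k)\<in>{((m, p), k). 1 \<le> m \<and> prime p \<and> primes_ge p k \<and> z ^ 2 < real p \<and> 1 < k \<and>
      z ^ 4 < real (p * k) \<and> real (p * k) \<le> y \<and> real (m * p * k) \<le> x}. e (m * p * k)) \<le> E"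
    (is "norm (sum ?g ?S) \<le> E")
proof -
  define A where "A = {p. prime p \<and> z ^ 2 < real p \<and> real p \<le> z ^ 3}"
  define B where "B = {(m :: nat, k). 1 \<le> m \<and> 1 < k \<and> real (m * k) \<le> x}"
  let ?R1 = "\<lambda>p r. primes_ge p (snd r)" and ?R2 = "\<lambda>p r. z ^ 4 < real (p * snd r)"
    and ?R3 = "\<lambda>p r. real (p * snd r) \<le> y"
  let ?w = "\<lambda>(m, k). m * k"
  have fA: "fibres_le A (\<lambda>n. n) (real G ^ 0)" using fibres_le_nat[of A] z_le by (auto simp: A_def)
  have fB: "fibres_le B ?w (real G ^ 1)" by (rule fibres_le_nat_pair) (auto simp: B_def)
  have finA: "finite A" using fA unfolding fibres_le_def by simp
  let ?T = "{(a, b) \<in> A \<times> B. real (a * ?w b) \<le> x \<and> (\<forall>R\<in>set [?R1, ?R2, ?R3]. R a b)}"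
  have bound: "norm (\<Sum>(a, b)\<in>?T. e (a * ?w b)) \<le> E"
  proof (rule type_II_middle[OF fA fB])
    have "chain_rel A B ?R1" by (rule chain_rel_primes_ge[OF finA]) auto
    moreover have "chain_rel A B ?R2"
      by (rule chain_rel_prodI[where f = "\<lambda>p. real p / z ^ 4" and h = "\<lambda>r. real (snd r)" and s = False])
         (use z_powers(1) in \<open>auto simp: A_def field_simps prime_gt_0_nat\<close>)
    moreover have "chain_rel A B ?R3"
      by (rule chain_rel_prodI[where f = "\<lambda>p. real p / y" and h = "\<lambda>r. real (snd r)" and s = True])
         (use assms in \<open>auto simp: A_def field_simps prime_gt_0_nat\<close>)
    ultimately show "chain_rel A B R" if "R \<in> set [?R1, ?R2, ?R3]" for R using that by auto
  qed (auto simp: A_def B_def)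
  have "sum ?g ?S = (\<Sum>(a, b)\<in>?T. e (a * ?w b))"
  proof (rule sum.reindex_bij_witness[of _ "\<lambda>(p, (m, k)). ((m, p), k)" "\<lambda>((m, p), k). (p, (m, k))"])
    fix s assume s: "s \<in> ?S"
    obtain m p k where s': "s = ((m, p), k)" by (metis prod.exhaust)
    have t: "1 \<le> m" "prime p" "primes_ge p k" "z ^ 2 < real p" "1 < k" "z ^ 4 < real (p * k)" "real (p * k) \<le> y" "real (m * p * k) \<le> x"
      using s by (auto simp: s')
    have "real (m * k) \<le> x" by (rule real_le_of_dvd[OF _ _ t(8)]) (use t in \<open>auto simp: prime_gt_0_nat\<close>)
    moreover have "real p \<le> z ^ 3"
    proof (rule ccontr)
      assume "\<not> real p \<le> z ^ 3"
      moreover have "real p \<le> real k" using primes_ge_le[OF t(3,5)] by simp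
      ultimately have "z ^ 3 * z ^ 2 < real p * real k" using t(4) z_powers(1) prime_gt_0_nat[OF t(2)] by (intro mult_strict_mono) auto
      moreover have "real (p * k) \<le> x" by (rule real_le_of_dvd[OF _ _ t(8)]) (use t in \<open>auto simp: prime_gt_0_nat\<close>)
      ultimately show False using z_pow by (simp add: power_add[symmetric])
    qed
    ultimately show "(\<lambda>((m, p), k). (p, (m, k))) s \<in> ?T" using t by (simp add: s' A_def B_def mult_ac)
  next
    fix s assume "s \<in> ?T"
    then show "(\<lambda>(p, (m, k)). ((m, p), k)) s \<in> ?S" by (auto simp: A_def B_def mult_ac)
  qed (auto simp: mult_ac)
  then show ?thesis using bound by simp
qed

text \<open>From \<open>p \<le> z ^ 2\<close> and \<open>p * k > z ^ 4\<close> follows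
  \<open>k > z ^ 2\<close>, so now \<open>k\<close> occupies the type II range. Accordingly the
  variables trade places, and \<open>chain_rel_flip\<close> adapts the condition on prime
  factors.\<close>

lemma composite_cofactor_middle:
  assumes "1 \<le> y"
  shows "norm (\<Sum>((m, p), k)\<in>{((m, p), k). 1 \<le> m \<and> prime p \<and> primes_ge p k \<and> z < real p \<and> real p \<le> z ^ 2 \<and> 1 < k \<and>
      real k \<le> z ^ 3 \<and> z ^ 4 < real (p * k) \<and> real (p * k) \<le> y \<and> real (m * p * k) \<le> x}. e (m * p * k)) \<le> E"
    (is "norm (sum ?g ?S) \<le> E")
proof -
  define A where "A = {k :: nat. z ^ 2 < real k \<and> real k \<le> z ^ 3}"
  define B where "B = {(m :: nat, p). 1 \<le> m \<and> prime p \<and> z < real p \<and> real p \<le> z ^ 2 \<and> real (m * p) \<le> x}"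
  let ?R1 = "\<lambda>k r. primes_ge (snd r) k" and ?R2 = "\<lambda>k r. z ^ 4 < real (snd r * k)"
    and ?R3 = "\<lambda>k r. real (snd r * k) \<le> y"
  let ?w = "\<lambda>(m, p). m * p"
  have fA: "fibres_le A (\<lambda>n. n) (real G ^ 0)" using fibres_le_nat[of A] z_le by (auto simp: A_def)
  have fB: "fibres_le B ?w (real G ^ 1)" by (rule fibres_le_nat_pair) (auto simp: B_def prime_gt_0_nat Suc_le_eq)
  have finB: "finite B" using fB unfolding fibres_le_def by simp
  have posA: "real k > 0" if "k \<in> A" for k
  proof -
    have "z ^ 2 < real k" using that by (simp add: A_def)
    then show ?thesis using z_powers(7) by linarith
  qed
  let ?T = "{(a, b) \<in> A \<times> B. real (a * ?w b) \<le> x \<and> (\<forall>R\<in>set [?R1, ?R2, ?R3]. R a b)}"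
  have bound: "norm (\<Sum>(a, b)\<in>?T. e (a * ?w b)) \<le> E"
  proof (rule type_II_middle[OF fA fB])
    have "chain_rel B A (\<lambda>r k. primes_ge (snd r) k)" by (rule chain_rel_primes_ge[OF finB]) auto
    from chain_rel_flip[OF this] have "chain_rel A B ?R1" .
    moreover have "chain_rel A B ?R2"
      by (rule chain_rel_prodI[where f = "\<lambda>k. real k / z ^ 4" and h = "\<lambda>r. real (snd r)" and s = False])
         (use z_powers(1) posA in \<open>auto simp: field_simps\<close>)
    moreover have "chain_rel A B ?R3"
      by (rule chain_rel_prodI[where f = "\<lambda>k. real k / y" and h = "\<lambda>r. real (snd r)" and s = True])
         (use assms posA in \<open>auto simp: field_simps\<close>)
    ultimately show "chain_rel A B R" if "R \<in> set [?R1, ?R2, ?R3]" for R using that by auto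
  qed (auto simp: A_def B_def prime_gt_0_nat Suc_le_eq)
  have "sum ?g ?S = (\<Sum>(a, b)\<in>?T. e (a * ?w b))"
  proof (rule sum.reindex_bij_witness[of _ "\<lambda>(k, r). (r, k)" "\<lambda>(r, k). (k, r)"])
    fix s assume s: "s \<in> ?S"
    obtain m p k where s': "s = ((m, p), k)" by (metis prod.exhaust)
    have t: "1 \<le> m" "prime p" "primes_ge p k" "z < real p" "real p \<le> z ^ 2" "1 < k" "real k \<le> z ^ 3" "z ^ 4 < real (p * k)" "real (p * k) \<le> y" "real (m * p * k) \<le> x"
      using s by (auto simp: s')
    have "real (m * p) \<le> x" by (rule real_le_of_dvd[OF _ _ t(10)]) (use t in \<open>auto simp: prime_gt_0_nat\<close>)
    moreover have "z ^ 2 < real k"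
    proof (rule ccontr)
      assume "\<not> z ^ 2 < real k"
      then have "real p * real k \<le> z ^ 2 * z ^ 2" using t(5) by (intro mult_mono) auto
      then show False using t(8) by (simp add: power_add[symmetric])
    qed
    ultimately show "(case s of (r, k) \<Rightarrow> (k, r)) \<in> ?T" using t by (simp add: s' A_def B_def mult_ac)
  next
    fix s assume s: "s \<in> ?T"
    obtain k m p where s': "s = (k, (m, p))" by (metis prod.exhaust)
    have "1 ^ 2 \<le> z ^ 2" using z_ge_1 by (intro power_mono) auto
    then have "1 < k" using s by (auto simp: s' A_def)
    then show "(case s of (k, r) \<Rightarrow> (r, k)) \<in> ?S" using s by (auto simp: s' A_def B_def mult_ac)
  qed (auto simp: mult_ac)
  then show ?thesis using bound by simp
qed

text \<open>The case left over by the two previous estimates, with \<open>primes_ge p k\<close>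
  relaxed to \<open>rough z k\<close>: a sieve at the fixed level \<open>z\<close> instead of one
  that varies with \<open>p\<close>.\<close>

definition sieved_triples :: "real \<Rightarrow> ((nat \<times> nat) \<times> nat) set" where
  "sieved_triples y = {((m, p), k). 1 \<le> m \<and> prime p \<and> z < real p \<and> real p \<le> z ^ 2 \<and> rough z k \<and> z ^ 3 < real k \<and>
     z ^ 4 < real (p * k) \<and> real (p * k) \<le> y \<and> real (m * p * k) \<le> x}"

lemma small_pair_bounds:
  assumes "1 \<le> (m::nat)" "real m \<le> z" "prime (p::nat)" "real p \<le> z ^ 2"
  shows "1 \<le> m \<and> 1 \<le> p \<and> real (m * p) \<le> z ^ 3"
proof -
  have "real m * real p \<le> z * z ^ 2" using assms z_powers(1) by (intro mult_mono) auto
  then show ?thesis using assms by (auto simp: prime_gt_0_nat Suc_le_eq eval_nat_numeral)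
qed

text \<open>The size of \<open>p * k\<close> forces \<open>m \<le> z\<close>, so
  \<open>m * p \<le> z ^ 3\<close> can be the bounded variable, with \<open>k\<close>
  sieved.\<close>

lemma composite_rough:
  assumes "1 \<le> y"
  shows "norm (\<Sum>((m, p), k)\<in>sieved_triples y. e (m * p * k)) \<le> E"
    (is "norm (sum ?g ?S) \<le> E")
proof -
  define A where "A = {(m :: nat, p). 1 \<le> m \<and> real m \<le> z \<and> prime p \<and> z < real p \<and> real p \<le> z ^ 2}"
  define c1 :: "(nat \<times> nat, unit) cond" where "c1 = (\<lambda>_. 1 / z ^ 3, \<lambda>_. 1, 1, False)"
  define c2 :: "(nat \<times> nat, unit) cond" where "c2 = (\<lambda>a. real (snd a) / z ^ 4, \<lambda>_. 1, 1, False)"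
  define c3 :: "(nat \<times> nat, unit) cond" where "c3 = (\<lambda>a. real (snd a) / y, \<lambda>_. 1, 1, True)"
  let ?v = "\<lambda>(m, p). m * p"
  have bA: "1 \<le> m \<and> 1 \<le> p \<and> real (m * p) \<le> z ^ 3" if "(m, p) \<in> A" for m p
    using small_pair_bounds[of m p] that by (auto simp: A_def)
  have fA: "fibres_le A ?v (real G ^ 1)" by (rule fibres_le_nat_pair) (use bA z_le(4) in force)
  have fu: "fibres_le {()} (\<lambda>_. 1 :: nat) 1" by (rule fibres_le_inj) auto
  have posA: "0 < real (snd a)" if "a \<in> A" for a using that by (auto simp: A_def prime_gt_0_nat)
  let ?T = "{(a, b, k). a \<in> A \<and> b \<in> {()} \<and> 1 \<le> k \<and> rough z k \<and> real (?v a * 1 * k) \<le> x \<and>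
      (\<forall>d\<in>set [c1, c2, c3]. holds d a b k)}"
  have bound: "norm (\<Sum>(a, b, k)\<in>?T. e (?v a * 1 * k)) \<le> E"
  proof (rule rough_sum_E[OF fA fu])
    show "pos_cond A {()} d" if "d \<in> set [c1, c2, c3]" for d
      using that z_powers(1) assms posA by (auto simp: pos_cond_def c1_def c2_def c3_def)
  qed (use bA z_le z_ge_1 in auto)
  have conds: "(\<forall>d\<in>set [c1, c2, c3]. holds d a b k) \<longleftrightarrow>
      z ^ 3 < real k \<and> z ^ 4 < real (snd a * k) \<and> real (snd a * k) \<le> y" for a b k
    using z_powers(1) assms by (auto simp: holds_def c1_def c2_def c3_def field_simps)
  have "sum ?g ?S = (\<Sum>(a, b, k)\<in>?T. e (?v a * 1 * k))"
  proof (rule sum.reindex_bij_witness[of _ "\<lambda>(a, b, k). (a, k)" "\<lambda>(a, k). (a, (), k)"])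
    fix s assume s: "s \<in> ?S"
    obtain m p k where s': "s = ((m, p), k)" by (metis prod.exhaust)
    have "real m \<le> z" by (rule cofactor_le[of m "p * k"]) (use s in \<open>auto simp: s' sieved_triples_def mult.assoc\<close>)
    moreover have "1 \<le> k" using s z_powers(6) by (auto simp: s' sieved_triples_def Suc_le_eq intro: gr0I)
    ultimately show "(case s of (a, k) \<Rightarrow> (a, (), k)) \<in> ?T" using s unfolding conds
      by (simp add: s' A_def sieved_triples_def)
  next
    fix s assume "s \<in> ?T"
    then show "(case s of (a, b, k) \<Rightarrow> (a, k)) \<in> ?S" unfolding conds by (auto simp: A_def sieved_triples_def)
  qed auto
  then show ?thesis using bound by simp
qed

text \<open>What the relaxation counts in excess: the sieved number is now \<open>r * k\<close>,
  where \<open>r\<close> is its least prime factor and is smaller than \<open>p\<close>.\<close>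

definition least_two_primes :: "real \<Rightarrow> ((nat \<times> nat) \<times> nat \<times> nat) set" where
  "least_two_primes y = {((m, p), r, k). 1 \<le> m \<and> prime p \<and> prime r \<and> z < real r \<and> r < p \<and> real p \<le> z ^ 2 \<and>
     primes_ge r k \<and> z ^ 3 < real (r * k) \<and> z ^ 4 < real (p * (r * k)) \<and> real (p * (r * k)) \<le> y \<and>
     real (m * p * (r * k)) \<le> x}"

text \<open>Two primes above \<open>z\<close> have a product above \<open>z ^ 2\<close>, so the pair
  \<open>(p, r)\<close> is in type II position.\<close>

lemma least_two_primes_type_II:
  assumes "1 \<le> y"
  shows "norm (\<Sum>((m, p), r, k)\<in>{((m, p), r, k) \<in> least_two_primes y. real (p * r) \<le> z ^ 3}. e (m * p * (r * k))) \<le> E"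
    (is "norm (sum ?g ?S) \<le> E")
proof -
  define A where "A = {(p, r). prime p \<and> prime r \<and> z < real r \<and> r < p \<and> real p \<le> z ^ 2 \<and> real (p * r) \<le> z ^ 3}"
  define B where "B = {(m :: nat, k :: nat). 1 \<le> m \<and> 1 \<le> k \<and> real (m * k) \<le> x}"
  let ?R1 = "\<lambda>a b. primes_ge (snd a) (snd b)" and ?R2 = "\<lambda>a b. z ^ 3 < real (snd a * snd b)"
    and ?R3 = "\<lambda>a b. z ^ 4 < real (fst a * (snd a * snd b))" and ?R4 = "\<lambda>a b. real (fst a * (snd a * snd b)) \<le> y"
  let ?v = "\<lambda>(p, r). p * r"
  have bA: "1 \<le> p \<and> 1 \<le> r \<and> real (p * r) \<le> x \<and> z ^ 2 < real (p * r)" if "(p, r) \<in> A" for p r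
  proof -
    have "z * z < real p * real r" using that z_powers(1) by (intro mult_strict_mono) (auto simp: A_def)
    then show ?thesis using that z_le(4) by (auto simp: A_def prime_gt_0_nat Suc_le_eq power2_eq_square)
  qed
  have fA: "fibres_le A ?v (real G ^ 1)" by (rule fibres_le_nat_pair) (use bA in blast)
  have fB: "fibres_le B ?v (real G ^ 1)" by (rule fibres_le_nat_pair) (auto simp: B_def)
  have finA: "finite A" using fA unfolding fibres_le_def by simp
  have posA: "0 < real (fst a)" "0 < real (snd a)" if "a \<in> A" for a using that by (auto simp: A_def prime_gt_0_nat)
  let ?T = "{(a, b) \<in> A \<times> B. real (?v a * ?v b) \<le> x \<and> (\<forall>R\<in>set [?R1, ?R2, ?R3, ?R4]. R a b)}"
  have bound: "norm (\<Sum>(a, b)\<in>?T. e (?v a * ?v b)) \<le> E"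
  proof (rule type_II_middle[OF fA fB])
    have "chain_rel A B ?R1" by (rule chain_rel_primes_ge[OF finA]) auto
    moreover have "chain_rel A B ?R2"
      by (rule chain_rel_prodI[where f = "\<lambda>a. real (snd a) / z ^ 3" and h = "\<lambda>b. real (snd b)" and s = False])
         (use z_powers(1) posA in \<open>auto simp: field_simps\<close>)
    moreover have "chain_rel A B ?R3"
      by (rule chain_rel_prodI[where f = "\<lambda>a. real (fst a) * real (snd a) / z ^ 4" and h = "\<lambda>b. real (snd b)" and s = False])
         (use z_powers(1) posA in \<open>auto simp: field_simps\<close>)
    moreover have "chain_rel A B ?R4"
      by (rule chain_rel_prodI[where f = "\<lambda>a. real (fst a) * real (snd a) / y" and h = "\<lambda>b. real (snd b)" and s = True])
         (use assms posA in \<open>auto simp: field_simps\<close>)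
    ultimately show "chain_rel A B R" if "R \<in> set [?R1, ?R2, ?R3, ?R4]" for R using that by auto
    show "z ^ 2 < real (?v a) \<and> real (?v a) \<le> z ^ 3" if "a \<in> A" for a
      using that bA[of "fst a" "snd a"] by (cases a) (auto simp: A_def)
  qed (auto simp: B_def)
  have "sum ?g ?S = (\<Sum>(a, b)\<in>?T. e (?v a * ?v b))"
  proof (rule sum.reindex_bij_witness[of _ "\<lambda>((p, r), (m, k)). ((m, p), r, k)" "\<lambda>((m, p), r, k). ((p, r), (m, k))"])
    fix s assume s: "s \<in> ?S"
    obtain m p r k where s': "s = ((m, p), r, k)" by (metis prod.exhaust)
    have t: "1 \<le> m" "prime p" "prime r" "z < real r" "r < p" "real p \<le> z ^ 2" "primes_ge r k" "z ^ 3 < real (r * k)"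
      "z ^ 4 < real (p * (r * k))" "real (p * (r * k)) \<le> y" "real (m * p * (r * k)) \<le> x" "real (p * r) \<le> z ^ 3"
      using s by (auto simp: s' least_two_primes_def)
    have k1: "1 \<le> k" using t(8) z_powers(6) by (cases k) auto
    have "real (m * k) \<le> x" by (rule real_le_of_dvd[OF _ _ t(11)]) (use t(1-3) k1 in \<open>auto simp: prime_gt_0_nat mult_dvd_mono\<close>)
    then show "(\<lambda>((m, p), r, k). ((p, r), (m, k))) s \<in> ?T" using t k1 by (simp add: s' A_def B_def mult_ac)
  next
    fix s assume "s \<in> ?T"
    then show "(\<lambda>((p, r), (m, k)). ((m, p), r, k)) s \<in> ?S" by (auto simp: A_def B_def least_two_primes_def mult_ac)
  qed (auto simp: mult_ac)
  then show ?thesis using bound by simp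
qed

text \<open>If \<open>p * r > z ^ 3\<close>, then \<open>k < z ^ 2\<close>, and a
  \<open>z\<close>-rough \<open>k\<close> of this size is prime. So \<open>primes_ge r k\<close>,
  whose level varies with \<open>r\<close>, can be replaced by \<open>rough z k\<close> and
  \<open>r \<le> k\<close>, which the sieved sums can express.\<close>

lemma least_two_primes_rough:
  assumes "1 \<le> y"
  shows "norm (\<Sum>((m, p), r, k)\<in>{((m, p), r, k) \<in> least_two_primes y. \<not> real (p * r) \<le> z ^ 3}. e (m * p * (r * k))) \<le> E"
    (is "norm (sum ?g ?S) \<le> E")
proof -
  define A where "A = {(m :: nat, p). 1 \<le> m \<and> real m \<le> z \<and> prime p \<and> z < real p \<and> real p \<le> z ^ 2}"
  define B where "B = {r. prime r \<and> z < real r \<and> real r \<le> z ^ 2}"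
  define c1 :: "(nat \<times> nat, nat) cond" where "c1 = (\<lambda>a. real (snd a) / z ^ 3, \<lambda>r. real r, 0, False)"
  define c2 :: "(nat \<times> nat, nat) cond" where "c2 = (\<lambda>a. real (snd a), \<lambda>r. 1 / real r, 0, False)"
  \<comment> \<open>A lower bound for \<open>k\<close> is available only as a negated and hence
    strict inequality; as \<open>r\<close> and \<open>k\<close> are integers,
    \<open>k > r - 1 / 2\<close> expresses \<open>r \<le> k\<close>.\<close>
  define c3 :: "(nat \<times> nat, nat) cond" where "c3 = (\<lambda>a. 1, \<lambda>r. 1 / (real r - 1 / 2), 1, False)"
  define c4 :: "(nat \<times> nat, nat) cond" where "c4 = (\<lambda>a. 1 / z ^ 3, \<lambda>r. real r, 1, False)"
  define c5 :: "(nat \<times> nat, nat) cond" where "c5 = (\<lambda>a. real (snd a) / z ^ 4, \<lambda>r. real r, 1, False)"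
  define c6 :: "(nat \<times> nat, nat) cond" where "c6 = (\<lambda>a. real (snd a) / y, \<lambda>r. real r, 1, True)"
  let ?v = "\<lambda>(m, p). m * p"
  have bA: "1 \<le> m \<and> 1 \<le> p \<and> real (m * p) \<le> z ^ 3" if "(m, p) \<in> A" for m p
    using small_pair_bounds[of m p] that by (auto simp: A_def)
  have fA: "fibres_le A ?v (real G ^ 1)" by (rule fibres_le_nat_pair) (use bA z_le(4) in force)
  have fB: "fibres_le B (\<lambda>n. n) 1" by (rule fibres_le_nat) (use z_le(6) in \<open>auto simp: B_def\<close>)
  have posA: "0 < real (snd a)" if "a \<in> A" for a using that by (auto simp: A_def prime_gt_0_nat)
  have posB: "1 \<le> real r" if "r \<in> B" for r using that prime_ge_1_nat[of r] by (auto simp: B_def)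
  let ?cs = "[c1, c2, c3, c4, c5, c6]"
  let ?T = "{(a, b, k). a \<in> A \<and> b \<in> B \<and> 1 \<le> k \<and> rough z k \<and> real (?v a * b * k) \<le> x \<and>
      (\<forall>d\<in>set ?cs. holds d a b k)}"
  have bound: "norm (\<Sum>(a, b, k)\<in>?T. e (?v a * b * k)) \<le> E"
  proof (rule rough_sum_E[OF fA fB])
    show "pos_cond A B d" if "d \<in> set ?cs" for d
    proof -
      have "0 \<le> real r - 1 / 2" if "r \<in> B" for r using posB[OF that] by simp
      then show ?thesis using that z_powers(1) assms posA
        by (auto simp: pos_cond_def c1_def c2_def c3_def c4_def c5_def c6_def)
    qed
  qed (use bA in \<open>auto simp: B_def prime_gt_0_nat Suc_le_eq\<close>)
  have conds: "(\<forall>d\<in>set ?cs. holds d a r k) \<longleftrightarrow>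
      z ^ 3 < real (snd a * r) \<and> r < snd a \<and> r \<le> k \<and> z ^ 3 < real (r * k) \<and> z ^ 4 < real (snd a * (r * k)) \<and> real (snd a * (r * k)) \<le> y"
    if "a \<in> A" "r \<in> B" for a r k
  proof -
    note p = posB[OF that(2)] z_powers(1) assms
    have 1: "holds c1 a r k \<longleftrightarrow> z ^ 3 < real (snd a * r)" using p by (simp add: holds_def c1_def field_simps not_le)
    have 2: "holds c2 a r k \<longleftrightarrow> r < snd a" using p by (simp add: holds_def c2_def field_simps not_le)
    have "holds c3 a r k \<longleftrightarrow> \<not> real k / (real r - 1 / 2) \<le> 1" by (simp add: holds_def c3_def)
    also have "\<dots> \<longleftrightarrow> \<not> real k \<le> real r - 1 / 2" using p by (subst divide_le_eq_1_pos) auto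
    also have "\<dots> \<longleftrightarrow> r \<le> k" by linarith
    finally have 3: "holds c3 a r k \<longleftrightarrow> r \<le> k" .
    have 4: "holds c4 a r k \<longleftrightarrow> z ^ 3 < real (r * k)" using p by (simp add: holds_def c4_def field_simps not_le)
    have 5: "holds c5 a r k \<longleftrightarrow> z ^ 4 < real (snd a * (r * k))" using p by (simp add: holds_def c5_def field_simps not_le)
    have 6: "holds c6 a r k \<longleftrightarrow> real (snd a * (r * k)) \<le> y" using p by (simp add: holds_def c6_def field_simps)
    show ?thesis using 1 2 3 4 5 6 by simp
  qed
  have "?T = ?S"
  proof (intro equalityI subsetI)
    fix s assume s: "s \<in> ?T"
    obtain m p r k where s': "s = ((m, p), r, k)" by (metis prod.exhaust)
    have t: "(m, p) \<in> A" "r \<in> B" "1 \<le> k" "rough z k" "real (m * p * r * k) \<le> x" and "\<forall>d\<in>set ?cs. holds d (m, p) r k"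
      using s by (auto simp: s')
    then have c: "z ^ 3 < real (p * r)" "r < p" "r \<le> k" "z ^ 3 < real (r * k)" "z ^ 4 < real (p * (r * k))" "real (p * (r * k)) \<le> y"
      using conds[OF t(1,2)] by auto
    have "real (p * r) * real k * 1 \<le> real (p * r) * real k * real m"
      using bA[OF t(1)] by (intro mult_left_mono) auto
    also have "\<dots> \<le> x" using t(5) by (simp add: mult_ac)
    finally have a: "real (p * r) * real k \<le> z ^ 5" using z_pow by simp
    have zk: "z < real k" using t(2) c(3) by (auto simp: B_def)
    have "z ^ 3 * real k < real (p * r) * real k" using c(1) zk z_powers(1) by (intro mult_strict_right_mono) auto
    then have "z ^ 3 * real k < z ^ 3 * z ^ 2" using a by (simp add: power_add[symmetric])
    then have "real k < z ^ 2" by (rule mult_left_less_imp_less) (rule z_powers(6))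
    moreover have "1 < k" using zk z_ge_1 by linarith
    ultimately have "prime k" using rough_less_square_prime[OF z_powers(1) _ t(4)] by blast
    then have "primes_ge r k" unfolding primes_ge_def using c(3) by (auto dest: primes_dvd_imp_eq)
    then show "s \<in> ?S" using t c by (auto simp: s' least_two_primes_def A_def B_def mult_ac)
  next
    fix s assume s: "s \<in> ?S"
    obtain m p r k where s': "s = ((m, p), r, k)" by (metis prod.exhaust)
    have t: "1 \<le> m" "prime p" "prime r" "z < real r" "r < p" "real p \<le> z ^ 2" "primes_ge r k" "z ^ 3 < real (r * k)"
      "z ^ 4 < real (p * (r * k))" "real (p * (r * k)) \<le> y" "real (m * p * (r * k)) \<le> x" "z ^ 3 < real (p * r)"
      using s by (auto simp: s' least_two_primes_def)
    \<comment> \<open>\<open>r < p \<le> z ^ 2 \<le> z ^ 3\<close> excludes \<open>k \<le> 1\<close>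
      in \<open>r * k > z ^ 3\<close>.\<close>
    have k1: "1 < k"
    proof (rule ccontr)
      assume "\<not> 1 < k"
      then have "real (r * k) \<le> real r" by (cases k) auto
      then show False using t(5,6,8) z_le(2) by linarith
    qed
    have "real m \<le> z" by (rule cofactor_le[of m "p * (r * k)"]) (use t in \<open>auto simp: mult.assoc\<close>)
    then have "(m, p) \<in> A" "r \<in> B" using t by (auto simp: A_def B_def)
    moreover have "r \<le> k" using primes_ge_le[OF t(7) k1] .
    moreover have "rough z k" using t(4,7) unfolding rough_def primes_ge_def by (meson of_nat_le_iff order.strict_trans2)
    ultimately show "s \<in> ?T" using t k1 conds[of "(m, p)" r k] by (simp add: s' mult_ac)
  qed
  then have "sum ?g ?S = (\<Sum>(a, b, k)\<in>?T. e (?v a * b * k))"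
    by (intro sum.cong) (auto simp: mult_ac)
  then show ?thesis using bound by simp
qed

end

section \<open>Assembly for \<open>y\<close> at least \<open>z\<close>\<close>

context fifth_root_setting
begin

lemma E_nonneg: "0 \<le> E"
  unfolding E_def using Bnd_ge(4)[OF z_powers(6)] by simp

text \<open>\<open>primes_ge p\<close> fails for the sieved number exactly when its least prime
  factor \<open>r\<close> is below \<open>p\<close>. The size of \<open>p * r\<close> then decides
  between \<open>least_two_primes_type_II\<close> and \<open>least_two_primes_rough\<close>.\<close>

lemma least_two_primes_sum:
  assumes "1 \<le> y"
  shows "norm (\<Sum>((m, p), k)\<in>{s \<in> sieved_triples y. \<not> primes_ge (snd (fst s)) (snd s)}. e (m * p * k)) \<le> 2 * E"
    (is "norm (sum ?g ?D) \<le> _")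
proof -
  have gt: "1 < k" if "(c, k) \<in> ?D" for c k
  proof -
    have "1 ^ 3 \<le> z ^ 3" using z_ge_1 by (intro power_mono) auto
    then show ?thesis using that by (cases c) (auto simp: sieved_triples_def)
  qed
  let ?h = "\<lambda>((m, p), r, k). e (m * p * (r * k))"
  have "sum ?g ?D = (\<Sum>(c, k)\<in>?D. (\<lambda>c k. e (fst c * snd c * k)) c k)" by (simp add: case_prod_beta')
  also have "\<dots> = (\<Sum>(c, r, k)\<in>{(c, r, k). prime r \<and> primes_ge r k \<and> (c, r * k) \<in> ?D}. e (fst c * snd c * (r * k)))"
    by (rule sum_split_least[OF gt])
  also have "{(c, r, k). prime r \<and> primes_ge r k \<and> (c, r * k) \<in> ?D} = least_two_primes y"
  proof -
    have eqv: "\<not> primes_ge p (r * k) \<longleftrightarrow> r < p" if r: "prime r" "primes_ge r k" for p r k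
    proof
      assume "r < p"
      then show "\<not> primes_ge p (r * k)" unfolding primes_ge_def using r(1) by (metis dvd_triv_left not_le)
    next
      assume n: "\<not> primes_ge p (r * k)"
      then obtain t where t: "prime t" "t dvd r * k" "t < p" unfolding primes_ge_def by auto
      have "t dvd r \<or> t dvd k" using t by (simp add: prime_dvd_mult_iff)
      then have "r \<le> t" using r t(1) primes_dvd_imp_eq[of t r] unfolding primes_ge_def by auto
      then show "r < p" using t(3) by simp
    qed
    have "primes_ge p (r * k) \<longleftrightarrow> \<not> r < p" if "prime r" "primes_ge r k" for p r k using eqv[OF that, of p] by blast
    then show ?thesis
      by (auto simp: sieved_triples_def least_two_primes_def rough_mult_iff)
  qed
  also have "(\<Sum>(c, r, k)\<in>least_two_primes y. e (fst c * snd c * (r * k))) = sum ?h (least_two_primes y)"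
    by (simp add: case_prod_beta')
  finally have eq: "sum ?g ?D = sum ?h (least_two_primes y)" .
  have fin: "finite (least_two_primes y)"
  proof (rule finite_subset)
    show "least_two_primes y \<subseteq> ({n. real n \<le> x} \<times> {n. real n \<le> x}) \<times> {n. real n \<le> x} \<times> {n. real n \<le> x}"
    proof
      fix s assume s: "s \<in> least_two_primes y"
      obtain m p r k where s': "s = ((m, p), r, k)" by (metis prod.exhaust)
      have t: "1 \<le> m" "prime p" "prime r" "z ^ 3 < real (r * k)" "real (m * p * (r * k)) \<le> x"
        using s by (auto simp: s' least_two_primes_def)
      have k1: "1 \<le> k" using t(4) z_powers(6) by (cases k) auto
      have "real m \<le> x" "real p \<le> x" "real r \<le> x" "real k \<le> x"
        by (rule real_le_of_dvd[OF _ _ t(5)]; use t(1-3) k1 in \<open>auto simp: prime_gt_0_nat\<close>)+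
      then show "s \<in> ({n. real n \<le> x} \<times> {n. real n \<le> x}) \<times> {n. real n \<le> x} \<times> {n. real n \<le> x}" by (simp add: s')
    qed
  qed (simp add: nat_le_x)
  let ?P = "\<lambda>s. real (snd (fst s) * fst (snd s)) \<le> z ^ 3"
  have s1: "{s \<in> least_two_primes y. ?P s} = {((m, p), r, k) \<in> least_two_primes y. real (p * r) \<le> z ^ 3}"
    and s2: "{s \<in> least_two_primes y. \<not> ?P s} = {((m, p), r, k) \<in> least_two_primes y. \<not> real (p * r) \<le> z ^ 3}" by auto
  have "norm (sum ?h (least_two_primes y)) \<le> E + E"
  proof (rule norm_sum_split[OF fin, where P = ?P])
    show "norm (sum ?h {s \<in> least_two_primes y. ?P s}) \<le> E"
      unfolding s1 by (rule least_two_primes_type_II[OF assms])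
    show "norm (sum ?h {s \<in> least_two_primes y. \<not> ?P s}) \<le> E"
      unfolding s2 by (rule least_two_primes_rough[OF assms])
  qed
  then show ?thesis unfolding eq by simp
qed

text \<open>After splitting off the least prime \<open>p\<close>: one \<open>E\<close> for
  \<open>p > z ^ 2\<close>, one for \<open>k \<le> z ^ 3\<close>, one for the relaxed sieve in the
  remaining case, and two for its excess.\<close>

lemma composite_sum:
  assumes "1 \<le> y"
  shows "norm (\<Sum>(m, k)\<in>{(m, k). rough z k \<and> z ^ 4 < real k \<and> real k \<le> y \<and> 1 \<le> m \<and> real (m * k) \<le> x \<and> \<not> prime k}.
     e (m * k)) \<le> 5 * E" (is "norm (sum ?g ?D) \<le> _")
proof -
  have z4: "1 \<le> z ^ 4" using z_ge_1 by (rule one_le_power)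
  have gt: "1 < k" if "(m, k) \<in> ?D" for m k
    using that z4 by auto
  define T where "T = {((m, p), k). 1 \<le> m \<and> prime p \<and> primes_ge p k \<and> z < real p \<and> 1 < k \<and> z ^ 4 < real (p * k) \<and>
     real (p * k) \<le> y \<and> real (m * p * k) \<le> x}"
  let ?h = "\<lambda>((m, p), k). e (m * p * k)"
  have "sum ?g ?D = (\<Sum>(m, p, k)\<in>{(m, p, k). prime p \<and> primes_ge p k \<and> (m, p * k) \<in> ?D}. e (m * (p * k)))"
    by (rule sum_split_least[OF gt])
  also have "\<dots> = sum ?h T"
  proof (rule sum.reindex_bij_witness[of _ "\<lambda>((m, p), k). (m, p, k)" "\<lambda>(m, p, k). ((m, p), k)"])
    fix s assume s: "s \<in> {(m, p, k). prime p \<and> primes_ge p k \<and> (m, p * k) \<in> ?D}"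
    obtain m p k where s': "s = (m, p, k)" by (metis prod.exhaust)
    have t: "prime p" "primes_ge p k" "(m, p * k) \<in> ?D" using s by (auto simp: s')
    have "k \<noteq> 1" using t by auto
    moreover have "k \<noteq> 0" using t(3) z4 by (cases k) auto
    ultimately have "1 < k" by simp
    then show "(\<lambda>(m, p, k). ((m, p), k)) s \<in> T" using t rough_mult_iff[OF t(1,2), of z] by (auto simp: s' T_def mult_ac)
  next
    fix s assume s: "s \<in> T"
    obtain m p k where s': "s = ((m, p), k)" by (metis prod.exhaust)
    have t: "prime p" "primes_ge p k" "1 < k" using s by (auto simp: s' T_def)
    have "\<not> prime (p * k)" using t prime_product[of p k] by auto
    then show "(\<lambda>((m, p), k). (m, p, k)) s \<in> {(m, p, k). prime p \<and> primes_ge p k \<and> (m, p * k) \<in> ?D}"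
      using s rough_mult_iff[OF t(1,2), of z] by (auto simp: s' T_def mult_ac)
  qed (auto simp: mult_ac)
  finally have eq: "sum ?g ?D = sum ?h T" .
  have finT: "finite T"
    by (rule finite_subset[OF _ finite_triples]) (auto simp: T_def prime_gt_0_nat Suc_le_eq)
  let ?P1 = "\<lambda>s. z ^ 2 < real (snd (fst s))" and ?P2 = "\<lambda>s. real (snd s) \<le> z ^ 3"
    and ?P3 = "\<lambda>s. primes_ge (snd (fst s)) (snd s)"
  define T2 where "T2 = {s \<in> T. \<not> ?P1 s}"
  have finT2: "finite T2" unfolding T2_def using finT by simp
  have finS: "finite (sieved_triples y)"
  proof (rule finite_subset[OF _ finite_triples], rule subsetI)
    fix s assume s: "s \<in> sieved_triples y"
    obtain m p k where s': "s = ((m, p), k)" by (metis prod.exhaust)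
    have "1 \<le> k" using s z_powers(6) by (cases k) (auto simp: s' sieved_triples_def)
    then show "s \<in> {((m, p), k). 1 \<le> m \<and> 1 \<le> p \<and> 1 \<le> k \<and> real (m * p * k) \<le> x}"
      using s by (auto simp: s' sieved_triples_def prime_gt_0_nat Suc_le_eq)
  qed
  have "z ^ 1 \<le> z ^ 2" using z_ge_1 by (intro power_increasing) auto
  then have s1: "{s \<in> T. ?P1 s} = {((m, p), k). 1 \<le> m \<and> prime p \<and> primes_ge p k \<and> z ^ 2 < real p \<and> 1 < k \<and>
      z ^ 4 < real (p * k) \<and> real (p * k) \<le> y \<and> real (m * p * k) \<le> x}" by (auto simp: T_def)
  have s2: "{s \<in> T2. ?P2 s} = {((m, p), k). 1 \<le> m \<and> prime p \<and> primes_ge p k \<and> z < real p \<and> real p \<le> z ^ 2 \<and> 1 < k \<and>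
      real k \<le> z ^ 3 \<and> z ^ 4 < real (p * k) \<and> real (p * k) \<le> y \<and> real (m * p * k) \<le> x}" by (auto simp: T2_def T_def)
  have s3: "{s \<in> T2. \<not> ?P2 s} = {s \<in> sieved_triples y. ?P3 s}"
  proof -
    have "rough z k" if "primes_ge p k" "z < real p" for p k
      using that unfolding rough_def primes_ge_def by (meson of_nat_le_iff order.strict_trans2)
    moreover have "1 \<le> z ^ 3" using z_ge_1 by (rule one_le_power)
    ultimately show ?thesis by (auto simp: T2_def T_def sieved_triples_def)
  qed
  have "norm (sum ?h {s \<in> sieved_triples y. ?P3 s}) \<le> E + 2 * E"
    by (rule norm_sum_diff[OF finS composite_rough[OF assms] least_two_primes_sum[OF assms]])
  then have n3: "norm (sum ?h {s \<in> T2. \<not> ?P2 s}) \<le> E + 2 * E" unfolding s3 .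
  have n2: "norm (sum ?h {s \<in> T2. ?P2 s}) \<le> E" unfolding s2 by (rule composite_cofactor_middle[OF assms])
  have n1: "norm (sum ?h {s \<in> T. ?P1 s}) \<le> E" unfolding s1 by (rule composite_least_large[OF assms])
  have "norm (sum ?h T2) \<le> E + (E + 2 * E)" by (rule norm_sum_split[OF finT2 n2 n3])
  then have "norm (sum ?h T) \<le> E + (E + (E + 2 * E))" unfolding T2_def by (rule norm_sum_split[OF finT n1])
  then show ?thesis unfolding eq by simp
qed

text \<open>All rough numbers beyond \<open>z ^ 4\<close> contribute \<open>E\<close>, and the
  composite ones to be removed \<open>5 * E\<close>. At this size of \<open>p\<close> the smoothness
  of \<open>m\<close> is automatic and does not appear.\<close>

lemma large_primes:
  assumes "1 \<le> y"
  shows "norm (\<Sum>(p, m)\<in>{(p, m). prime p \<and> z ^ 4 < real p \<and> real p \<le> y \<and> 1 \<le> m \<and> real (p * m) \<le> x}. e (p * m)) \<le> 6 * E"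
    (is "norm (sum ?g ?S) \<le> _")
proof -
  define R where "R = {(m, k). rough z k \<and> z ^ 4 < real k \<and> real k \<le> y \<and> 1 \<le> m \<and> real (m * k) \<le> x}"
  let ?h = "\<lambda>(m, k). e (m * k)"
  have finR: "finite R"
  proof (rule finite_subset)
    show "R \<subseteq> {n. real n \<le> x} \<times> {n. real n \<le> x}"
    proof
      fix s assume s: "s \<in> R"
      obtain m k where s': "s = (m, k)" by (cases s)
      have t: "1 \<le> m" "real (m * k) \<le> x" "z ^ 4 < real k" using s by (auto simp: s' R_def)
      have k1: "1 \<le> k" using t(3) z_powers(1) by (cases k) auto
      have "real m \<le> x" "real k \<le> x" by (rule real_le_of_dvd[OF _ _ t(2)]; use t(1) k1 in auto)+
      then show "s \<in> {n. real n \<le> x} \<times> {n. real n \<le> x}" by (simp add: s')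
    qed
  qed (simp add: nat_le_x)
  have s: "{s \<in> R. \<not> prime (snd s)} = {(m, k). rough z k \<and> z ^ 4 < real k \<and> real k \<le> y \<and> 1 \<le> m \<and> real (m * k) \<le> x \<and> \<not> prime k}"
    by (auto simp: R_def)
  have n1: "norm (sum ?h R) \<le> E" unfolding R_def by (rule large_rough[OF assms])
  have n2: "norm (sum ?h {s \<in> R. \<not> prime (snd s)}) \<le> 5 * E" unfolding s by (rule composite_sum[OF assms])
  have "z ^ 1 \<le> z ^ 4" using z_ge_1 by (intro power_increasing) auto
  then have rough: "rough z p" if "prime p" "z ^ 4 < real p" for p
  proof -
    have "z < real p" using that(2) \<open>z ^ 1 \<le> z ^ 4\<close> by simp
    then show ?thesis unfolding rough_def using that(1) primes_dvd_imp_eq by blast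
  qed
  have "sum ?g ?S = sum ?h {s \<in> R. prime (snd s)}"
    by (rule sum.reindex_bij_witness[of _ "\<lambda>(m, p). (p, m)" "\<lambda>(p, m). (m, p)"])
       (auto simp: R_def rough mult_ac)
  then show ?thesis using norm_sum_diff[OF finR n1 n2] by simp
qed

text \<open>Classification by the largest prime factor, with bounds \<open>E\<close> up to
  \<open>z\<close>, \<open>4 * E\<close> in \<open>(z, z ^ 2]\<close>, \<open>E\<close> in
  \<open>(z ^ 2, z ^ 3]\<close>, \<open>E\<close> in \<open>(z ^ 3, z ^ 4]\<close> and
  \<open>6 * E\<close> beyond. The sum \<open>13 * E\<close> is absorbed by one more factor
  \<open>5 * G\<close>.\<close>

lemma smooth_sum_large_y:
  assumes "z \<le> y"
  shows "norm (\<Sum>n\<in>{n. 1 \<le> n \<and> real n \<le> x \<and> y_smooth y n}. e n) \<le> (5 * real G) ^ 16 * Bnd (z ^ 3)"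
    (is "norm (sum e ?S) \<le> _")
proof -
  have y1: "1 \<le> y" using assms z_ge_1 by simp
  have finS: "finite ?S" by (rule finite_subset[OF _ nat_le_x]) auto
  have multiples: "norm (\<Sum>(a, m)\<in>{(a, m). a \<in> A0 \<and> 1 \<le> m \<and> y_smooth z m \<and> real (a * m) \<le> x}. e (a * m)) \<le> E"
    if "A0 \<subseteq> {a. 1 \<le> a \<and> real a \<le> z ^ 2}" for A0
  proof (rule power_Bnd_le_E[of 6])
    have "finite A0" by (rule finite_subset[OF _ nat_le_x]) (use that z_le(6) in auto)
    then show "norm (\<Sum>(a, m)\<in>{(a, m). a \<in> A0 \<and> 1 \<le> m \<and> y_smooth z m \<and> real (a * m) \<le> x}. e (a * m)) \<le>
        (5 * real G) ^ 6 * Bnd (z ^ 3)"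
      by (rule smooth_multiples) (use that z_le z_powers z_ge_1 in \<open>auto simp: one_le_power\<close>)
  qed simp
  have smooth_mono: "y_smooth b m" if "y_smooth a m" "a \<le> b" for a b m
    using that unfolding y_smooth_def by (meson order_trans)
  define LP where "LP = {(p, m). prime p \<and> z < real p \<and> real p \<le> y \<and> 1 \<le> m \<and> y_smooth p m \<and> real (p * m) \<le> x}"
  let ?h = "\<lambda>(p, m). e (p * m)"
  have nz: "norm (sum e {n \<in> ?S. y_smooth z n}) \<le> E"
  proof -
    have "sum e {n \<in> ?S. y_smooth z n} =
        (\<Sum>(a, m)\<in>{(a, m). a \<in> {1} \<and> 1 \<le> m \<and> y_smooth z m \<and> real (a * m) \<le> x}. e (a * m))"
      by (rule sum.reindex_bij_witness[of _ snd "\<lambda>n. (1, n)"]) (use assms smooth_mono in auto)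
    then show ?thesis using multiples[of "{1}"] z_ge_1 by (simp add: one_le_power)
  qed
  have eqLP: "sum e {n \<in> ?S. \<not> y_smooth z n} = sum ?h LP"
  proof -
    \<comment> \<open>\<open>sum_split_greatest\<close> works on pairs, so a dummy index of type
      \<open>unit\<close> is carried along.\<close>
    define D where "D = {(c :: unit, n). n \<in> ?S \<and> \<not> y_smooth z n}"
    have gt: "1 < n" if "(c, n) \<in> D" for c n
      using that z_ge_1 by (cases "n = 1") (auto simp: D_def y_smooth_def)
    have "sum e {n \<in> ?S. \<not> y_smooth z n} = (\<Sum>(c, n)\<in>D. (\<lambda>_ n. e n) c n)"
      by (rule sum.reindex_bij_witness[of _ snd "\<lambda>n. ((), n)"]) (auto simp: D_def)
    also have "\<dots> = (\<Sum>(c, p, k)\<in>{(c, p, k). prime p \<and> y_smooth p k \<and> (c, p * k) \<in> D}. e (p * k))"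
      by (rule sum_split_greatest[OF gt])
    also have "\<dots> = sum ?h LP"
      by (rule sum.reindex_bij_witness[of _ "\<lambda>(p, m). ((), p, m)" "\<lambda>(c, p, m). (p, m)"])
         (auto simp: D_def LP_def y_smooth_mult_iff prime_gt_0_nat Suc_le_eq)
    finally show ?thesis .
  qed
  have finLP: "finite LP"
  proof (rule finite_subset)
    show "LP \<subseteq> {n. real n \<le> x} \<times> {n. real n \<le> x}"
    proof
      fix s assume s: "s \<in> LP"
      obtain p m where s': "s = (p, m)" by (cases s)
      have t: "prime p" "1 \<le> m" "real (p * m) \<le> x" using s by (auto simp: s' LP_def)
      have "real p \<le> x" "real m \<le> x" by (rule real_le_of_dvd[OF _ _ t(3)]; use t(1,2) in \<open>auto simp: prime_gt_0_nat\<close>)+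
      then show "s \<in> {n. real n \<le> x} \<times> {n. real n \<le> x}" by (simp add: s')
    qed
  qed (simp add: nat_le_x)
  let ?P2 = "\<lambda>s. real (fst s) \<le> z ^ 2" and ?P3 = "\<lambda>s. real (fst s) \<le> z ^ 3" and ?P4 = "\<lambda>s. real (fst s) \<le> z ^ 4"
  define L1 where "L1 = {s \<in> LP. ?P2 s}"
  define L2 where "L2 = {s \<in> LP. \<not> ?P2 s}"
  define L3 where "L3 = {s \<in> L2. \<not> ?P3 s}"
  have fin: "finite L1" "finite L2" "finite L3" using finLP by (auto simp: L1_def L2_def L3_def)
  \<comment> \<open>The cofactor is below \<open>z ^ 2\<close>, hence below \<open>p\<close>, and
    cannot contain a larger prime.\<close>
  have auto_smooth: "y_smooth p m" if "z ^ 3 < real p" "real (p * m) \<le> x" "1 \<le> m" for p m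
  proof -
    have "real m < z ^ 2"
    proof (rule ccontr)
      assume "\<not> real m < z ^ 2"
      then have "z ^ 3 * z ^ 2 < real p * real m" using that(1) z_powers(1,7) by (intro mult_less_le_imp_less) auto
      then show False using that(2) z_pow by (simp add: power_add[symmetric])
    qed
    then have "m \<le> p" using that(1) z_le(2) by linarith
    then show ?thesis unfolding y_smooth_def using that(3) by (auto dest!: dvd_imp_le)
  qed
  \<comment> \<open>If no second prime factor exceeds \<open>z\<close>, the number is a prime up to
    \<open>z ^ 2\<close> times a \<open>z\<close>-smooth number, and the cut applies; otherwise the
    two largest primes form an element of \<open>prime_pairs\<close>.\<close>
  have "norm (sum ?h {s \<in> L1. y_smooth z (snd s)}) \<le> E"
  proof -
    define A0 where "A0 = {p. prime p \<and> z < real p \<and> real p \<le> z ^ 2 \<and> real p \<le> y}"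
    have "{s \<in> L1. y_smooth z (snd s)} = {(a, m). a \<in> A0 \<and> 1 \<le> m \<and> y_smooth z m \<and> real (a * m) \<le> x}"
      using smooth_mono[of z] by (auto simp: L1_def LP_def A0_def intro: less_imp_le)
    moreover have "A0 \<subseteq> {a. 1 \<le> a \<and> real a \<le> z ^ 2}" by (auto simp: A0_def prime_gt_0_nat Suc_le_eq)
    ultimately show ?thesis using multiples[of A0] by simp
  qed
  moreover have "norm (sum ?h {s \<in> L1. \<not> y_smooth z (snd s)}) \<le> 3 * E"
  proof -
    define D where "D = {s \<in> L1. \<not> y_smooth z (snd s)}"
    have gt: "1 < m" if "(p, m) \<in> D" for p m
      using that z_ge_1 by (cases "m = 1") (auto simp: D_def L1_def LP_def y_smooth_def)
    have "sum ?h D = (\<Sum>(p, r, k)\<in>{(p, r, k). prime r \<and> y_smooth r k \<and> (p, r * k) \<in> D}. e (p * (r * k)))"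
      by (rule sum_split_greatest[OF gt])
    also have "\<dots> = (\<Sum>((p, r), m)\<in>{((p, r), m). (p, r) \<in> prime_pairs y \<and> 1 \<le> m \<and>
       y_smooth (real r) m \<and> real (p * r * m) \<le> x}. e (p * r * m))"
      by (rule sum.reindex_bij_witness[of _ "\<lambda>((p, r), k). (p, r, k)" "\<lambda>(p, r, k). ((p, r), k)"])
         (auto simp: D_def L1_def LP_def prime_pairs_def y_smooth_mult_iff mult_ac prime_gt_0_nat Suc_le_eq)
    finally show ?thesis using two_primes[of y] by (simp add: D_def)
  qed
  ultimately have "norm (sum ?h L1) \<le> E + 3 * E" by (rule norm_sum_split[OF fin(1)])
  moreover have "norm (sum ?h L2) \<le> E + (E + 6 * E)"
  proof (rule norm_sum_split[OF fin(2), where P = ?P3])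
    have "{s \<in> L2. ?P3 s} = {(p, m). prime p \<and> z ^ 2 < real p \<and> real p \<le> z ^ 3 \<and> real p \<le> y \<and> 1 \<le> m \<and>
       y_smooth (real p) m \<and> real (p * m) \<le> x}" using z_le(1) by (auto simp: L2_def LP_def)
    then show "norm (sum ?h {s \<in> L2. ?P3 s}) \<le> E" using largest_prime_middle[of y] by simp
    have "norm (sum ?h L3) \<le> E + 6 * E"
    proof (rule norm_sum_split[OF fin(3), where P = ?P4])
      have "{s \<in> L3. ?P4 s} = {(p, m). prime p \<and> z ^ 3 < real p \<and> real p \<le> z ^ 4 \<and> real p \<le> y \<and> 1 \<le> m \<and> real (p * m) \<le> x}"
        using z_le auto_smooth by (auto simp: L3_def L2_def LP_def)
      then show "norm (sum ?h {s \<in> L3. ?P4 s}) \<le> E" using largest_prime_upper[of y] by simp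
      have "{s \<in> L3. \<not> ?P4 s} = {(p, m). prime p \<and> z ^ 4 < real p \<and> real p \<le> y \<and> 1 \<le> m \<and> real (p * m) \<le> x}"
        using z_le auto_smooth by (auto simp: L3_def L2_def LP_def)
      then show "norm (sum ?h {s \<in> L3. \<not> ?P4 s}) \<le> 6 * E" using large_primes[OF y1] by simp
    qed
    then show "norm (sum ?h {s \<in> L2. \<not> ?P3 s}) \<le> E + 6 * E" by (simp add: L3_def)
  qed
  ultimately have "norm (sum ?h LP) \<le> (E + 3 * E) + (E + (E + 6 * E))"
    unfolding L1_def L2_def by (rule norm_sum_split[OF finLP])
  then have "norm (sum e {n \<in> ?S. \<not> y_smooth z n}) \<le> (E + 3 * E) + (E + (E + 6 * E))" unfolding eqLP .
  from norm_sum_split[OF finS nz this] have "norm (sum e ?S) \<le> 13 * E" by simp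
  also have "\<dots> \<le> (5 * real G) * E" using E_nonneg G_ge by (intro mult_right_mono) auto
  also have "\<dots> = (5 * real G) ^ 16 * Bnd (z ^ 3)" unfolding E_def by (simp add: eval_nat_numeral)
  finally show ?thesis .
qed

end

section \<open>The divisor bound\<close>

lemma card_divisors_mult_le:
  assumes "0 < m" "0 < (n::nat)"
  shows "card {d. d dvd m * n} \<le> card {d. d dvd m} * card {d. d dvd n}"
proof -
  have "{d. d dvd m * n} \<subseteq> (\<lambda>(b, c). b * c) ` ({d. d dvd m} \<times> {d. d dvd n})"
  proof
    fix d assume "d \<in> {d. d dvd m * n}"
    then obtain b c where "d = b * c" "b dvd m" "c dvd n" using division_decomp[of d m n] by auto
    then show "d \<in> (\<lambda>(b, c). b * c) ` ({d. d dvd m} \<times> {d. d dvd n})" by auto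
  qed
  then have "card {d. d dvd m * n} \<le> card ((\<lambda>(b, c). b * c) ` ({d. d dvd m} \<times> {d. d dvd n}))"
    using assms by (intro card_mono) auto
  also have "\<dots> \<le> card ({d. d dvd m} \<times> {d. d dvd n})" using assms by (intro card_image_le) auto
  finally show ?thesis by (simp add: card_cartesian_product)
qed

lemma card_divisors_prime_power:
  assumes "prime (p::nat)"
  shows "card {d. d dvd p ^ k} \<le> k + 1"
proof -
  have "{d. d dvd p ^ k} \<subseteq> (\<lambda>i. p ^ i) ` {..k}"
    using assms by (auto simp: divides_primepow_nat)
  then have "card {d. d dvd p ^ k} \<le> card ((\<lambda>i. p ^ i) ` {..k})" by (intro card_mono) auto
  also have "\<dots> \<le> card {..k}" by (rule card_image_le) simp
  finally show ?thesis by simp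
qed

text \<open>The primes \<open>p \<ge> 2\<^bsup>1/\<delta>\<^esup>\<close> contribute a factor at most \<open>1\<close> to \<open>d(n) / n\<^bsup>\<delta>\<^esup>\<close>, each of the others at most \<open>K\<close>.\<close>

lemma divisor_bound:
  fixes \<delta> :: real
  assumes "0 < \<delta>"
  shows "\<exists>C\<ge>1. \<forall>n\<ge>1. real (card {d. d dvd n}) \<le> C * real n powr \<delta>"
proof -
  \<comment> \<open>\<open>K\<close> is the price of one small prime, from \<open>a + 1 \<le> K * (1
    + a * \<delta> * ln 2) \<le> K * 2 powr (a * \<delta>)\<close>. From \<open>N\<close> on one has
    \<open>p powr \<delta> \<ge> 2\<close>, and \<open>a + 1 \<le> 2 ^ a\<close> makes the price
    \<open>1\<close>.\<close>
  define K where "K = max 1 (1 / (\<delta> * ln 2))"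
  define N where "N = nat \<lceil>2 powr (1 / \<delta>)\<rceil>"
  have K1: "1 \<le> K" by (simp add: K_def)
  have K: "real a + 1 \<le> K * 2 powr (a * \<delta>)" for a :: nat
  proof -
    have l: "0 < \<delta> * ln 2" using assms by simp
    have "real a = 1 / (\<delta> * ln 2) * (real a * (\<delta> * ln 2))" using assms by simp
    also have "\<dots> \<le> K * (real a * (\<delta> * ln 2))" using l by (intro mult_right_mono) (auto simp: K_def)
    finally have "real a + 1 \<le> K * (1 + real a * (\<delta> * ln 2))" using K1 by (simp add: distrib_left)
    also have "1 + real a * (\<delta> * ln 2) \<le> exp (real a * (\<delta> * ln 2))" by (rule exp_ge_add_one_self)
    also have "\<dots> = 2 powr (a * \<delta>)" by (simp add: powr_def mult_ac)
    finally show ?thesis using K1 by (simp add: mult_left_mono)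
  qed
  \<comment> \<open>Only small primes are paid for, and there are at most \<open>N\<close> of them
    whatever \<open>n\<close> is; so \<open>K ^ N\<close> becomes the constant.\<close>
  define c where "c n = card {p. prime p \<and> p dvd n \<and> p < N}" for n
  have main: "real (card {d. d dvd n}) \<le> K ^ c n * real n powr \<delta>" if "1 \<le> n" for n
    using that
  proof (induction n rule: less_induct)
    case (less n)
    show ?case
    proof (cases "n = 1")
      case True
      have "{d. d dvd (1::nat)} = {1}" by auto
      moreover have "c 1 = 0" by (simp add: c_def)
      ultimately show ?thesis using True by simp
    next
      case False
      then obtain p where p: "prime p" "p dvd n" using prime_factor_nat by blast
      \<comment> \<open>The full power of \<open>p\<close> is removed, so that \<open>p\<close> is
        counted in \<open>c n\<close> but not in \<open>c m\<close>.\<close>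
      obtain m where m: "n = p ^ multiplicity p n * m" "\<not> p dvd m"
        using multiplicity_decompose'[of n p] less.prems p(1) by (metis not_one_le_zero not_prime_unit)
      define a where "a = multiplicity p n"
      have a1: "1 \<le> a" using p less.prems unfolding a_def by (simp add: prime_multiplicity_gt_zero_iff Suc_le_eq)
      have m0: "1 \<le> m" using m(1) less.prems by (cases m) auto
      have pa: "1 < p ^ a" using a1 prime_gt_1_nat[OF p(1)] by (intro one_less_power) auto
      have n: "n = p ^ a * m" using m(1) a_def by simp
      have "m < n" using n pa m0 by simp
      then have IH: "real (card {d. d dvd m}) \<le> K ^ c m * real m powr \<delta>" using less.IH m0 by blast
      have nd: "real n powr \<delta> = (real p powr \<delta>) ^ a * real m powr \<delta>"
        using prime_gt_0_nat[OF p(1)] by (simp add: n powr_mult powr_power powr_realpow[symmetric] powr_powr mult_ac)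
      have "card {d. d dvd n} \<le> card {d. d dvd p ^ a} * card {d. d dvd m}"
        unfolding n using prime_gt_0_nat[OF p(1)] m0 by (intro card_divisors_mult_le) auto
      also have "\<dots> \<le> (a + 1) * card {d. d dvd m}"
        by (intro mult_right_mono card_divisors_prime_power p(1)) simp
      finally have "real (card {d. d dvd n}) \<le> real ((a + 1) * card {d. d dvd m})" by (rule of_nat_mono)
      also have "\<dots> = (real a + 1) * real (card {d. d dvd m})" by (simp add: distrib_right)
      also have "\<dots> \<le> (real a + 1) * (K ^ c m * real m powr \<delta>)" using IH by (intro mult_left_mono) auto
      finally have step: "real (card {d. d dvd n}) \<le> (real a + 1) * (K ^ c m * real m powr \<delta>)" .
      have pd: "r dvd n \<longleftrightarrow> r = p \<or> r dvd m" if "prime r" for r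
        using that p(1) a1 primes_dvd_imp_eq[of r p] by (auto simp: n prime_dvd_mult_iff prime_dvd_power_iff)
      have fin: "finite {r. prime r \<and> r dvd m \<and> r < N}" by simp
      show ?thesis
      proof (cases "p < N")
        case True
        have "{r. prime r \<and> r dvd n \<and> r < N} = insert p {r. prime r \<and> r dvd m \<and> r < N}"
          using pd p True by auto
        then have cn: "c n = c m + 1" unfolding c_def using m(2) fin by simp
        have "2 powr (a * \<delta>) = (2 powr \<delta>) ^ a" by (simp add: powr_power mult.commute)
        also have "\<dots> \<le> (real p powr \<delta>) ^ a"
          using prime_ge_2_nat[OF p(1)] assms by (intro power_mono powr_mono2) auto
        finally have "real a + 1 \<le> K * (real p powr \<delta>) ^ a"
          using K[of a] K1 by (meson mult_left_mono order_trans zero_le_one)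
        then have "(real a + 1) * (K ^ c m * real m powr \<delta>) \<le> K * (real p powr \<delta>) ^ a * (K ^ c m * real m powr \<delta>)"
          using K1 by (intro mult_right_mono) auto
        then show ?thesis using step by (simp add: cn nd mult_ac)
      next
        case False
        have "{r. prime r \<and> r dvd n \<and> r < N} = {r. prime r \<and> r dvd m \<and> r < N}"
          using pd False by auto
        then have cn: "c n = c m" unfolding c_def by simp
        have "2 powr (1 / \<delta>) \<le> real p" using False unfolding N_def by linarith
        then have "(2 powr (1 / \<delta>)) powr \<delta> \<le> real p powr \<delta>" using assms by (intro powr_mono2) auto
        then have "2 \<le> real p powr \<delta>" using assms by (simp add: powr_powr)
        then have "2 ^ a \<le> (real p powr \<delta>) ^ a" by (intro power_mono) auto
        moreover have "real a + 1 \<le> 2 ^ a"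
        proof -
          have "a + 1 \<le> 2 ^ a" by (simp add: Suc_le_eq)
          then have "real (a + 1) \<le> real (2 ^ a)" by (rule of_nat_mono)
          then show ?thesis by simp
        qed
        ultimately have "real a + 1 \<le> (real p powr \<delta>) ^ a" by linarith
        then have "(real a + 1) * (K ^ c m * real m powr \<delta>) \<le> (real p powr \<delta>) ^ a * (K ^ c m * real m powr \<delta>)"
          using K1 by (intro mult_right_mono) auto
        then show ?thesis using step by (simp add: cn nd mult_ac)
      qed
    qed
  qed
  have "real (card {d. d dvd n}) \<le> K ^ N * real n powr \<delta>" if "1 \<le> n" for n
  proof -
    have "c n \<le> card {..<N}" unfolding c_def by (rule card_mono) auto
    then have "K ^ c n \<le> K ^ N" using K1 by (intro power_increasing) auto
    then have "K ^ c n * real n powr \<delta> \<le> K ^ N * real n powr \<delta>" by (intro mult_right_mono) auto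
    then show ?thesis using main[OF that] by linarith
  qed
  then show ?thesis using K1 by (intro exI[of _ "K ^ N"]) (auto simp: one_le_power)
qed

text \<open>The value of \<open>G\<close> used for a given \<open>x\<close>: \<open>10\<close> for
  the numerical constants, the logarithm for the dyadic scales, the maximum for the divisor
  counts.\<close>

definition growth :: "real \<Rightarrow> nat" where
  "growth x = 10 + nat \<lceil>log 2 x\<rceil> + Max (insert 0 ((\<lambda>n. card {d. d dvd n}) ` {1..nat \<lfloor>x\<rfloor>}))"

lemma growth_props:
  assumes "1 \<le> x"
  shows "x \<le> 2 ^ growth x" "10 \<le> growth x" "\<And>n. 1 \<le> n \<Longrightarrow> real n \<le> x \<Longrightarrow> card {d. d dvd n} \<le> growth x"
proof -
  have "x = 2 powr (log 2 x)" using assms by simp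
  also have "\<dots> \<le> 2 powr real (growth x)"
  proof (rule powr_mono)
    have "log 2 x \<le> real (nat \<lceil>log 2 x\<rceil>)" by linarith
    then show "log 2 x \<le> real (growth x)" unfolding growth_def by linarith
  qed simp
  finally show "x \<le> 2 ^ growth x" by (simp add: powr_realpow)
  show "10 \<le> growth x" by (simp add: growth_def)
  fix n :: nat assume "1 \<le> n" "real n \<le> x"
  then have "card {d. d dvd n} \<le> Max (insert 0 ((\<lambda>n. card {d. d dvd n}) ` {1..nat \<lfloor>x\<rfloor>}))"
    by (intro Max_ge) (auto simp: le_nat_floor)
  then show "card {d. d dvd n} \<le> growth x" by (simp add: growth_def)
qed

text \<open>This makes any fixed power of \<open>growth x\<close> a factor x^(o(1)).\<close>

lemma growth_bound:
  fixes \<delta> :: real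
  assumes "0 < \<delta>"
  shows "\<exists>C>0. \<forall>x\<ge>1. real (growth x) \<le> C * x powr \<delta>"
proof -
  obtain C where C: "1 \<le> C" "\<And>n. 1 \<le> n \<Longrightarrow> real (card {d. d dvd n}) \<le> C * real n powr \<delta>"
    using divisor_bound[OF assms] by blast
  define B where "B = 11 + 1 / (\<delta> * ln 2) + C"
  have "real (growth x) \<le> B * x powr \<delta>" if x: "1 \<le> x" for x
  proof -
    have x1: "1 \<le> x powr \<delta>" using x assms by (simp add: ge_one_powr_ge_zero)
    have "ln x \<le> x powr \<delta> / \<delta>" using ln_powr_bound[OF x assms] .
    then have "log 2 x \<le> x powr \<delta> / \<delta> / ln 2" unfolding log_def by (intro divide_right_mono) auto
    moreover have "0 \<le> log 2 x" using x by simp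
    then have "real (nat \<lceil>log 2 x\<rceil>) \<le> log 2 x + 1" by linarith
    ultimately have 1: "real (nat \<lceil>log 2 x\<rceil>) \<le> 1 / (\<delta> * ln 2) * x powr \<delta> + 1" by (simp add: field_simps)
    let ?M = "Max (insert 0 ((\<lambda>n. card {d. d dvd n}) ` {1..nat \<lfloor>x\<rfloor>}))"
    have "?M \<in> insert 0 ((\<lambda>n. card {d. d dvd n}) ` {1..nat \<lfloor>x\<rfloor>})" by (rule Max_in) auto
    then have 2: "real ?M \<le> C * x powr \<delta>"
    proof
      assume "?M = 0"
      then show ?thesis using C(1) by simp
    next
      assume "?M \<in> (\<lambda>n. card {d. d dvd n}) ` {1..nat \<lfloor>x\<rfloor>}"
      then obtain n where n: "?M = card {d. d dvd n}" "1 \<le> n" "n \<le> nat \<lfloor>x\<rfloor>" by auto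
      have "real n \<le> x" using n(3) x by linarith
      then have "real n powr \<delta> \<le> x powr \<delta>" using assms by (intro powr_mono2) auto
      then have "C * real n powr \<delta> \<le> C * x powr \<delta>" using C(1) by (intro mult_left_mono) auto
      then show ?thesis using C(2)[OF n(2)] n(1) by linarith
    qed
    have "real (growth x) = 10 + real (nat \<lceil>log 2 x\<rceil>) + real ?M" unfolding growth_def by simp
    also have "\<dots> \<le> 11 * x powr \<delta> + 1 / (\<delta> * ln 2) * x powr \<delta> + C * x powr \<delta>" using 1 2 x1 by linarith
    also have "\<dots> = B * x powr \<delta>" by (simp add: B_def distrib_right)
    finally show ?thesis .
  qed
  moreover have "0 < B" using C(1) assms by (simp add: B_def add_pos_nonneg)
  ultimately show ?thesis by blast
qed

text \<open>Chosen so that, for \<open>x > 1\<close>, \<open>x powr eps x\<close> is exactly the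
  total loss. It depends on \<open>x\<close> alone, which is the uniformity in \<open>y\<close>,
  \<open>a\<close> and \<open>q\<close>.\<close>

definition eps :: "real \<Rightarrow> real" where
  "eps x = ln ((5 * real (growth x)) ^ 16) / ln x"

lemma eps_tendsto: "(eps \<longlongrightarrow> 0) at_top"
proof (rule tendstoI)
  fix \<eta> :: real assume \<eta>: "0 < \<eta>"
  \<comment> \<open>\<open>eps x\<close> is at most
    \<open>16 * (\<bar>ln (5 * C)\<bar> + \<delta> * ln x) / ln x\<close>. This
    \<open>\<delta>\<close> makes the second part \<open>\<eta> / 2\<close>; the first drops below
    \<open>\<eta> / 2\<close> once \<open>ln x\<close> is large.\<close>
  define \<delta> where "\<delta> = \<eta> / 32"
  have \<delta>: "0 < \<delta>" using \<eta> by (simp add: \<delta>_def)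
  obtain C where C: "0 < C" "\<And>x. 1 \<le> x \<Longrightarrow> real (growth x) \<le> C * x powr \<delta>" using growth_bound[OF \<delta>] by blast
  have "\<forall>\<^sub>F x in at_top. max 1 (32 * \<bar>ln (5 * C)\<bar> / \<eta>) < ln (x::real)"
    using ln_at_top unfolding filterlim_at_top_dense by blast
  then show "\<forall>\<^sub>F x in at_top. dist (eps x) 0 < \<eta>"
    using eventually_gt_at_top[of 1]
  proof eventually_elim
    case (elim x)
    have g: "10 \<le> growth x" using growth_props(2)[of x] elim(2) by simp
    have l: "1 < ln x" "32 * \<bar>ln (5 * C)\<bar> < \<eta> * ln x"
      using elim(1) \<eta> by (auto simp: field_simps)
    have "ln (5 * real (growth x)) \<le> ln (5 * C * x powr \<delta>)"
      using C(2)[of x] elim(2) g by (intro ln_mono) auto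
    also have "\<dots> = ln (5 * C) + \<delta> * ln x" using C(1) elim(2) by (simp add: ln_mult ln_powr)
    finally have "16 * ln (5 * real (growth x)) \<le> 16 * \<bar>ln (5 * C)\<bar> + \<eta> / 2 * ln x" by (simp add: \<delta>_def)
    also have "\<dots> < \<eta> * ln x" using l by simp
    finally have "16 * ln (5 * real (growth x)) < \<eta> * ln x" .
    moreover have "ln ((5 * real (growth x)) ^ 16) = 16 * ln (5 * real (growth x))" using g ln_realpow[of "5 * real (growth x)" 16] by simp
    ultimately have "eps x < \<eta>" using l(1) unfolding eps_def by (simp add: divide_less_eq)
    moreover have "0 \<le> eps x" unfolding eps_def using g l(1) elim(2) by (intro divide_nonneg_nonneg ln_ge_zero one_le_power) auto
    ultimately show ?case by simp
  qed
qed

section \<open>From \<open>Bnd\<close> to the three terms of the theorem\<close>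

context exp_sum_setting
begin

text \<open>By subadditivity of the square root, \<open>x / q\<close> and \<open>q\<close> inside
  \<open>Bnd\<close> produce the two terms depending on \<open>q\<close>, and \<open>V\<close> is
  left to produce the minimum.\<close>

lemma Bnd_le:
  assumes "0 \<le> V"
  shows "Bnd V \<le> sqrt (x * V) + x * real q powr (- 1 / 2) + x * (x / q) powr (- 1 / 2)"
proof -
  have q: "0 < real q" using q_pos by simp
  have x: "0 < x" using x_ge_1 by simp
  have "Bnd V = sqrt (x * V + x * (x / q) + x * q)" unfolding Bnd_def by (simp add: algebra_simps)
  also have "\<dots> \<le> sqrt (x * V + x * (x / q)) + sqrt (x * q)"
    using assms x q by (intro sqrt_add_le_add_sqrt) auto
  also have "\<dots> \<le> sqrt (x * V) + sqrt (x * (x / q)) + sqrt (x * q)"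
    using sqrt_add_le_add_sqrt[of "x * V" "x * (x / q)"] assms x q by simp
  also have "sqrt (x * (x / q)) = x * real q powr (- 1 / 2)"
    using q x by (simp add: real_sqrt_mult real_sqrt_divide powr_minus powr_half_sqrt inverse_eq_divide)
  also have "sqrt (x * q) = x * (x / q) powr (- 1 / 2)"
  proof -
    have "(x / q) powr (- 1 / 2) = sqrt q / sqrt x"
      using q x by (simp add: real_sqrt_divide powr_minus powr_half_sqrt inverse_eq_divide)
    then have "x * (x / q) powr (- 1 / 2) = x / sqrt x * sqrt q" by simp
    also have "\<dots> = sqrt (x * q)" using x by (simp add: real_div_sqrt real_sqrt_mult)
    finally show ?thesis by simp
  qed
  finally show ?thesis .
qed

text \<open>The choice \<open>U = sqrt (x / y)\<close> makes \<open>U * y\<close> and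
  \<open>x / U\<close> equal, both being \<open>sqrt (x * y)\<close>.\<close>

lemma smooth_sum_small_y:
  assumes "1 \<le> y" "y \<le> x"
  shows "norm (\<Sum>n\<in>{n. 1 \<le> n \<and> real n \<le> x \<and> y_smooth y n}. e n) \<le> (5 * real G) ^ 6 * Bnd (sqrt (x * y))"
proof -
  have y: "0 < y" and x: "0 < x" using assms by auto
  have U: "1 \<le> sqrt (x / y)" using assms y by simp
  have m: "sqrt (x / y) * y = sqrt (x * y)"
    using y by (simp add: real_sqrt_mult real_sqrt_divide) (metis real_sqrt_divide real_div_sqrt less_imp_le times_divide_eq_right mult.commute)
  have d: "x / sqrt (x / y) = sqrt (x * y)"
  proof -
    have "sqrt (x * y) * sqrt (x / y) = sqrt (x * x)" using y by (simp add: real_sqrt_mult[symmetric])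
    also have "\<dots> = x" using x by simp
    finally have "x = sqrt (x * y) * sqrt (x / y)" by simp
    moreover have "sqrt (x / y) \<noteq> 0" using x y by simp
    ultimately show ?thesis using nonzero_eq_divide_eq by metis
  qed
  have "norm (\<Sum>(a, m)\<in>{(a, m). a \<in> {1} \<and> 1 \<le> m \<and> y_smooth y m \<and> real (a * m) \<le> x}. e (a * m)) \<le>
    (5 * real G) ^ 6 * Bnd (sqrt (x * y))"
  proof (rule smooth_multiples)
    show "sqrt (x / y) \<le> sqrt (x * y)"
    proof (rule real_sqrt_le_mono)
      have "x / y \<le> x" "x \<le> x * y" using assms x by (auto simp: field_simps)
      then show "x / y \<le> x * y" by linarith
    qed
    have "sqrt (x / y) \<le> sqrt (x * x)"
    proof (rule real_sqrt_le_mono)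
      have "x / y \<le> x" "x \<le> x * x" using assms x by (auto simp: field_simps)
      then show "x / y \<le> x * x" by linarith
    qed
    then show "sqrt (x / y) \<le> x" using x by simp
  qed (use U m d in auto)
  moreover have "(\<Sum>n\<in>{n. 1 \<le> n \<and> real n \<le> x \<and> y_smooth y n}. e n) =
    (\<Sum>(a, m)\<in>{(a, m). a \<in> {1} \<and> 1 \<le> m \<and> y_smooth y m \<and> real (a * m) \<le> x}. e (a * m))"
    by (rule sum.reindex_bij_witness[of _ snd "\<lambda>n. (1, n)"]) auto
  ultimately show ?thesis by simp
qed

text \<open>The two entries of the minimum agree at \<open>y = x powr (1 / 5)\<close>, so the switch
  between the two methods is also the switch of the minimum.\<close>

lemma smooth_sum_bound:
  assumes "2 \<le> y" "y \<le> x"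
  shows "norm (\<Sum>n\<in>{n. 1 \<le> n \<and> real n \<le> x \<and> y_smooth y n}. e n) \<le> (5 * real G) ^ 16 *
     (x * (min (x powr (- 1 / 5)) ((x / y) powr (- 1 / 4)) + real q powr (- 1 / 2) + (x / q) powr (- 1 / 2)))"
    (is "norm ?S \<le> _ * (x * (?m + ?a + ?b))")
proof -
  have x: "0 < x" and y: "0 < y" using assms by auto
  have fin: "norm ?S \<le> (5 * real G) ^ 16 * (x * (?m + ?a + ?b))"
    if b: "norm ?S \<le> (5 * real G) ^ j * Bnd V" and j: "j \<le> 16" and V: "0 \<le> V" and s: "sqrt (x * V) \<le> x * ?m" for j V
  proof -
    have "(5 * real G) ^ j * Bnd V \<le> (5 * real G) ^ 16 * Bnd V"
      using j G_ge Bnd_ge(4)[OF V] by (intro mult_right_mono power_increasing) auto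
    also have "\<dots> \<le> (5 * real G) ^ 16 * (x * (?m + ?a + ?b))"
      using Bnd_le[OF V] s by (intro mult_left_mono) (auto simp: distrib_left)
    finally show ?thesis using b by linarith
  qed
  have x5: "x * x powr (- 1 / 5) = x powr (4 / 5)" using x powr_mult_base[of x "- 1 / 5"] by simp
  show ?thesis
  proof (cases "x powr (1 / 5) \<le> y")
    case True
    define z where "z = x powr (1 / 5)"
    have z5: "z ^ 5 = x" using x by (simp add: z_def powr_power)
    have z1: "1 \<le> z" using x_ge_1 by (simp add: z_def ge_one_powr_ge_zero)
    interpret fifth_root_setting a q x G z by unfold_locales (fact z5, fact z1)
    have "x * z ^ 3 = (x powr (4 / 5)) ^ 2" using x by (simp add: z_def powr_power powr_mult_base)
    then have "sqrt (x * z ^ 3) = x powr (4 / 5)" by simp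
    moreover have "x powr (- 1 / 5) \<le> (x / y) powr (- 1 / 4)"
    proof -
      have "x / y \<le> x / x powr (1 / 5)" using True x y by (intro divide_left_mono) auto
      also have "\<dots> = x powr (4 / 5)" using x powr_diff[of x 1 "1 / 5"] by simp
      finally have "(x powr (4 / 5)) powr (- 1 / 4) \<le> (x / y) powr (- 1 / 4)"
        using x y by (intro powr_mono2') auto
      then show ?thesis by (simp add: powr_powr)
    qed
    then have "?m = x powr (- 1 / 5)" by simp
    ultimately have "sqrt (x * z ^ 3) \<le> x * ?m" using x5 by simp
    with smooth_sum_large_y[of y] True z_powers(6) show ?thesis by (intro fin[of 16 "z ^ 3"]) (auto simp: z_def)
  next
    case False
    have b: "norm ?S \<le> (5 * real G) ^ 6 * Bnd (sqrt (x * y))" by (rule smooth_sum_small_y) (use assms in auto)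
    have "x powr (4 / 5) = x / x powr (1 / 5)" using x powr_diff[of x 1 "1 / 5"] by simp
    also have "\<dots> \<le> x / y" using False x y by (intro divide_left_mono) auto
    finally have "(x / y) powr (- 1 / 4) \<le> (x powr (4 / 5)) powr (- 1 / 4)"
      using x by (intro powr_mono2') auto
    then have m: "?m = (x / y) powr (- 1 / 4)" by (simp add: powr_powr)
    \<comment> \<open>Both sides of the comparison are x^(3/4) y^(1/4), the right one in the guise x
      (x/y)^(-1/4).\<close>
    have "sqrt (x * sqrt (x * y)) = (x * (x * y) powr (1 / 2)) powr (1 / 2)"
      using x y by (simp add: powr_half_sqrt)
    also have "\<dots> = x powr (1 / 2) * ((x * y) powr (1 / 2)) powr (1 / 2)" by (rule powr_mult)
    also have "\<dots> = x powr (1 / 2) * (x powr (1 / 4) * y powr (1 / 4))"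
      by (simp add: powr_powr powr_mult)
    also have "\<dots> = x powr (1 / 2 + 1 / 4) * y powr (1 / 4)"
      unfolding powr_add[of x "1 / 2" "1 / 4"] by (simp only: mult.assoc)
    also have "\<dots> = x powr (1 + - 1 / 4) * y powr (1 / 4)" by simp
    also have "\<dots> = x * (x powr (- 1 / 4) * y powr (1 / 4))" 
      using x unfolding powr_add[of x 1 "- 1 / 4"] by simp
    also have "x powr (- 1 / 4) * y powr (1 / 4) = (x / y) powr (- 1 / 4)"
      using x y by (simp add: powr_divide powr_minus field_simps)
    finally have "sqrt (x * sqrt (x * y)) \<le> x * ?m" unfolding m by simp
    then show ?thesis using b x y by (intro fin[of 6 "sqrt (x * y)"]) auto
  qed
qed

end

theorem theorem1p1:
  "\<exists>\<epsilon> :: real \<Rightarrow> real. (\<epsilon> \<longlongrightarrow> 0) at_top \<and>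
     (\<forall>(q :: int) (a :: int) (x :: real) (y :: real).
        q \<ge> 1 \<longrightarrow> gcd a q = 1 \<longrightarrow> x \<ge> y \<longrightarrow> y \<ge> 2 \<longrightarrow>
        norm (smooth_exp_sum a q x y) \<le>
          x powr (1 + \<epsilon> x) *
            (min (x powr (-1/5)) ((x / y) powr (-1/4))
             + real_of_int q powr (-1/2) + (x / real_of_int q) powr (-1/2)))"
proof (intro exI[of _ eps] conjI allI impI)
  show "(eps \<longlongrightarrow> 0) at_top" by (rule eps_tendsto)
  fix q a :: int and x y :: real
  assume q: "q \<ge> 1" and g: "gcd a q = 1" and xy: "x \<ge> y" and y: "y \<ge> 2"
  define n where "n = nat q"
  have qn: "q = int n" "1 \<le> n" using q by (auto simp: n_def)
  have x: "2 \<le> x" using xy y by simp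
  note gp = growth_props[of x]
  interpret additive_char a n
    by unfold_locales (use qn g in \<open>auto simp: coprime_iff_gcd_eq_1\<close>)
  let ?S = "{m. 1 \<le> m \<and> real m \<le> x \<and> y_smooth y m}"
  have "e_mod q (of_int (a * int m)) = e m" for m
    unfolding e_mod_def e_def cis_conv_exp qn(1) by (rule arg_cong[where f = exp]) (simp add: field_simps)
  then have eq: "smooth_exp_sum a q x y = sum e ?S"
    unfolding smooth_exp_sum_def using y by (simp add: smooth_upto_eq)
  have xe: "x powr (1 + eps x) = (5 * real (growth x)) ^ 16 * x"
  proof -
    have "x powr eps x = (5 * real (growth x)) ^ 16"
      using x gp(2) by (simp add: powr_def eps_def)
    then show ?thesis using x by (simp add: powr_add)
  qed
  let ?r = "min (x powr (-1/5)) ((x / y) powr (-1/4)) + real n powr (-1/2) + (x / real n) powr (-1/2)"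
  have "norm (sum e ?S) \<le> (5 * real (growth x)) ^ 16 * (x * ?r)"
  proof (cases "real n \<le> x")
    case True
    interpret exp_sum_setting a n x "growth x"
      by unfold_locales (use True gp x in auto)
    show ?thesis by (rule smooth_sum_bound[OF y xy])
  next
    \<comment> \<open>For \<open>q > x\<close> the term \<open>(x / q) powr (- 1 / 2)\<close> is at
      least \<open>1\<close>, so counting the integers up to \<open>x\<close> is enough.\<close>
    case False
    have "norm (sum e ?S) \<le> (\<Sum>m\<in>?S. 1)" by (rule sum_norm_le) simp
    also have "\<dots> = real (card ?S)" by simp
    also have "\<dots> \<le> real (card {1..nat \<lfloor>x\<rfloor>})"
      by (intro of_nat_mono card_mono) (auto simp: le_nat_floor)
    also have "\<dots> \<le> x" using x by simp
    also have "\<dots> \<le> x * ?r"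
    proof -
      have "1 powr (-1/2) \<le> (x / real n) powr (-1/2)"
        using False x by (intro powr_mono2') auto
      then have "1 \<le> ?r" using x by (simp add: add_increasing)
      then show ?thesis using x by simp
    qed
    also have "\<dots> \<le> (5 * real (growth x)) ^ 16 * (x * ?r)"
    proof -
      have "1 \<le> (5 * real (growth x)) ^ 16" using gp(2) x by (intro one_le_power) auto
      moreover have "0 \<le> x * ?r" using x by simp
      ultimately show ?thesis by (metis mult_le_cancel_right1 not_le)
    qed
    finally show ?thesis .
  qed
  moreover have "real n = real_of_int q" using q by (simp add: n_def)
  ultimately show "norm (smooth_exp_sum a q x y) \<le> x powr (1 + eps x) *
            (min (x powr (-1/5)) ((x / y) powr (-1/4))
             + real_of_int q powr (-1/2) + (x / real_of_int q) powr (-1/2))"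
    unfolding eq xe by (simp only: mult.assoc)
qed

end
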